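(* Let $\rho\in(0,1)$ and, for each $n\ge2$, let $(X_k)_{-p+1\le k\le n}$ be an INAR($p$) process with a change only in the innovation mean after time $\tau=\max(\lfloor n\rho\rfloor,1)$: the innovation mean changes from $\mu'$ to $\mu''$, where $\mu'>\mu''>0$, while the coefficients $\alpha_1,\dots,\alpha_p$ stay constant. Suppose that $\operatorname E(X_0^6)<\infty,\dots,\operatorname E(X_{-p+1}^6)<\infty$, $\operatorname E(\varepsilon_1^6)<\infty$, $\operatorname E(\varepsilon_{\tau+1}^6)<\infty$, $\alpha_1+\cdots+\alpha_p<1$, and that $\alpha_1+\cdots+\alpha_p>0$ or the innovation variance is positive both before and after the change. Then for any $\gamma\in(0,\tfrac14)$, $$\max_{1\le k\le n}\sum_{j=1}^k\widehat M_j^{(n)}=n\psi+\mathrm O_{\operatorname P}(n^{1-\gamma})\qquad\text{as }n\to\infty,$$ with $$\psi:=\rho(1-\rho)(\mu'-\mu'')\,\boldsymbol e_{p+1}^\top\boldsymbol C''\widetilde{\boldsymbol Q}^{-1}\boldsymbol C'\boldsymbol e_{p+1}>0,$$ where $\boldsymbol e_{p+1}$ is the $(p+1)$-st unit vector of $\mathbb R^{p+1}$.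
   Context: For each $n$ the process satisfies $$X_k=\sum_{i=1}^p\sum_{j=1}^{X_{k-i}}\xi_{i,k,j}+\varepsilon_k,\qquad 1\le k\le n,$$ where for each $k$ and $i$ the variables $\{\xi_{i,k,j}:j\in\mathbb N\}$ are i.i.d. Bernoulli with mean $\alpha_i$; the innovations $\varepsilon_k$ are independent non-negative integer-valued with finite variance, $\varepsilon_1,\dots,\varepsilon_\tau$ being identically distributed with mean $\mu'$ and $\varepsilon_{\tau+1},\dots,\varepsilon_n$ identically distributed with mean $\mu''$; all the sequences $\{\xi_{i,k,j}\}_j$ are mutually independent and independent of the innovations; $X_0,\dots,X_{-p+1}$ are non-negative integer-valued and independent of all $\xi_{i,k,j},\varepsilon_k$. The distribution of $(X_0,\dots,X_{-p+1})$, the coefficients, and the two innovation laws do not depend on $n$; only the change point $\tau=\tau(n)$ does (the dependence of the process on $n$ is suppressed in notation). Put $\boldsymbol X_k:=(X_k,\dots,X_{k-p+1})^\top$ and $$\boldsymbol Q_n:=\sum_{k=1}^n\begin{bmatrix}\boldsymbol X_{k-1}\\1\end{bmatrix}\begin{bmatrix}\boldsymbol X_{k-1}\\1\end{bmatrix}^\top,\quad \widehat{\boldsymbol\theta}_n:=\boldsymbol Q_n^{-1}\sum_{k=1}^nX_k\begin{bmatrix}\boldsymbol X_{k-1}\\1\end{bmatrix},\quad \widehat M_k^{(n)}:=X_k-\widehat{\boldsymbol\theta}_n^\top\begin{bmatrix}\boldsymbol X_{k-1}\\1\end{bmatrix}.$$ ($\boldsymbol Q_n$ is invertible with probability tending to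 $1$; on the complement $\widehat{\boldsymbol\theta}_n$ may be defined arbitrarily.) Let $\widetilde{\boldsymbol X}'$ (resp. $\widetilde{\boldsymbol X}''$) be a random vector whose law is the unique stationary distribution of the Markov chain $(\boldsymbol X_k)$ of the time-homogeneous INAR($p$) process with the parameters and innovation law valid before (resp. after) the change, and $$\boldsymbol C':=\operatorname E\left(\begin{bmatrix}\widetilde{\boldsymbol X}'\\1\end{bmatrix}\begin{bmatrix}\widetilde{\boldsymbol X}'\\1\end{bmatrix}^\top\right),\quad \boldsymbol C'':=\operatorname E\left(\begin{bmatrix}\widetilde{\boldsymbol X}''\\1\end{bmatrix}\begin{bmatrix}\widetilde{\boldsymbol X}''\\1\end{bmatrix}^\top\right),\quad \widetilde{\boldsymbol Q}:=\rho\boldsymbol C'+(1-\rho)\boldsymbol C''.$$ *)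

theory Defs
  imports
    "HOL-Probability.Probability"
    "Jordan_Normal_Form.Gauss_Jordan_Elimination"
begin

text \<open>
  Vectors and matrices are those of \<open>Jordan_Normal_Form\<close>, whose dimensions are natural numbers and
  whose indices start at 0; the homonymous notions of \<open>HOL-Analysis\<close> are hidden.
\<close>

unbundle no vec_syntax
hide_type (open) Finite_Cartesian_Product.vec
hide_const (open)
  Finite_Cartesian_Product.vec Finite_Cartesian_Product.mat Finite_Cartesian_Product.row

subsection \<open>INAR processes with one change\<close>

definition bernoulli_nat :: "real \<Rightarrow> nat pmf" where
  "bernoulli_nat a = map_pmf of_bool (bernoulli_pmf a)"

text \<open>The vector \<open>(X\<^sub>k, \<dots>, X\<^sub>k\<^sub>-\<^sub>p\<^sub>+\<^sub>1)\<close>; its component with index \<open>i\<close> is \<open>X\<^sub>k\<^sub>-\<^sub>i\<close>.\<close>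

definition state :: "nat \<Rightarrow> (int \<Rightarrow> 'a \<Rightarrow> nat) \<Rightarrow> int \<Rightarrow> 'a \<Rightarrow> nat vec" where
  "state p X k \<omega> = vec p (\<lambda>i. X (k - int i) \<omega>)"

text \<open>
  All thinning variables \<open>\<xi> i k j\<close> and all innovations \<open>\<epsilon> k\<close> of a process observed up to time \<open>n\<close>,
  as one family of random variables.
\<close>

type_synonym noise_index = "(nat \<times> nat \<times> nat) + nat"

definition noise_indices :: "nat \<Rightarrow> nat \<Rightarrow> noise_index set" where
  "noise_indices p n = ({1..p} \<times> {1..n} \<times> {1..}) <+> {1..n}"

definition noise ::
  "(nat \<Rightarrow> nat \<Rightarrow> nat \<Rightarrow> 'a \<Rightarrow> nat) \<Rightarrow> (nat \<Rightarrow> 'a \<Rightarrow> nat) \<Rightarrow> noise_index \<Rightarrow> 'a \<Rightarrow> nat" where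
  "noise \<xi> \<epsilon> = case_sum (\<lambda>(i, k, j). \<xi> i k j) \<epsilon>"

text \<open>
  The coefficients are \<open>\<alpha> 1, \<dots>, \<alpha> p\<close>, the law of the initial vector is \<open>G\<close>, and the innovations have
  law \<open>F'\<close> up to time \<open>\<tau>\<close> and law \<open>F''\<close> afterwards. The components of the initial vector may be
  dependent; that vector is independent of the whole noise family. Independence is stated for the
  generated \<open>\<sigma>\<close>-algebras because \<open>indep_var\<close> needs both random elements in the same type.
\<close>

locale inar_with_change = prob_space M
  for M :: "'a measure" and p n \<tau> :: nat and \<alpha> :: "nat \<Rightarrow> real"
    and G :: "nat vec pmf" and F' F'' :: "nat pmf"
    and \<xi> :: "nat \<Rightarrow> nat \<Rightarrow> nat \<Rightarrow> 'a \<Rightarrow> nat" and \<epsilon> :: "nat \<Rightarrow> 'a \<Rightarrow> nat" and X :: "int \<Rightarrow> 'a \<Rightarrow> nat" +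
  assumes recursion:
      "\<And>k \<omega>. k \<in> {1..n} \<Longrightarrow> \<omega> \<in> space M \<Longrightarrow>
        X (int k) \<omega> = (\<Sum>i=1..p. \<Sum>j=1..X (int k - int i) \<omega>. \<xi> i k j \<omega>) + \<epsilon> k \<omega>"
    and thinning_law:
      "\<And>i k j. i \<in> {1..p} \<Longrightarrow> k \<in> {1..n} \<Longrightarrow> 1 \<le> j \<Longrightarrow>
        distr M (count_space UNIV) (\<xi> i k j) = measure_pmf (bernoulli_nat (\<alpha> i))"
    and innovation_law:
      "\<And>k. k \<in> {1..n} \<Longrightarrow>
        distr M (count_space UNIV) (\<epsilon> k) = measure_pmf (if k \<le> \<tau> then F' else F'')"
    and initial_law:
      "distr M (count_space UNIV) (state p X 0) = measure_pmf G"
    and noise_indep: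
      "indep_vars (\<lambda>_. count_space UNIV) (noise \<xi> \<epsilon>) (noise_indices p n)"
    and initial_indep:
      "indep_set
        (sets (vimage_algebra (space M) (state p X 0) (count_space UNIV)))
        (sets (vimage_algebra (space M)
          (\<lambda>\<omega>. \<lambda>s\<in>noise_indices p n. noise \<xi> \<epsilon> s \<omega>)
          (PiM (noise_indices p n) (\<lambda>_. count_space UNIV))))"

subsection \<open>Stationary distributions of the time-homogeneous chain\<close>

text \<open>
  One step of the Markov chain of state vectors of the time-homogeneous INAR process with innovation
  law \<open>F\<close>: from \<open>x\<close>, draw independent thinning variables \<open>b (i, j)\<close> with \<open>1 \<le> j \<le> x\<^sub>i\<close> (the lag-\<open>i\<close>
  component, stored at index \<open>i - 1\<close>) and an innovation \<open>e\<close>, put the new value in front and shift.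
\<close>

definition inar_kernel :: "nat \<Rightarrow> (nat \<Rightarrow> real) \<Rightarrow> nat pmf \<Rightarrow> nat vec \<Rightarrow> nat vec pmf" where
  "inar_kernel p \<alpha> F x =
    bind_pmf (Pi_pmf (SIGMA i:{1..p}. {1..x $ (i - 1)}) 0 (\<lambda>(i, j). bernoulli_nat (\<alpha> i))) (\<lambda>b.
    bind_pmf F (\<lambda>e.
    return_pmf (vec p (\<lambda>m.
      if m = 0 then (\<Sum>i=1..p. \<Sum>j=1..x $ (i - 1). b (i, j)) + e else x $ (m - 1)))))"

definition inar_stationary :: "nat \<Rightarrow> (nat \<Rightarrow> real) \<Rightarrow> nat pmf \<Rightarrow> nat vec pmf \<Rightarrow> bool" where
  "inar_stationary p \<alpha> F \<pi> \<longleftrightarrow>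
    set_pmf \<pi> \<subseteq> carrier_vec p \<and> bind_pmf \<pi> (inar_kernel p \<alpha> F) = \<pi>"

subsection \<open>Conditional least squares\<close>

text \<open>The vector \<open>x\<close> extended by a last component 1.\<close>

definition regressor :: "nat vec \<Rightarrow> real vec" where
  "regressor x = vec (dim_vec x + 1) (\<lambda>a. if a < dim_vec x then real (x $ a) else 1)"

definition second_moment :: "nat \<Rightarrow> nat vec pmf \<Rightarrow> real mat" where
  "second_moment p \<pi> = mat (p + 1) (p + 1) (\<lambda>(a, b).
    measure_pmf.expectation \<pi> (\<lambda>x. regressor x $ a * regressor x $ b))"

definition Q_matrix :: "nat \<Rightarrow> nat \<Rightarrow> (int \<Rightarrow> 'a \<Rightarrow> nat) \<Rightarrow> 'a \<Rightarrow> real mat" where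
  "Q_matrix p n X \<omega> = mat (p + 1) (p + 1) (\<lambda>(a, b).
    \<Sum>k=1..n. regressor (state p X (int k - 1) \<omega>) $ a * regressor (state p X (int k - 1) \<omega>) $ b)"

definition XY_vector :: "nat \<Rightarrow> nat \<Rightarrow> (int \<Rightarrow> 'a \<Rightarrow> nat) \<Rightarrow> 'a \<Rightarrow> real vec" where
  "XY_vector p n X \<omega> = vec (p + 1) (\<lambda>a.
    \<Sum>k=1..n. real (X (int k) \<omega>) * regressor (state p X (int k - 1) \<omega>) $ a)"

text \<open>Meaningful for invertible matrices only.\<close>

definition inverse_mat :: "real mat \<Rightarrow> real mat" where
  "inverse_mat A = the (mat_inverse A)"

text \<open>
  Where \<open>Q_matrix\<close> is singular, the estimator is an arbitrary random vector.
\<close>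

definition cls_estimator ::
  "'a measure \<Rightarrow> nat \<Rightarrow> nat \<Rightarrow> (int \<Rightarrow> 'a \<Rightarrow> nat) \<Rightarrow> ('a \<Rightarrow> real vec) \<Rightarrow> bool" where
  "cls_estimator M p n X \<theta> \<longleftrightarrow>
    (\<forall>\<omega>\<in>space M. \<theta> \<omega> \<in> carrier_vec (p + 1)) \<and>
    (\<forall>a<p + 1. (\<lambda>\<omega>. \<theta> \<omega> $ a) \<in> borel_measurable M) \<and>
    (\<forall>\<omega>\<in>space M. invertible_mat (Q_matrix p n X \<omega>) \<longrightarrow>
      \<theta> \<omega> = inverse_mat (Q_matrix p n X \<omega>) *\<^sub>v XY_vector p n X \<omega>)"

definition residual ::
  "nat \<Rightarrow> (int \<Rightarrow> 'a \<Rightarrow> nat) \<Rightarrow> ('a \<Rightarrow> real vec) \<Rightarrow> nat \<Rightarrow> 'a \<Rightarrow> real" where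
  "residual p X \<theta> k \<omega> = real (X (int k) \<omega>) - \<theta> \<omega> \<bullet> regressor (state p X (int k - 1) \<omega>)"

subsection \<open>Stochastic boundedness\<close>

text \<open>
  \<open>Y n = O\<^sub>P(r n)\<close>. Each \<open>Y n\<close> may live on its own probability space \<open>M n\<close>.
\<close>

definition O_P :: "(nat \<Rightarrow> 'a measure) \<Rightarrow> (nat \<Rightarrow> 'a \<Rightarrow> real) \<Rightarrow> (nat \<Rightarrow> real) \<Rightarrow> bool" where
  "O_P M Y r \<longleftrightarrow> (\<forall>\<delta>>0. \<exists>K. eventually
    (\<lambda>n. measure (M n) {\<omega> \<in> space (M n). \<bar>Y n \<omega>\<bar> > K * r n} < \<delta>) sequentially)"

end

theory Submission
  imports Defs "Jordan_Normal_Form.Determinant"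
begin

text \<open>
  Write \<open>S = \<alpha> 1 + \<dots> + \<alpha> p < 1\<close> and let \<open>D\<^sub>k\<close> be the deviation of \<open>X\<^sub>k\<close> from its conditional mean
  \<open>\<Sum>i. \<alpha> i X\<^sub>k\<^sub>-\<^sub>i + \<mu>\<close> given the past. All randomness enters through three kinds of martingales, the sums of
  \<open>D\<^sub>k\<close>, of \<open>D\<^sub>k X\<^sub>k\<^sub>-\<^sub>d\<close>, and of \<open>D\<^sub>k\<^sup>2\<close> minus its conditional mean. Fourth moments of \<open>X\<^sub>k\<close> are bounded uniformly
  in time because the fourth moment of one step satisfies a drift inequality with total weight below one
  (\<open>step_law_drift\<close>), so each martingale has second moment of order \<open>n\<close> (\<open>martingale_bound\<close>). A single Markov
  inequality over a grid of about \<open>sqrt n\<close> times makes all of them \<open>O(n\<^sup>1\<^sup>-\<^sup>\<gamma>)\<close> at once with high probability;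
  the summed second moments are of order \<open>n\<^sup>3\<^sup>/\<^sup>2\<close>, which explains the restriction \<open>\<gamma> < 1/4\<close> (\<open>fluctuations_small\<close>).

  The rest is deterministic. On a stretch with a constant innovation law the empirical means and lag products
  satisfy the Yule-Walker equations up to these martingales and boundary terms, while the stationary moments
  satisfy them exactly. The equations are a sup-norm contraction with factor \<open>S\<close>, so the two solutions differ by
  \<open>O(n\<^sup>1\<^sup>-\<^sup>\<gamma>)\<close> (\<open>segment_averages\<close>). Since the partial sums of \<open>X\<close> are monotone, their approximation at grid
  times extends to all times (\<open>good_path_averages\<close>). Hence the normal equations are a small perturbation of
  \<open>n Q \<theta> = n (\<rho> C' \<theta>' + (1 - \<rho>) C'' \<theta>'')\<close>, where \<open>\<theta>'\<close> and \<open>\<theta>''\<close> are the parameters before and after the change.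
  With \<open>e\<close> the last unit vector, the limit of the estimator is \<open>\<theta>'' + \<rho> (\<mu>' - \<mu>'') v\<close> where \<open>v = Q\<inverse> C' e\<close>, and the
  cumulated residuals follow, up to \<open>O(n\<^sup>1\<^sup>-\<^sup>\<gamma>)\<close>, a tent with slope \<open>\<psi> / \<rho>\<close> before and \<open>- \<psi> / (1 - \<rho>)\<close> after the
  change. Its peak, at the change point, is \<open>n \<psi>\<close> up to a bounded error (\<open>residual_max_approx\<close>).

  Positivity of \<open>\<psi>\<close> amounts to \<open>e \<bullet> C'' v > 0\<close>. This number is a positive combination of two quadratic forms, in \<open>C'\<close> and \<open>C''\<close>
  (\<open>parallel_sum_positive\<close>), which are positive definite because every new value carries noise
  (\<open>affine_zero\<close>). Finally, independence of the initial vector and of disjoint blocks of the noise identifies the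
  law of the observed path with the Markovian path law for which the estimates are proved (\<open>path_measurable\<close>).
\<close>

section \<open>Expectations over mixtures and products\<close>

text \<open>
  For nonnegative functions this is the tower rule of nonnegative integrals; integrability under the mixture
  keeps the outer expectation finite.
\<close>

lemma expectation_bind_pmf_nonneg:
  fixes f :: "'b \<Rightarrow> real"
  assumes f: "integrable (bind_pmf N K) f" and inner: "\<And>x. integrable (K x) f" and nn: "\<And>y. 0 \<le> f y"
  shows "integrable N (\<lambda>x. measure_pmf.expectation (K x) f)"
    and "measure_pmf.expectation (bind_pmf N K) f = measure_pmf.expectation N (\<lambda>x. measure_pmf.expectation (K x) f)"
proof -
  have "(\<integral>\<^sup>+x. ennreal (measure_pmf.expectation (K x) f) \<partial>N) = (\<integral>\<^sup>+y. f y \<partial>bind_pmf N K)"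
    using nn_integral_eq_integral[OF inner] nn by simp
  also have "\<dots> = ennreal (measure_pmf.expectation (bind_pmf N K) f)"
    using nn by (intro nn_integral_eq_integral f) auto
  finally have "integrable N (\<lambda>x. measure_pmf.expectation (K x) f) \<and>
     measure_pmf.expectation N (\<lambda>x. measure_pmf.expectation (K x) f) = measure_pmf.expectation (bind_pmf N K) f"
    using nn by (subst (asm) nn_integral_eq_integrable) (auto intro!: integral_nonneg_AE)
  then show "integrable N (\<lambda>x. measure_pmf.expectation (K x) f)"
    and "measure_pmf.expectation (bind_pmf N K) f = measure_pmf.expectation N (\<lambda>x. measure_pmf.expectation (K x) f)"
    by simp_all
qed

lemma expectation_bind_pmf:
  fixes f :: "'b \<Rightarrow> real"
  assumes f: "integrable (bind_pmf N K) f" and inner: "\<And>x. integrable (K x) f"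
  shows "integrable N (\<lambda>x. measure_pmf.expectation (K x) f)"
    and "measure_pmf.expectation (bind_pmf N K) f = measure_pmf.expectation N (\<lambda>x. measure_pmf.expectation (K x) f)"
proof -
  let ?p = "\<lambda>y. max 0 (f y)" and ?m = "\<lambda>y. max 0 (- f y)"
  have eq: "f = (\<lambda>y. ?p y - ?m y)" by (auto simp: fun_eq_iff)
  have P: "integrable (bind_pmf N K) ?p" "\<And>x. integrable (K x) ?p"
    and M: "integrable (bind_pmf N K) ?m" "\<And>x. integrable (K x) ?m"
    using f inner by (auto intro!: integrable_max)
  note p = expectation_bind_pmf_nonneg[OF P, simplified] and m = expectation_bind_pmf_nonneg[OF M, simplified]
  have K: "measure_pmf.expectation (K x) f = measure_pmf.expectation (K x) ?p - measure_pmf.expectation (K x) ?m" for x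
    by (subst eq, rule Bochner_Integration.integral_diff[OF P(2) M(2)])
  show "integrable N (\<lambda>x. measure_pmf.expectation (K x) f)"
    unfolding K by (intro Bochner_Integration.integrable_diff p m)
  have "measure_pmf.expectation (bind_pmf N K) f = measure_pmf.expectation (bind_pmf N K) ?p - measure_pmf.expectation (bind_pmf N K) ?m"
    by (subst eq, rule Bochner_Integration.integral_diff[OF P(1) M(1)])
  also have "\<dots> = measure_pmf.expectation N (\<lambda>x. measure_pmf.expectation (K x) f)"
    unfolding p(2) m(2) K by (rule Bochner_Integration.integral_diff[symmetric, OF p(1) m(1)])
  finally show "measure_pmf.expectation (bind_pmf N K) f = measure_pmf.expectation N (\<lambda>x. measure_pmf.expectation (K x) f)" .
qed

lemma integrable_bind_pmf_nonneg:
  fixes f :: "'b \<Rightarrow> real" and N :: "'a pmf" and K :: "'a \<Rightarrow> 'b pmf"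
  assumes inner: "\<And>x. integrable (K x) f" and nn: "\<And>y. 0 \<le> f y"
    and bd: "\<And>x. measure_pmf.expectation (K x) f \<le> h x" and h: "integrable N h"
  shows "integrable (bind_pmf N K) f"
proof -
  have "(\<integral>\<^sup>+y. f y \<partial>bind_pmf N K) = (\<integral>\<^sup>+x. ennreal (measure_pmf.expectation (K x) f) \<partial>N)"
    using nn_integral_eq_integral[OF inner] nn by simp
  also have "\<dots> \<le> (\<integral>\<^sup>+x. ennreal (norm (h x)) \<partial>N)"
  proof (intro nn_integral_mono ennreal_leI)
    fix x
    show "measure_pmf.expectation (K x) f \<le> norm (h x)" using bd[of x] by simp
  qed
  also have "\<dots> < \<infinity>" using h by (simp add: integrable_iff_bounded)
  finally show ?thesis using nn by (intro integrableI_bounded) auto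
qed

lemma pair_pmf_product:
  fixes f :: "'b \<Rightarrow> real" and g :: "'c \<Rightarrow> real"
  assumes f: "integrable (measure_pmf P) f" and g: "integrable (measure_pmf Q) g"
  shows "integrable (pair_pmf P Q) (\<lambda>z. f (fst z) * g (snd z))"
    and "measure_pmf.expectation (pair_pmf P Q) (\<lambda>z. f (fst z) * g (snd z)) =
      measure_pmf.expectation P f * measure_pmf.expectation Q g"
proof -
  have eq: "pair_pmf P Q = bind_pmf P (\<lambda>x. map_pmf (Pair x) Q)"
    by (simp add: pair_pmf_def map_pmf_def)
  have inner: "integrable (map_pmf (Pair x) Q) (\<lambda>z. f (fst z) * g (snd z))" for x
    using g by simp
  have "integrable (pair_pmf P Q) (\<lambda>z. norm (f (fst z) * g (snd z)))" unfolding eq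
  proof (rule integrable_bind_pmf_nonneg)
    show "integrable (measure_pmf P) (\<lambda>x. \<bar>f x\<bar> * measure_pmf.expectation Q (\<lambda>y. \<bar>g y\<bar>))"
      using f by simp
  qed (use g in \<open>simp_all add: abs_mult\<close>)
  then show 1: "integrable (pair_pmf P Q) (\<lambda>z. f (fst z) * g (snd z))"
    by (subst integrable_norm_iff[symmetric]) auto
  have "measure_pmf.expectation (pair_pmf P Q) (\<lambda>z. f (fst z) * g (snd z)) =
     measure_pmf.expectation P (\<lambda>x. f x * measure_pmf.expectation Q g)"
    unfolding eq using expectation_bind_pmf(2)[OF 1[unfolded eq] inner] by simp
  also have "\<dots> = measure_pmf.expectation P f * measure_pmf.expectation Q g" by simp
  finally show "measure_pmf.expectation (pair_pmf P Q) (\<lambda>z. f (fst z) * g (snd z)) =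
      measure_pmf.expectation P f * measure_pmf.expectation Q g" .
qed

lemma power_le_one_plus_power4:
  fixes x :: real
  shows "\<bar>x\<bar> \<le> 1 + x^4" "x^2 \<le> 1 + x^4" "\<bar>x\<bar>^3 \<le> 1 + x^4"
proof -
  have "\<bar>x\<bar> ^ k \<le> 1 + x^4" if "k \<le> 4" for k
  proof (cases "\<bar>x\<bar> \<le> 1")
    case True
    then have "\<bar>x\<bar> ^ k \<le> 1" by (simp add: power_le_one)
    moreover have "0 \<le> x^4" by simp
    ultimately show ?thesis by linarith
  next
    case False
    then have "\<bar>x\<bar> ^ k \<le> \<bar>x\<bar> ^ 4" using that by (intro power_increasing) auto
    then show ?thesis by simp
  qed
  from this[of 1] this[of 2] this[of 3] show "\<bar>x\<bar> \<le> 1 + x^4" "x^2 \<le> 1 + x^4" "\<bar>x\<bar>^3 \<le> 1 + x^4" by simp_all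
qed

lemma integrable_lower_moments:
  fixes f :: "'b \<Rightarrow> real"
  assumes "integrable (measure_pmf P) (\<lambda>x. f x ^ 4)"
  shows "integrable (measure_pmf P) f" "integrable (measure_pmf P) (\<lambda>x. f x ^ 2)" "integrable (measure_pmf P) (\<lambda>x. f x ^ 3)"
proof -
  have i: "integrable (measure_pmf P) (\<lambda>x. 1 + f x ^ 4)" using assms by simp
  show "integrable (measure_pmf P) f" "integrable (measure_pmf P) (\<lambda>x. f x ^ 2)" "integrable (measure_pmf P) (\<lambda>x. f x ^ 3)"
    by (rule Bochner_Integration.integrable_bound[OF i]; use power_le_one_plus_power4 in \<open>auto simp: power_abs intro: order_trans\<close>)+
qed

text \<open>
  In the expansion of the powers of a sum of two independent centred variables, every mixed term in which one
  of them has exponent one vanishes.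
\<close>

lemma pair_pmf_centered_sum:
  fixes f :: "'b \<Rightarrow> real" and g :: "'c \<Rightarrow> real"
  assumes f4: "integrable (measure_pmf P) (\<lambda>x. f x ^ 4)" and g4: "integrable (measure_pmf Q) (\<lambda>x. g x ^ 4)"
    and f0: "measure_pmf.expectation P f = 0" and g0: "measure_pmf.expectation Q g = 0"
  defines "h \<equiv> \<lambda>z. f (fst z) + g (snd z)"
  shows "integrable (pair_pmf P Q) (\<lambda>z. h z ^ 4)"
    and "measure_pmf.expectation (pair_pmf P Q) h = 0"
    and "measure_pmf.expectation (pair_pmf P Q) (\<lambda>z. h z ^ 2) =
      measure_pmf.expectation P (\<lambda>x. f x ^ 2) + measure_pmf.expectation Q (\<lambda>x. g x ^ 2)"
    and "measure_pmf.expectation (pair_pmf P Q) (\<lambda>z. h z ^ 4) =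
      measure_pmf.expectation P (\<lambda>x. f x ^ 4) +
      6 * measure_pmf.expectation P (\<lambda>x. f x ^ 2) * measure_pmf.expectation Q (\<lambda>x. g x ^ 2) +
      measure_pmf.expectation Q (\<lambda>x. g x ^ 4)"
proof -
  note f = f4 integrable_lower_moments[OF f4] and g = g4 integrable_lower_moments[OF g4]
  let ?F = "\<lambda>i z. f (fst z) ^ i" and ?G = "\<lambda>i z. g (snd z) ^ i"
  have fi: "integrable (measure_pmf P) (\<lambda>x. f x ^ i)" if "i \<le> 4" for i
    proof -
    have "i = 0 \<or> i = 1 \<or> i = 2 \<or> i = 3 \<or> i = 4" using that by linarith
    then show ?thesis using f by (elim disjE) simp_all
  qed
  have gi: "integrable (measure_pmf Q) (\<lambda>x. g x ^ i)" if "i \<le> 4" for i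
    proof -
    have "i = 0 \<or> i = 1 \<or> i = 2 \<or> i = 3 \<or> i = 4" using that by linarith
    then show ?thesis using g by (elim disjE) simp_all
  qed
  have I: "integrable (pair_pmf P Q) (\<lambda>z. f (fst z) ^ i * g (snd z) ^ j)" if "i \<le> 4" "j \<le> 4" for i j
    by (rule pair_pmf_product(1)[OF fi gi]) (use that in auto)
  have E: "measure_pmf.expectation (pair_pmf P Q) (\<lambda>z. f (fst z) ^ i * g (snd z) ^ j) =
     measure_pmf.expectation P (\<lambda>x. f x ^ i) * measure_pmf.expectation Q (\<lambda>x. g x ^ j)" if "i \<le> 4" "j \<le> 4" for i j
    by (rule pair_pmf_product(2)[OF fi gi]) (use that in auto)
  have exp4: "h z ^ 4 = (\<Sum>i\<le>4. of_nat (4 choose i) * (f (fst z) ^ i * g (snd z) ^ (4 - i)))" for z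
    unfolding h_def by (subst binomial_ring) (simp add: mult.assoc)
  have exp2: "h z ^ 2 = (\<Sum>i\<le>2. of_nat (2 choose i) * (f (fst z) ^ i * g (snd z) ^ (2 - i)))" for z
    unfolding h_def by (subst binomial_ring) (simp add: mult.assoc)
  have exp1: "h z = (\<Sum>i\<le>1. f (fst z) ^ i * g (snd z) ^ (1 - i))" for z
    unfolding h_def by simp
  show "integrable (pair_pmf P Q) (\<lambda>z. h z ^ 4)"
    unfolding exp4 by (intro Bochner_Integration.integrable_sum integrable_mult_right I) auto
  have "measure_pmf.expectation (pair_pmf P Q) h =
    (\<Sum>i\<le>1. measure_pmf.expectation P (\<lambda>x. f x ^ i) * measure_pmf.expectation Q (\<lambda>x. g x ^ (1 - i)))"
    unfolding exp1[abs_def] by (subst Bochner_Integration.integral_sum) (auto simp: E I)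
  then show "measure_pmf.expectation (pair_pmf P Q) h = 0" using f0 g0 by simp
  have "measure_pmf.expectation (pair_pmf P Q) (\<lambda>z. h z ^ 2) =
    (\<Sum>i\<le>2. of_nat (2 choose i) * (measure_pmf.expectation P (\<lambda>x. f x ^ i) * measure_pmf.expectation Q (\<lambda>x. g x ^ (2 - i))))"
    unfolding exp2[abs_def] by (subst Bochner_Integration.integral_sum) (auto simp: E I)
  then show "measure_pmf.expectation (pair_pmf P Q) (\<lambda>z. h z ^ 2) =
      measure_pmf.expectation P (\<lambda>x. f x ^ 2) + measure_pmf.expectation Q (\<lambda>x. g x ^ 2)"
    using f0 g0 by (simp add: numeral_2_eq_2)
  have "measure_pmf.expectation (pair_pmf P Q) (\<lambda>z. h z ^ 4) =
    (\<Sum>i\<le>4. of_nat (4 choose i) * (measure_pmf.expectation P (\<lambda>x. f x ^ i) * measure_pmf.expectation Q (\<lambda>x. g x ^ (4 - i))))"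
    unfolding exp4[abs_def] by (subst Bochner_Integration.integral_sum) (auto simp: E I)
  then show "measure_pmf.expectation (pair_pmf P Q) (\<lambda>z. h z ^ 4) =
      measure_pmf.expectation P (\<lambda>x. f x ^ 4) +
      6 * measure_pmf.expectation P (\<lambda>x. f x ^ 2) * measure_pmf.expectation Q (\<lambda>x. g x ^ 2) +
      measure_pmf.expectation Q (\<lambda>x. g x ^ 4)"
    using f0 g0 by (simp add: eval_nat_numeral algebra_simps)
qed

lemma bernoulli_nat_moments:
  assumes "0 \<le> a" "a \<le> 1"
  shows "integrable (bernoulli_nat a) (\<lambda>y. f y :: real)"
    and "measure_pmf.expectation (bernoulli_nat a) f = a * f 1 + (1 - a) * f 0"
  using assms unfolding bernoulli_nat_def by (auto intro!: integrable_measure_pmf_finite)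

text \<open>
  The variables are added one at a time. The centred fourth moment of a Bernoulli variable is at most its
  variance, and this makes the bound \<open>s + 3 s\<^sup>2\<close> stable under adding a variable.
\<close>

lemma Pi_bernoulli_centered_moments:
  fixes q :: "'b \<Rightarrow> real"
  assumes "finite A" "\<And>a. a \<in> A \<Longrightarrow> 0 \<le> q a \<and> q a \<le> 1"
  defines "Y \<equiv> \<lambda>A b. \<Sum>a\<in>A. real (b a) - q a" and "P \<equiv> \<lambda>A. Pi_pmf A 0 (\<lambda>a. bernoulli_nat (q a))"
    and "s \<equiv> \<lambda>A. \<Sum>a\<in>A. q a * (1 - q a)"
  shows "integrable (P A) (\<lambda>b. Y A b ^ 4) \<and> measure_pmf.expectation (P A) (Y A) = 0 \<and>
    measure_pmf.expectation (P A) (\<lambda>b. Y A b ^ 2) = s A \<and>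
    measure_pmf.expectation (P A) (\<lambda>b. Y A b ^ 4) \<le> s A + 3 * s A ^ 2"
  using assms(1,2)
proof (induction A rule: finite_induct)
  case empty
  then show ?case by (simp add: Y_def P_def s_def)
next
  case (insert x A)
  let ?g = "\<lambda>y. real y - q x" and ?B = "bernoulli_nat (q x)" and ?h = "\<lambda>z. real (fst z) - q x + Y A (snd z)"
  have q: "0 \<le> q x" "q x \<le> 1" using insert.prems by auto
  have IH: "integrable (P A) (\<lambda>b. Y A b ^ 4)" "measure_pmf.expectation (P A) (Y A) = 0"
    "measure_pmf.expectation (P A) (\<lambda>b. Y A b ^ 2) = s A"
    "measure_pmf.expectation (P A) (\<lambda>b. Y A b ^ 4) \<le> s A + 3 * s A ^ 2"
    using insert by auto
  note bern = bernoulli_nat_moments[OF q]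
  let ?t = "q x * (1 - q x)"
  have t0: "0 \<le> ?t" using q by simp
  have g0: "measure_pmf.expectation ?B ?g = 0" by (simp add: bern algebra_simps)
  have g2: "measure_pmf.expectation ?B (\<lambda>y. ?g y ^ 2) = ?t" by (simp add: bern algebra_simps power2_eq_square)
  have "q x ^ 3 + (1 - q x) ^ 3 \<le> 1"
  proof -
    have "q x ^ 3 \<le> q x" "(1 - q x) ^ 3 \<le> 1 - q x"
      using q power_decreasing[of 1 3 "q x"] power_decreasing[of 1 3 "1 - q x"] by simp_all
    then show ?thesis by simp
  qed
  then have "?t * (q x ^ 3 + (1 - q x) ^ 3) \<le> ?t" using t0 by (metis mult.right_neutral mult_left_mono)
  then have g4: "measure_pmf.expectation ?B (\<lambda>y. ?g y ^ 4) \<le> ?t" by (simp add: bern algebra_simps eval_nat_numeral)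
  note c = pair_pmf_centered_sum[where f = ?g and g = "Y A" and P = ?B and Q = "P A", OF bern(1) IH(1) g0 IH(2)]
  have PI: "P (insert x A) = map_pmf (\<lambda>(y, f). f(x := y)) (pair_pmf ?B (P A))"
    unfolding P_def using insert by (subst Pi_pmf_insert) auto
  have YI: "Y (insert x A) (case z of (y, f) \<Rightarrow> f(x := y)) = ?h z" for z
  proof -
    have "Y A (f(x := y)) = Y A f" for y f unfolding Y_def using insert.hyps by (intro sum.cong) auto
    then show ?thesis unfolding Y_def using insert.hyps by (cases z) simp
  qed
  have sI: "s (insert x A) = ?t + s A" unfolding s_def using insert.hyps by simp
  have "measure_pmf.expectation ?B (\<lambda>y. ?g y ^ 4) + 6 * ?t * s A + measure_pmf.expectation (P A) (\<lambda>b. Y A b ^ 4)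
     \<le> ?t + 6 * ?t * s A + (s A + 3 * s A ^ 2)"
    using g4 IH(4) by simp
  also have "\<dots> \<le> ?t + 6 * ?t * s A + (s A + 3 * s A ^ 2) + 3 * ?t^2" by simp
  also have "\<dots> = (?t + s A) + 3 * (?t + s A) ^ 2" by (simp add: power2_eq_square algebra_simps)
  finally show ?case
    using c unfolding PI sI g2 IH(3) integrable_map_pmf_eq integral_map_pmf YI by simp
qed

section \<open>Moments of one step of the process\<close>

text \<open>
  The law of the next value when the value at lag \<open>i\<close> is \<open>c i\<close>. It is the random coordinate of the Markov kernel,
  and, with the innovation law varying in time, also the step of the observed process.
\<close>

definition step_law :: "nat \<Rightarrow> (nat \<Rightarrow> real) \<Rightarrow> nat pmf \<Rightarrow> (nat \<Rightarrow> nat) \<Rightarrow> nat pmf" where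
  "step_law p \<alpha> F c =
    bind_pmf (Pi_pmf (SIGMA i:{1..p}. {1..c i}) 0 (\<lambda>(i, j). bernoulli_nat (\<alpha> i))) (\<lambda>b.
    map_pmf (\<lambda>e. (\<Sum>i=1..p. \<Sum>j=1..c i. b (i, j)) + e) F)"

definition lag_mean :: "nat \<Rightarrow> (nat \<Rightarrow> real) \<Rightarrow> (nat \<Rightarrow> nat) \<Rightarrow> real" where
  "lag_mean p \<alpha> c = (\<Sum>i=1..p. \<alpha> i * real (c i))"

definition lag_var :: "nat \<Rightarrow> (nat \<Rightarrow> real) \<Rightarrow> (nat \<Rightarrow> nat) \<Rightarrow> real" where
  "lag_var p \<alpha> c = (\<Sum>i=1..p. \<alpha> i * (1 - \<alpha> i) * real (c i))"

abbreviation "innov_mean F \<equiv> measure_pmf.expectation F real"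
abbreviation "innov_var F \<equiv> measure_pmf.variance F real"

text \<open>
  A constant \<open>K\<close> with \<open>s + 3 s\<^sup>2 + 6 s v + k \<le> K (1 + N)\<^sup>2\<close> whenever \<open>0 \<le> s \<le> N\<close>, where \<open>v\<close> and \<open>k\<close> are the second and
  fourth centred moments of the innovation.
\<close>

definition fourth_const :: "nat pmf \<Rightarrow> real" where
  "fourth_const F = 4 + 6 * innov_var F + measure_pmf.expectation F (\<lambda>e. (real e - innov_mean F) ^ 4)"

lemma fourth_const_ge: "4 \<le> fourth_const F"
proof -
  have "0 \<le> innov_var F" "0 \<le> measure_pmf.expectation F (\<lambda>e. (real e - innov_mean F) ^ 4)"
    by (auto intro!: integral_nonneg_AE)
  then show ?thesis unfolding fourth_const_def by linarith
qed

text \<open>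
  Convexity of the fourth power with weights \<open>q\<close> and \<open>t\<close>. The weights stay free because a factor close to one in
  front of \<open>a\<^sup>4\<close> is what preserves the contraction in the drift inequality.
\<close>

lemma sum_power4_le:
  fixes a b q t :: real
  assumes "0 < q" "0 < t" "q + t = 1"
  shows "(a + b) ^ 4 \<le> a ^ 4 / q ^ 3 + b ^ 4 / t ^ 3"
proof -
  have sq: "(a + b)^2 \<le> a^2 / q + b^2 / t" for a b :: real
  proof -
    have "0 \<le> (t * a - q * b)^2 / (q * t)" using assms by simp
    also have "\<dots> = a^2 / q + b^2 / t - (a + b)^2"
    proof -
      have t: "t = 1 - q" using assms by simp
      show ?thesis using assms(1,2) unfolding t by (simp add: field_simps power2_eq_square)
    qed
    finally show ?thesis by simp
  qed
  have "(a + b)^4 = ((a + b)^2)^2" by simp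
  also have "\<dots> \<le> (a^2 / q + b^2 / t)^2" using sq by (intro power_mono) auto
  also have "\<dots> \<le> (a^2 / q)^2 / q + (b^2 / t)^2 / t" by (rule sq)
  also have "\<dots> = a ^ 4 / q ^ 3 + b ^ 4 / t ^ 3" by (simp add: power_divide eval_nat_numeral)
  finally show ?thesis .
qed

lemma power4_integrable_add_const:
  fixes f :: "'b \<Rightarrow> real"
  assumes "integrable (measure_pmf P) (\<lambda>x. f x ^ 4)"
  shows "integrable (measure_pmf P) (\<lambda>x. (f x + c) ^ 4)"
proof (rule Bochner_Integration.integrable_bound)
  show "integrable (measure_pmf P) (\<lambda>x. f x ^ 4 / (1/2)^3 + c^4 / (1/2)^3)" using assms by simp
  show "AE x in measure_pmf P. norm ((f x + c) ^ 4) \<le> norm (f x ^ 4 / (1/2)^3 + c^4 / (1/2)^3)"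
    using sum_power4_le[of "1/2" "1/2" "f _" c] by (intro always_eventually) (simp add: abs_le_iff)
qed auto

lemma lag_var_bounds:
  assumes \<alpha>: "\<And>i. i \<in> {1..p} \<Longrightarrow> 0 \<le> \<alpha> i \<and> \<alpha> i \<le> 1"
  shows "0 \<le> lag_var p \<alpha> c" "lag_var p \<alpha> c \<le> (\<Sum>i=1..p. real (c i))"
proof -
  show "0 \<le> lag_var p \<alpha> c" unfolding lag_var_def using \<alpha> by (intro sum_nonneg) auto
  show "lag_var p \<alpha> c \<le> (\<Sum>i=1..p. real (c i))" unfolding lag_var_def
  proof (intro sum_mono)
    fix i assume "i \<in> {1..p}"
    then have "\<alpha> i * (1 - \<alpha> i) \<le> 1" using \<alpha>[of i] by (simp add: mult_le_one)
    then show "\<alpha> i * (1 - \<alpha> i) * real (c i) \<le> real (c i)"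
      using mult_right_mono[of "\<alpha> i * (1 - \<alpha> i)" 1 "real (c i)"] by simp
  qed
qed

text \<open>
  The deviation from the conditional mean is a sum of independent centred variables, one for each thinning trial
  and one for the innovation.
\<close>

lemma step_law_deviation:
  fixes F :: "nat pmf" and c :: "nat \<Rightarrow> nat"
  assumes \<alpha>: "\<And>i. i \<in> {1..p} \<Longrightarrow> 0 \<le> \<alpha> i \<and> \<alpha> i \<le> 1"
    and F: "integrable F (\<lambda>e. real e ^ 4)"
  defines "D \<equiv> \<lambda>y. real y - lag_mean p \<alpha> c - innov_mean F"
  shows "integrable (step_law p \<alpha> F c) (\<lambda>y. D y ^ 4)"
    and "measure_pmf.expectation (step_law p \<alpha> F c) D = 0"
    and "measure_pmf.expectation (step_law p \<alpha> F c) (\<lambda>y. D y ^ 2) = lag_var p \<alpha> c + innov_var F"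
    and "measure_pmf.expectation (step_law p \<alpha> F c) (\<lambda>y. D y ^ 4) \<le>
      fourth_const F * (1 + (\<Sum>i=1..p. real (c i))) ^ 2"
proof -
  let ?A = "SIGMA i:{1..p}. {1..c i}" and ?q = "\<lambda>(i, j). \<alpha> i"
  let ?P = "Pi_pmf ?A 0 (\<lambda>a. bernoulli_nat (?q a))"
  let ?Y = "\<lambda>b. \<Sum>a\<in>?A. real (b a) - ?q a" and ?g = "\<lambda>e. real e - innov_mean F"
  let ?s = "\<Sum>a\<in>?A. ?q a * (1 - ?q a)"
  have fin: "finite ?A" by auto
  have Pi: "Pi_pmf ?A 0 (\<lambda>(i, j). bernoulli_nat (\<alpha> i)) = ?P"
    by (intro Pi_pmf_cong) auto
  have step: "step_law p \<alpha> F c = map_pmf (\<lambda>z. (\<Sum>i=1..p. \<Sum>j=1..c i. fst z (i, j)) + snd z) (pair_pmf ?P F)"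
    unfolding step_law_def Pi pair_pmf_def by (simp add: map_pmf_def bind_assoc_pmf bind_return_pmf)
  have s: "?s = lag_var p \<alpha> c"
    using sum.Sigma[of "{1..p}" "\<lambda>i. {1..c i}" "\<lambda>i j. \<alpha> i * (1 - \<alpha> i)"]
    unfolding lag_var_def by (simp add: case_prod_unfold ac_simps)
  have D: "D ((\<Sum>i=1..p. \<Sum>j=1..c i. fst z (i, j)) + snd z) = ?Y (fst z) + ?g (snd z)" for z
    using sum.Sigma[of "{1..p}" "\<lambda>i. {1..c i}" "\<lambda>i j. real (fst z (i, j)) - \<alpha> i"]
    unfolding D_def lag_mean_def by (simp add: case_prod_unfold sum_subtractf ac_simps)
  have Y: "integrable ?P (\<lambda>b. ?Y b ^ 4)" "measure_pmf.expectation ?P ?Y = 0"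
    "measure_pmf.expectation ?P (\<lambda>b. ?Y b ^ 2) = ?s" "measure_pmf.expectation ?P (\<lambda>b. ?Y b ^ 4) \<le> ?s + 3 * ?s ^ 2"
    using Pi_bernoulli_centered_moments[OF fin, of ?q] \<alpha> by auto
  have g4: "integrable F (\<lambda>e. ?g e ^ 4)" using power4_integrable_add_const[OF F, of "- innov_mean F"] by simp
  have g0: "measure_pmf.expectation F ?g = 0"
    using integrable_lower_moments(1)[OF F] by simp
  note c = pair_pmf_centered_sum[where f = ?Y and g = ?g and P = ?P and Q = F, OF Y(1) g4 Y(2) g0]
  show "integrable (step_law p \<alpha> F c) (\<lambda>y. D y ^ 4)"
    "measure_pmf.expectation (step_law p \<alpha> F c) D = 0"
    "measure_pmf.expectation (step_law p \<alpha> F c) (\<lambda>y. D y ^ 2) = lag_var p \<alpha> c + innov_var F"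
    using c(1-3) unfolding step integrable_map_pmf_eq integral_map_pmf D Y(3) s by simp_all
  let ?N = "\<Sum>i=1..p. real (c i)" and ?v = "innov_var F" and ?k = "measure_pmf.expectation F (\<lambda>e. ?g e ^ 4)"
  have N0: "0 \<le> ?N" by (intro sum_nonneg) auto
  have s0: "0 \<le> ?s" and sN: "?s \<le> ?N"
    unfolding s by (rule lag_var_bounds; use \<alpha> in blast)+
  have v0: "0 \<le> ?v" and k0: "0 \<le> ?k" by (auto intro!: integral_nonneg_AE)
  let ?w = "(1 + ?N)^2"
  have w: "1 \<le> ?w" "?N \<le> ?w" "?N^2 \<le> ?w" using N0 by (auto simp: power2_eq_square algebra_simps)
  have "measure_pmf.expectation (step_law p \<alpha> F c) (\<lambda>y. D y ^ 4) \<le> (?s + 3 * ?s^2) + 6 * ?s * ?v + ?k"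
    using c(4) Y(4) unfolding step integrable_map_pmf_eq integral_map_pmf D Y(3) by simp
  also have "\<dots> \<le> (?N + 3 * ?N^2) + 6 * ?N * ?v + ?k"
    using sN s0 v0 by (intro add_mono mult_mono mult_left_mono power_mono) auto
  also have "\<dots> \<le> (?w + 3 * ?w) + 6 * ?w * ?v + ?k * ?w"
    using w v0 k0 N0 mult_left_mono[OF w(1) k0] by (intro add_mono mult_mono mult_left_mono) auto
  also have "\<dots> = fourth_const F * ?w" unfolding fourth_const_def by (simp add: algebra_simps)
  finally show "measure_pmf.expectation (step_law p \<alpha> F c) (\<lambda>y. D y ^ 4) \<le> fourth_const F * ?w" .
qed

lemma weighted_sum_squared_le:
  fixes w x :: "'b \<Rightarrow> real"
  assumes "\<And>i. i \<in> A \<Longrightarrow> 0 \<le> w i"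
  shows "(\<Sum>i\<in>A. w i * x i)^2 \<le> (\<Sum>i\<in>A. w i) * (\<Sum>i\<in>A. w i * (x i)^2)"
proof -
  have "(\<Sum>i\<in>A. w i * x i) = (\<Sum>i\<in>A. sqrt (w i) * (sqrt (w i) * x i))"
    using assms by (intro sum.cong) (auto simp: mult.assoc[symmetric])
  then have "(\<Sum>i\<in>A. w i * x i)^2 \<le> (\<Sum>i\<in>A. (sqrt (w i))^2) * (\<Sum>i\<in>A. (sqrt (w i) * x i)^2)"
    using Cauchy_Schwarz_ineq_sum by metis
  also have "(\<Sum>i\<in>A. (sqrt (w i))^2) = (\<Sum>i\<in>A. w i)" using assms by (intro sum.cong) auto
  also have "(\<Sum>i\<in>A. (sqrt (w i) * x i)^2) = (\<Sum>i\<in>A. w i * (x i)^2)"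
    using assms by (intro sum.cong) (auto simp: power_mult_distrib)
  finally show ?thesis .
qed

lemma weighted_sum_power4_le:
  fixes w x :: "'b \<Rightarrow> real"
  assumes w: "\<And>i. i \<in> A \<Longrightarrow> 0 \<le> w i"
  shows "(\<Sum>i\<in>A. w i * x i)^4 \<le> (\<Sum>i\<in>A. w i)^3 * (\<Sum>i\<in>A. w i * (x i)^4)"
proof -
  let ?S = "\<Sum>i\<in>A. w i"
  have S: "0 \<le> ?S" using w by (rule sum_nonneg)
  have "(\<Sum>i\<in>A. w i * x i)^4 = ((\<Sum>i\<in>A. w i * x i)^2)^2" by simp
  also have "\<dots> \<le> (?S * (\<Sum>i\<in>A. w i * (x i)^2))^2"
    using weighted_sum_squared_le[OF w] by (intro power_mono) auto
  also have "\<dots> = ?S^2 * (\<Sum>i\<in>A. w i * (x i)^2)^2" by (simp add: power_mult_distrib)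
  also have "\<dots> \<le> ?S^2 * (?S * (\<Sum>i\<in>A. w i * ((x i)^2)^2))"
    using weighted_sum_squared_le[of A w "\<lambda>i. (x i)^2"] w by (intro mult_left_mono) auto
  also have "\<dots> = ?S^3 * (\<Sum>i\<in>A. w i * (x i)^4)" by (simp add: eval_nat_numeral ac_simps)
  finally show ?thesis .
qed

text \<open>
  With \<open>S\<close> the sum of the coefficients and \<open>q = (1 + S) / 2\<close>, convexity gives the conditional mean the total weight
  \<open>S\<^sup>4 / q\<^sup>3 \<le> S\<close>. The deviation has a fourth moment that is only quadratic in the lagged values, so a small multiple
  of their fourth powers and a constant absorb it.
\<close>

lemma step_law_drift:
  fixes F :: "nat pmf" and c :: "nat \<Rightarrow> nat"
  assumes p: "1 \<le> p" and \<alpha>: "\<And>i. i \<in> {1..p} \<Longrightarrow> 0 \<le> \<alpha> i \<and> \<alpha> i \<le> 1"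
    and stable: "(\<Sum>i=1..p. \<alpha> i) < 1"
    and F: "integrable F (\<lambda>e. real e ^ 4)"
  shows "integrable (step_law p \<alpha> F c) (\<lambda>y. real y ^ 4)"
    and "\<exists>\<beta> C. (\<forall>i\<in>{1..p}. 0 \<le> \<beta> i) \<and> (\<Sum>i=1..p. \<beta> i) < 1 \<and> 0 \<le> C \<and>
      (\<forall>c. measure_pmf.expectation (step_law p \<alpha> F c) (\<lambda>y. real y ^ 4) \<le> (\<Sum>i=1..p. \<beta> i * real (c i) ^ 4) + C)"
proof -
  let ?\<mu> = "innov_mean F"
  define D where "D c y = real y - lag_mean p \<alpha> c - ?\<mu>" for c y
  note dev = step_law_deviation[where \<alpha> = \<alpha> and p = p and F = F, OF \<alpha> F, folded D_def]
  have I: "integrable (step_law p \<alpha> F c) (\<lambda>y. real y ^ 4)" for c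
    using power4_integrable_add_const[OF dev(1), of c "lag_mean p \<alpha> c + ?\<mu>"] by (simp add: D_def)
  then show "integrable (step_law p \<alpha> F c) (\<lambda>y. real y ^ 4)" .
  define S where "S = (\<Sum>i=1..p. \<alpha> i)"
  define q t where "q = (1 + S) / 2" and "t = 1 - q"
  have S: "0 \<le> S" "S < 1" unfolding S_def using \<alpha> stable by (auto intro: sum_nonneg)
  have qt: "0 < q" "0 < t" "q + t = 1" "S \<le> q" using S unfolding t_def q_def by auto
  define B where "B = 8 * fourth_const F / t ^ 3"
  have B: "0 \<le> B" unfolding B_def using fourth_const_ge[of F] qt by simp
  \<comment> \<open>This \<open>\<eta>\<close> spends at most half of the gap \<open>1 - S\<close> on the deviation.\<close>
  define \<eta> where "\<eta> = (1 - S) / (2 * (B + 1) * real p ^ 4)"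
  have \<eta>: "0 < \<eta>" unfolding \<eta>_def using S B p by simp
  define \<beta> where "\<beta> i = S ^ 3 * \<alpha> i / q ^ 3 + B * \<eta> * real p ^ 3" for i
  define C where "C = 8 * ?\<mu> ^ 4 / t ^ 3 + B * (2 + 1 / \<eta>)"
  have \<beta>0: "0 \<le> \<beta> i" if "i \<in> {1..p}" for i
    unfolding \<beta>_def using \<alpha>[OF that] S qt B \<eta> by simp
  have C0: "0 \<le> C" unfolding C_def using qt B \<eta> by simp
  have "(\<Sum>i=1..p. \<beta> i) = S ^ 3 / q ^ 3 * S + B * \<eta> * real p ^ 4"
    unfolding \<beta>_def sum.distrib
    by (simp add: sum_distrib_left[symmetric] sum_divide_distrib[symmetric] S_def eval_nat_numeral)
  also have "\<dots> \<le> S + (1 - S) / 2"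
  proof (intro add_mono)
    have "S ^ 3 / q ^ 3 \<le> 1" using S qt by (auto intro: power_mono)
    then show "S ^ 3 / q ^ 3 * S \<le> S" using S qt by (intro mult_left_le_one_le) auto
    have "B * \<eta> * real p ^ 4 = B / (B + 1) * ((1 - S) / 2)" 
    proof -
      have "B * (a / (2 * b * P)) * P = B / b * (a / 2)" if "P \<noteq> 0" "b \<noteq> 0" for a b P :: real
        using that by (simp add: field_simps)
      from this[of "real p ^ 4" "B + 1" "1 - S"] show ?thesis unfolding \<eta>_def using p B by simp
    qed
    also have "\<dots> \<le> 1 * ((1 - S) / 2)" using S B by (intro mult_right_mono) auto
    finally show "B * \<eta> * real p ^ 4 \<le> (1 - S) / 2" by simp
  qed
  also have "\<dots> < 1" using S by (simp add: field_simps)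
  finally have \<beta>1: "(\<Sum>i=1..p. \<beta> i) < 1" .
  have main: "measure_pmf.expectation (step_law p \<alpha> F c) (\<lambda>y. real y ^ 4) \<le> (\<Sum>i=1..p. \<beta> i * real (c i) ^ 4) + C" for c
  proof -
    let ?l = "lag_mean p \<alpha> c" and ?E = "measure_pmf.expectation (step_law p \<alpha> F c)"
    let ?N = "\<Sum>i=1..p. real (c i)" and ?N4 = "\<Sum>i=1..p. real (c i) ^ 4"
    have I4: "integrable (step_law p \<alpha> F c) (\<lambda>y. D c y ^ 4)" by (rule dev(1))
    have pw: "real y ^ 4 \<le> ?l ^ 4 / q ^ 3 + (8 * ?\<mu> ^ 4 + 8 * D c y ^ 4) / t ^ 3" for y
    proof -
      have "(?\<mu> + D c y) ^ 4 \<le> 8 * ?\<mu> ^ 4 + 8 * D c y ^ 4"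
        using sum_power4_le[of "1/2" "1/2" ?\<mu> "D c y"] by (simp add: power_divide)
      then have "(?\<mu> + D c y) ^ 4 / t ^ 3 \<le> (8 * ?\<mu> ^ 4 + 8 * D c y ^ 4) / t ^ 3"
        using qt by (intro divide_right_mono) auto
      moreover have "real y ^ 4 \<le> ?l ^ 4 / q ^ 3 + (?\<mu> + D c y) ^ 4 / t ^ 3"
        using sum_power4_le[OF qt(1-3), of ?l "?\<mu> + D c y"] by (simp add: D_def)
      ultimately show ?thesis by linarith
    qed
    have "?E (\<lambda>y. real y ^ 4) \<le> ?E (\<lambda>y. ?l ^ 4 / q ^ 3 + (8 * ?\<mu> ^ 4 + 8 * D c y ^ 4) / t ^ 3)"
      using I4 by (intro integral_mono I pw) auto
    also have "\<dots> = ?l ^ 4 / q ^ 3 + (8 * ?\<mu> ^ 4 + 8 * ?E (\<lambda>y. D c y ^ 4)) / t ^ 3"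
      using I4 by simp
    also have "\<dots> \<le> ?l ^ 4 / q ^ 3 + (8 * ?\<mu> ^ 4 + 8 * (fourth_const F * (1 + ?N) ^ 2)) / t ^ 3"
      using qt dev(4)[of c] by (intro add_mono divide_right_mono mult_left_mono) auto
    also have "\<dots> = ?l ^ 4 / q ^ 3 + 8 * ?\<mu> ^ 4 / t ^ 3 + B * (1 + ?N) ^ 2"
      unfolding B_def by (simp add: add_divide_distrib)
    also have "\<dots> \<le> S ^ 3 * (\<Sum>i=1..p. \<alpha> i * real (c i) ^ 4) / q ^ 3 + 8 * ?\<mu> ^ 4 / t ^ 3
        + B * (2 + (\<eta> * (real p ^ 3 * ?N4) + 1 / \<eta>))"
    proof (intro add_mono mult_left_mono[OF _ B] divide_right_mono order_refl)
      show "?l ^ 4 \<le> S ^ 3 * (\<Sum>i=1..p. \<alpha> i * real (c i) ^ 4)"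
        unfolding lag_mean_def S_def using \<alpha> by (intro weighted_sum_power4_le) auto
      show "0 \<le> q ^ 3" "0 \<le> t ^ 3" using qt by simp_all
      have "0 \<le> (?N - 1)^2" by simp
      then have "(1 + ?N)^2 \<le> 2 + 2 * ?N^2" by (simp add: power2_eq_square algebra_simps)
      moreover have "2 * ?N^2 \<le> \<eta> * ?N^4 + 1 / \<eta>"
      proof -
        have "0 \<le> (\<eta> * ?N^2 - 1)^2 / \<eta>" using \<eta> by simp
        also have "\<dots> = \<eta> * ?N^4 + 1 / \<eta> - 2 * ?N^2" using \<eta> by (simp add: field_simps eval_nat_numeral)
        finally show ?thesis by simp
      qed
      moreover have "?N^4 \<le> real p ^ 3 * ?N4"
        using weighted_sum_power4_le[of "{1..p}" "\<lambda>_. 1" "\<lambda>i. real (c i)"] by simp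
      then have "\<eta> * ?N^4 \<le> \<eta> * (real p ^ 3 * ?N4)" using \<eta> by (intro mult_left_mono) auto
      ultimately show "(1 + ?N)^2 \<le> 2 + (\<eta> * (real p ^ 3 * ?N4) + 1 / \<eta>)" by linarith
    qed
    also have "\<dots> = (\<Sum>i=1..p. \<beta> i * real (c i) ^ 4) + C"
      unfolding \<beta>_def C_def
      by (simp add: algebra_simps sum.distrib sum_distrib_left sum_divide_distrib)
    finally show ?thesis .
  qed
  show "\<exists>\<beta> C. (\<forall>i\<in>{1..p}. 0 \<le> \<beta> i) \<and> (\<Sum>i=1..p. \<beta> i) < 1 \<and> 0 \<le> C \<and>
      (\<forall>c. measure_pmf.expectation (step_law p \<alpha> F c) (\<lambda>y. real y ^ 4) \<le> (\<Sum>i=1..p. \<beta> i * real (c i) ^ 4) + C)"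
    using \<beta>0 \<beta>1 C0 main by blast
qed

section \<open>Moments of a stationary distribution\<close>

lemma pmf_integrable_bounded:
  fixes f :: "'b \<Rightarrow> real"
  assumes "\<And>x. \<bar>f x\<bar> \<le> B"
  shows "integrable (measure_pmf P) f"
  using assms by (intro measure_pmf.integrable_const_bound[where B = B]) auto

text \<open>
  Integrating the drift inequality directly would presuppose that \<open>V\<close> is integrable. It is therefore tested on the
  truncations \<open>min V L\<close>, and \<open>L\<close> tends to infinity by monotone convergence.
\<close>

lemma stationary_integrable_of_drift:
  fixes V :: "'b \<Rightarrow> real" and N :: "'b pmf" and K :: "'b \<Rightarrow> 'b pmf"
  assumes stat: "bind_pmf N K = N" and V0: "\<And>x. 0 \<le> V x"
    and r: "0 \<le> r" "r < 1" and C: "0 \<le> C"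
    and inner: "\<And>x. integrable (K x) V" and drift: "\<And>x. measure_pmf.expectation (K x) V \<le> r * V x + C"
  shows "integrable N V"
proof -
  let ?E = "measure_pmf.expectation N"
  define U where "U L x = (if V x < real L then V x else 0)" for L :: nat and x
  have U: "0 \<le> U L x" "U L x \<le> real L" for L x using V0 by (auto simp: U_def)
  have Ui: "integrable N (U L)" for L using U by (intro pmf_integrable_bounded[where B = "real L"]) auto
  have bound: "?E (U L) \<le> C / (1 - r)" for L
  proof -
    let ?m = "\<lambda>x. min (V x) (real L)"
    let ?g = "\<lambda>x. min (r * V x + C) (real L)"
    have mi: "integrable (measure_pmf P) ?m" for P using V0 by (intro pmf_integrable_bounded[where B = "real L"]) (auto simp: min_def)
    have gi: "integrable N ?g" using V0 r C by (intro pmf_integrable_bounded[where B = "real L"]) (auto simp: min_def)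
    have "?E ?m = ?E (\<lambda>x. measure_pmf.expectation (K x) ?m)"
      using expectation_bind_pmf(2)[of N K ?m] mi by (simp add: stat)
    also have "\<dots> \<le> ?E ?g"
    proof (rule integral_mono)
      show "integrable N (\<lambda>x. measure_pmf.expectation (K x) ?m)"
        using expectation_bind_pmf(1)[of N K ?m] mi by simp
      show "integrable N ?g" by (rule gi)
      fix x
      have "measure_pmf.expectation (K x) ?m \<le> measure_pmf.expectation (K x) V"
        by (intro integral_mono mi inner) auto
      moreover have "measure_pmf.expectation (K x) ?m \<le> measure_pmf.expectation (K x) (\<lambda>_. real L)"
        by (intro integral_mono mi) auto
      ultimately show "measure_pmf.expectation (K x) ?m \<le> ?g x" using drift[of x] by simp
    qed
    finally have 1: "?E ?m \<le> ?E ?g" .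
    have "(1 - r) * ?E (U L) - C = ?E (\<lambda>x. (1 - r) * U L x - C)" using Ui by simp
    also have "\<dots> \<le> ?E (\<lambda>x. ?m x - ?g x)"
    proof (rule integral_mono)
      fix x
      show "(1 - r) * U L x - C \<le> ?m x - ?g x"
        using r V0[of x] C by (auto simp: U_def min_def algebra_simps)
    qed (use Ui mi gi in auto)
    also have "\<dots> = ?E ?m - ?E ?g" using mi gi by simp
    finally show ?thesis using 1 r by (simp add: field_simps)
  qed
  have mono: "incseq (\<lambda>L. U L x)" for x using V0 by (auto simp: incseq_def U_def)
  have "incseq (\<lambda>L. ?E (U L))" unfolding incseq_def
    using mono by (auto intro!: integral_mono Ui simp: incseq_def)
  then obtain l where l: "(\<lambda>L. ?E (U L)) \<longlonglongrightarrow> l"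
    using incseq_convergent[of "\<lambda>L. ?E (U L)"] bound by blast
  have lim: "(\<lambda>L. U L x) \<longlonglongrightarrow> V x" for x
  proof (rule tendsto_eventually)
    show "eventually (\<lambda>L. U L x = V x) sequentially"
      using eventually_gt_at_top[of "nat \<lceil>V x\<rceil>"] by eventually_elim (auto simp: U_def; linarith)
  qed
  show ?thesis
    by (rule integrable_monotone_convergence[where f = U and x = l]) (use Ui mono lim l in \<open>auto simp: mono_def incseq_def\<close>)
qed

lemma inar_kernel_step_law:
  "inar_kernel p \<alpha> F x =
    map_pmf (\<lambda>y. vec p (\<lambda>m. if m = 0 then y else x $ (m - 1))) (step_law p \<alpha> F (\<lambda>i. x $ (i - 1)))"
  unfolding inar_kernel_def step_law_def map_bind_pmf map_pmf_comp by (simp add: map_pmf_def)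

locale stable_inar =
  fixes p :: nat and \<alpha> :: "nat \<Rightarrow> real"
  assumes p: "1 \<le> p" and \<alpha>: "\<And>i. i \<in> {1..p} \<Longrightarrow> 0 \<le> \<alpha> i \<and> \<alpha> i \<le> 1"
    and stable: "(\<Sum>i=1..p. \<alpha> i) < 1"

locale stationary_inar = stable_inar +
  fixes F :: "nat pmf" and \<pi> :: "nat vec pmf"
  assumes F4: "integrable F (\<lambda>e. real e ^ 4)" and stat: "inar_stationary p \<alpha> F \<pi>"
begin

abbreviation "lags x \<equiv> \<lambda>i. x $ (i - 1)"
abbreviation "push x y \<equiv> vec p (\<lambda>m. if m = 0 then y else x $ (m - 1))"
abbreviation "step x \<equiv> step_law p \<alpha> F (lags x)"
abbreviation "\<mu> \<equiv> innov_mean F"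
abbreviation "E \<equiv> measure_pmf.expectation \<pi>"

lemma bind_stationary: "bind_pmf \<pi> (\<lambda>x. map_pmf (push x) (step x)) = \<pi>"
  using stat unfolding inar_stationary_def inar_kernel_step_law by blast

lemma stationary_expectation:
  fixes f :: "nat vec \<Rightarrow> real"
  assumes "integrable \<pi> f" "\<And>x. integrable (step x) (\<lambda>y. f (push x y))"
  shows "E f = E (\<lambda>x. measure_pmf.expectation (step x) (\<lambda>y. f (push x y)))"
  using expectation_bind_pmf(2)[of \<pi> "\<lambda>x. map_pmf (push x) (step x)" f] assms
  unfolding bind_stationary by simp

text \<open>
  The Lyapunov function gives the component at index \<open>i\<close> the total drift weight of the larger lags plus a margin
  \<open>\<eta>\<close> for each of them, so that after one step every weight has dropped by \<open>\<eta>\<close>.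
\<close>

lemma stationary_fourth_moment:
  assumes "i < p"
  shows "integrable \<pi> (\<lambda>x. real (x $ i) ^ 4)"
proof -
  have I: "integrable (step x) (\<lambda>y. real y ^ 4)" for x by (rule step_law_drift(1)[OF p \<alpha> stable F4])
  obtain \<beta> C where \<beta>: "\<And>i. i \<in> {1..p} \<Longrightarrow> 0 \<le> \<beta> i" "(\<Sum>i=1..p. \<beta> i) < 1" and C: "0 \<le> C"
    and drift: "\<And>c. measure_pmf.expectation (step_law p \<alpha> F c) (\<lambda>y. real y ^ 4) \<le> (\<Sum>i=1..p. \<beta> i * real (c i) ^ 4) + C"
    using step_law_drift(2)[OF p \<alpha> stable F4] by blast
  define \<eta> where "\<eta> = (1 - (\<Sum>i=1..p. \<beta> i)) / real p"
  have \<eta>: "0 < \<eta>" unfolding \<eta>_def using \<beta>(2) p by simp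
  define \<kappa> where "\<kappa> i = (\<Sum>l=i+1..p. \<beta> l + \<eta>)" for i
  define V where "V x = (\<Sum>i<p. \<kappa> i * real (x $ i) ^ 4)" for x :: "nat vec"
  have \<kappa>0: "\<kappa> 0 = 1" unfolding \<kappa>_def sum.distrib \<eta>_def using p by simp
  have \<kappa>_step: "\<kappa> i = \<beta> (i + 1) + \<eta> + \<kappa> (i + 1)" if "i < p" for i
    unfolding \<kappa>_def using that by (subst sum.atLeast_Suc_atMost) auto
  have \<kappa>_nn: "0 \<le> \<kappa> i" for i unfolding \<kappa>_def using \<beta>(1) \<eta> by (intro sum_nonneg add_nonneg_nonneg) auto
  have \<kappa>_le: "\<kappa> i \<le> 1" if "i \<le> p" for i
  proof -
    have "\<kappa> i \<le> \<kappa> 0" unfolding \<kappa>_def using \<beta>(1) \<eta> by (intro sum_mono2) (auto intro: add_nonneg_nonneg less_imp_le)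
    then show ?thesis using \<kappa>0 by simp
  qed
  have \<kappa>p: "\<kappa> p = 0" unfolding \<kappa>_def by simp
  have \<eta>1: "\<eta> \<le> 1" using \<kappa>_step[of 0] \<kappa>_nn[of 1] \<beta>(1)[of 1] p \<kappa>0 by simp
  obtain p' where p': "p = Suc p'" using p by (cases p) auto
  have Vp: "V (push x y) = real y ^ 4 + (\<Sum>i<p'. \<kappa> (Suc i) * real (x $ i) ^ 4)" for x y
    unfolding V_def p' by (subst sum.lessThan_Suc_shift) (simp add: \<kappa>0)
  have "integrable \<pi> V"
  proof (rule stationary_integrable_of_drift[OF bind_stationary, where r = "1 - \<eta>" and C = C])
    show "0 \<le> V x" for x unfolding V_def using \<kappa>_nn by (intro sum_nonneg) auto
    show "0 \<le> 1 - \<eta>" "1 - \<eta> < 1" "0 \<le> C" using \<eta> \<eta>1 C by auto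
    show "integrable (map_pmf (push x) (step x)) V" for x
      using I[of x] by (simp add: Vp)
    fix x
    have "measure_pmf.expectation (map_pmf (push x) (step x)) V =
       measure_pmf.expectation (step x) (\<lambda>y. real y ^ 4) + (\<Sum>i<p'. \<kappa> (Suc i) * real (x $ i) ^ 4)"
      using I[of x] by (simp add: Vp)
    also have "\<dots> \<le> ((\<Sum>i=1..p. \<beta> i * real (lags x i) ^ 4) + C) + (\<Sum>i<p. \<kappa> (Suc i) * real (x $ i) ^ 4)"
      using drift[of "lags x"] \<kappa>_nn unfolding p' by (intro add_mono) auto
    also have "(\<Sum>i=1..p. \<beta> i * real (lags x i) ^ 4) = (\<Sum>i<p. \<beta> (Suc i) * real (x $ i) ^ 4)"
      using sum.atLeast1_atMost_eq[of "\<lambda>i. \<beta> i * real (lags x i) ^ 4" p] by simp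
    also have "(\<Sum>i<p. \<beta> (Suc i) * real (x $ i) ^ 4) + C + (\<Sum>i<p. \<kappa> (Suc i) * real (x $ i) ^ 4) =
       (\<Sum>i<p. (\<kappa> i - \<eta>) * real (x $ i) ^ 4) + C"
      using \<kappa>_step by (auto simp: sum.distrib[symmetric] algebra_simps intro!: sum.cong)
    also have "\<dots> \<le> (\<Sum>i<p. (1 - \<eta>) * (\<kappa> i * real (x $ i) ^ 4)) + C"
    proof (intro add_right_mono sum_mono)
      fix i assume "i \<in> {..<p}"
      then have "\<eta> * \<kappa> i \<le> \<eta>" using \<kappa>_le[of i] \<eta> by simp
      then have "\<kappa> i - \<eta> \<le> (1 - \<eta>) * \<kappa> i" by (simp add: algebra_simps)
      then show "(\<kappa> i - \<eta>) * real (x $ i) ^ 4 \<le> (1 - \<eta>) * (\<kappa> i * real (x $ i) ^ 4)"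
        using mult_right_mono[of "\<kappa> i - \<eta>" "(1 - \<eta>) * \<kappa> i" "real (x $ i) ^ 4"] by (simp add: mult.assoc)
    qed
    also have "\<dots> = (1 - \<eta>) * V x + C" unfolding V_def by (simp add: sum_distrib_left)
    finally show "measure_pmf.expectation (map_pmf (push x) (step x)) V \<le> (1 - \<eta>) * V x + C" .
  qed
  then have Vi: "integrable \<pi> (\<lambda>x. V x / \<eta>)" by simp
  show ?thesis
  proof (rule Bochner_Integration.integrable_bound[OF Vi])
    show "AE x in measure_pmf \<pi>. norm (real (x $ i) ^ 4) \<le> norm (V x / \<eta>)"
    proof (intro always_eventually allI)
      fix x
      have "\<eta> * real (x $ i) ^ 4 \<le> \<kappa> i * real (x $ i) ^ 4"
        using \<kappa>_step[OF assms] \<beta>(1)[of "i + 1"] \<kappa>_nn[of "i + 1"] assms by (intro mult_right_mono) auto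
      also have "\<dots> \<le> V x" unfolding V_def using assms \<kappa>_nn by (intro member_le_sum) auto
      finally have "real (x $ i) ^ 4 \<le> V x / \<eta>" using \<eta> by (simp add: field_simps)
      then show "norm (real (x $ i) ^ 4) \<le> norm (V x / \<eta>)" using abs_ge_self[of "V x / \<eta>"] by (simp del: abs_divide)
    qed
  qed auto
qed

lemma integrable_component: "i < p \<Longrightarrow> integrable \<pi> (\<lambda>x. real (x $ i))"
  using integrable_lower_moments(1)[OF stationary_fourth_moment] by simp

lemma integrable_product:
  assumes "i < p" "j < p"
  shows "integrable \<pi> (\<lambda>x. real (x $ i) * real (x $ j))"
proof (rule Bochner_Integration.integrable_bound)
  show "integrable \<pi> (\<lambda>x. real (x $ i) ^ 2 + real (x $ j) ^ 2)"
    using integrable_lower_moments(2)[OF stationary_fourth_moment] assms by simp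
  show "AE x in measure_pmf \<pi>. norm (real (x $ i) * real (x $ j)) \<le> norm (real (x $ i) ^ 2 + real (x $ j) ^ 2)"
  proof (intro always_eventually allI)
    fix x
    have "0 \<le> (real (x $ i) - real (x $ j))^2" by simp
    then have "2 * (real (x $ i) * real (x $ j)) \<le> real (x $ i) ^ 2 + real (x $ j) ^ 2"
      by (simp add: power2_eq_square algebra_simps)
    moreover have "0 \<le> real (x $ i) * real (x $ j)" by simp
    ultimately have "real (x $ i) * real (x $ j) \<le> real (x $ i) ^ 2 + real (x $ j) ^ 2" by linarith
    then show "norm (real (x $ i) * real (x $ j)) \<le> norm (real (x $ i) ^ 2 + real (x $ j) ^ 2)" by simp
  qed
qed auto

definition m :: real where "m = E (\<lambda>x. real (x $ 0))"

text \<open>The stationary lag products \<open>E X\<^sub>k X\<^sub>k\<^sub>-\<^sub>d\<close> for \<open>d \<le> p\<close>; lag \<open>p\<close> is not visible in the state vector.\<close>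

definition lag_product :: "nat \<Rightarrow> real" where
  "lag_product d = (if d < p then E (\<lambda>x. real (x $ 0) * real (x $ d))
    else (\<Sum>i=1..p. \<alpha> i * E (\<lambda>x. real (x $ 0) * real (x $ (p - i)))) + \<mu> * m)"

lemma deviation_moments:
  defines "D \<equiv> \<lambda>x y. real y - lag_mean p \<alpha> (lags x) - \<mu>"
  shows "integrable (step x) (\<lambda>y. D x y ^ 2)" "integrable (step x) (D x)"
    "measure_pmf.expectation (step x) (D x) = 0"
    "measure_pmf.expectation (step x) (\<lambda>y. D x y ^ 2) = lag_var p \<alpha> (lags x) + innov_var F"
  unfolding D_def 
  using step_law_deviation[where p = p and \<alpha> = \<alpha> and F = F and c = "lags x", OF \<alpha> F4]
    integrable_lower_moments[OF step_law_deviation(1)[where p = p and \<alpha> = \<alpha> and F = F and c = "lags x", OF \<alpha> F4]]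
  by simp_all

lemma step_integrable: "integrable (step x) (\<lambda>y. real y)"
  and step_integrable2: "integrable (step x) (\<lambda>y. real y ^ 2)"
  using integrable_lower_moments[OF step_law_drift(1)[OF p \<alpha> stable F4]] by simp_all

lemma step_mean: "measure_pmf.expectation (step x) real = lag_mean p \<alpha> (lags x) + \<mu>"
proof -
  have "0 = measure_pmf.expectation (step x) (\<lambda>y. real y - lag_mean p \<alpha> (lags x) - \<mu>)"
    using deviation_moments(3)[of x] by simp
  also have "\<dots> = measure_pmf.expectation (step x) real - lag_mean p \<alpha> (lags x) - \<mu>"
    using step_integrable[of x] by simp
  finally show ?thesis by simp
qed

lemma step_second_moment:
  "measure_pmf.expectation (step x) (\<lambda>y. (w * real y + b) ^ 2) =
    w^2 * (lag_var p \<alpha> (lags x) + innov_var F) + (w * (lag_mean p \<alpha> (lags x) + \<mu>) + b) ^ 2"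
proof -
  let ?l = "lag_mean p \<alpha> (lags x) + \<mu>"
  let ?D = "\<lambda>y. real y - lag_mean p \<alpha> (lags x) - \<mu>"
  have "(w * real y + b) ^ 2 = w^2 * ?D y ^ 2 + 2 * w * (w * ?l + b) * ?D y + (w * ?l + b)^2" for y
    by (simp add: power2_eq_square algebra_simps)
  then have "measure_pmf.expectation (step x) (\<lambda>y. (w * real y + b) ^ 2) =
    measure_pmf.expectation (step x) (\<lambda>y. w^2 * ?D y ^ 2 + 2 * w * (w * ?l + b) * ?D y + (w * ?l + b)^2)" by simp
  also have "\<dots> = w^2 * measure_pmf.expectation (step x) (\<lambda>y. ?D y ^ 2)
     + 2 * w * (w * ?l + b) * measure_pmf.expectation (step x) ?D + (w * ?l + b)^2"
    using deviation_moments(1,2)[of x] by simp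
  finally show ?thesis unfolding deviation_moments(3,4) by simp
qed

lemma mean_component: "i < p \<Longrightarrow> E (\<lambda>x. real (x $ i)) = m"
proof (induction i)
  case (Suc i)
  have "E (\<lambda>x. real (x $ Suc i)) = E (\<lambda>x. real (x $ i))"
    using stationary_expectation[of "\<lambda>x. real (x $ Suc i)"] Suc.prems integrable_component by simp
  then show ?case using Suc by simp
qed (simp add: m_def)

lemma mean_lag_mean: "integrable \<pi> (\<lambda>x. lag_mean p \<alpha> (lags x))"
  "E (\<lambda>x. lag_mean p \<alpha> (lags x)) = (\<Sum>i=1..p. \<alpha> i) * m"
proof -
  have i: "integrable \<pi> (\<lambda>x. real (x $ (i - 1)))" if "i \<in> {1..p}" for i using that by (intro integrable_component) auto
  then show "integrable \<pi> (\<lambda>x. lag_mean p \<alpha> (lags x))" unfolding lag_mean_def by (intro Bochner_Integration.integrable_sum integrable_mult_right)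
  have "E (\<lambda>x. lag_mean p \<alpha> (lags x)) = (\<Sum>i=1..p. \<alpha> i * E (\<lambda>x. real (x $ (i - 1))))"
    unfolding lag_mean_def using i by (subst Bochner_Integration.integral_sum) auto
  also have "\<dots> = (\<Sum>i=1..p. \<alpha> i * m)" by (intro sum.cong refl arg_cong2[where f = "(*)"] mean_component) auto
  finally show "E (\<lambda>x. lag_mean p \<alpha> (lags x)) = (\<Sum>i=1..p. \<alpha> i) * m" by (simp add: sum_distrib_right)
qed

lemma mean_lag_var: "integrable \<pi> (\<lambda>x. lag_var p \<alpha> (lags x))"
  "E (\<lambda>x. lag_var p \<alpha> (lags x)) = (\<Sum>i=1..p. \<alpha> i * (1 - \<alpha> i)) * m"
proof -
  have i: "integrable \<pi> (\<lambda>x. real (x $ (i - 1)))" if "i \<in> {1..p}" for i using that by (intro integrable_component) auto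
  then show "integrable \<pi> (\<lambda>x. lag_var p \<alpha> (lags x))" unfolding lag_var_def by (intro Bochner_Integration.integrable_sum integrable_mult_right)
  have "E (\<lambda>x. lag_var p \<alpha> (lags x)) = (\<Sum>i=1..p. \<alpha> i * (1 - \<alpha> i) * E (\<lambda>x. real (x $ (i - 1))))"
    unfolding lag_var_def using i by (subst Bochner_Integration.integral_sum) auto
  also have "\<dots> = (\<Sum>i=1..p. \<alpha> i * (1 - \<alpha> i) * m)" by (intro sum.cong refl arg_cong2[where f = "(*)"] mean_component) auto
  finally show "E (\<lambda>x. lag_var p \<alpha> (lags x)) = (\<Sum>i=1..p. \<alpha> i * (1 - \<alpha> i)) * m" by (simp add: sum_distrib_right)
qed

lemma stationary_mean: "m = (\<Sum>i=1..p. \<alpha> i) * m + \<mu>"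
proof -
  have "m = E (\<lambda>x. lag_mean p \<alpha> (lags x) + \<mu>)"
    unfolding m_def using stationary_expectation[of "\<lambda>x. real (x $ 0)"] p integrable_component step_integrable
    by (simp add: step_mean[unfolded One_nat_def])
  also have "\<dots> = (\<Sum>i=1..p. \<alpha> i) * m + \<mu>" using mean_lag_mean by simp
  finally show ?thesis .
qed

lemma product_eq_lag_product:
  assumes "i < p" "j < p"
  shows "E (\<lambda>x. real (x $ i) * real (x $ j)) = lag_product (nat \<bar>int i - int j\<bar>)"
proof -
  have *: "E (\<lambda>x. real (x $ i) * real (x $ (i + d))) = lag_product d" if "i + d < p" for i d
    using that
  proof (induction i)
    case (Suc i)
    have "E (\<lambda>x. real (x $ Suc i) * real (x $ (Suc i + d))) = E (\<lambda>x. real (x $ i) * real (x $ (i + d)))"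
      using stationary_expectation[of "\<lambda>x. real (x $ Suc i) * real (x $ (Suc i + d))"] Suc.prems integrable_product
      by simp
    then show ?case using Suc by simp
  qed (simp add: lag_product_def)
  show ?thesis
  proof (cases "i \<le> j")
    case True
    then have "nat \<bar>int i - int j\<bar> = j - i" by simp
    then show ?thesis using *[of i "j - i"] True assms by simp
  next
    case False
    then have "nat \<bar>int i - int j\<bar> = i - j" by simp
    then show ?thesis using *[of j "i - j"] False assms by (simp add: mult.commute)
  qed
qed

lemma prediction_product:
  assumes "d \<in> {1..p}"
  shows "integrable \<pi> (\<lambda>x. (lag_mean p \<alpha> (lags x) + \<mu>) * real (x $ (d - 1)))"
    and "E (\<lambda>x. (lag_mean p \<alpha> (lags x) + \<mu>) * real (x $ (d - 1))) =
      (\<Sum>i=1..p. \<alpha> i * lag_product (nat \<bar>int i - int d\<bar>)) + \<mu> * m"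
proof -
  have eq: "(lag_mean p \<alpha> (lags x) + \<mu>) * real (x $ (d - 1)) =
     (\<Sum>i=1..p. \<alpha> i * (real (x $ (i - 1)) * real (x $ (d - 1)))) + \<mu> * real (x $ (d - 1))" for x
    unfolding lag_mean_def by (simp add: distrib_right sum_distrib_right mult.assoc)
  have i: "integrable \<pi> (\<lambda>x. real (x $ (i - 1)) * real (x $ (d - 1)))" if "i \<in> {1..p}" for i
    using that assms by (intro integrable_product) auto
  have d: "integrable \<pi> (\<lambda>x. real (x $ (d - 1)))" using assms by (intro integrable_component) auto
  show "integrable \<pi> (\<lambda>x. (lag_mean p \<alpha> (lags x) + \<mu>) * real (x $ (d - 1)))"
    unfolding eq using i d by (intro Bochner_Integration.integrable_add Bochner_Integration.integrable_sum integrable_mult_right)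
  have "E (\<lambda>x. (lag_mean p \<alpha> (lags x) + \<mu>) * real (x $ (d - 1))) =
     (\<Sum>i=1..p. \<alpha> i * E (\<lambda>x. real (x $ (i - 1)) * real (x $ (d - 1)))) + \<mu> * E (\<lambda>x. real (x $ (d - 1)))"
    unfolding eq using i d
    by (subst Bochner_Integration.integral_add) (auto intro!: Bochner_Integration.integrable_sum simp: Bochner_Integration.integral_sum)
  also have "\<dots> = (\<Sum>i=1..p. \<alpha> i * lag_product (nat \<bar>int i - int d\<bar>)) + \<mu> * m"
  proof (intro arg_cong2[where f = "(+)"] arg_cong2[where f = "(*)"] refl sum.cong)
    show "E (\<lambda>x. real (x $ (d - 1))) = m" using assms by (intro mean_component) auto
    fix i assume "i \<in> {1..p}"
    then have "nat \<bar>int (i - 1) - int (d - 1)\<bar> = nat \<bar>int i - int d\<bar>" using assms by auto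
    then show "E (\<lambda>x. real (x $ (i - 1)) * real (x $ (d - 1))) = lag_product (nat \<bar>int i - int d\<bar>)"
      using product_eq_lag_product[of "i - 1" "d - 1"] \<open>i \<in> _\<close> assms by fastforce
  qed
  finally show "E (\<lambda>x. (lag_mean p \<alpha> (lags x) + \<mu>) * real (x $ (d - 1))) =
      (\<Sum>i=1..p. \<alpha> i * lag_product (nat \<bar>int i - int d\<bar>)) + \<mu> * m" .
qed

text \<open>
  For \<open>d < p\<close> the newest value of a stationary state is replaced by its conditional mean; at lag \<open>p\<close> the equation
  holds by the definition of the lag product.
\<close>

lemma yule_walker:
  assumes "d \<in> {1..p}"
  shows "lag_product d = (\<Sum>i=1..p. \<alpha> i * lag_product (nat \<bar>int i - int d\<bar>)) + \<mu> * m"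
proof (cases "d < p")
  case True
  have "lag_product d = E (\<lambda>x. measure_pmf.expectation (step x) (\<lambda>y. real y * real (x $ (d - 1))))"
    unfolding lag_product_def
    using stationary_expectation[of "\<lambda>x. real (x $ 0) * real (x $ d)"] p True assms integrable_product step_integrable
    by simp
  also have "\<dots> = E (\<lambda>x. (lag_mean p \<alpha> (lags x) + \<mu>) * real (x $ (d - 1)))" by (simp add: step_mean[unfolded One_nat_def])
  finally show ?thesis using prediction_product(2)[OF assms] by simp
next
  case False
  then have d: "d = p" using assms by simp
  have "nat \<bar>int i - int p\<bar> = p - i \<and> p - i < p" if "i \<in> {1..p}" for i using that by auto
  then have "\<alpha> i * lag_product (nat \<bar>int i - int p\<bar>) = \<alpha> i * E (\<lambda>x. real (x $ 0) * real (x $ (p - i)))"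
    if "i \<in> {1..p}" for i using that by (simp add: lag_product_def)
  then have "(\<Sum>i=1..p. \<alpha> i * lag_product (nat \<bar>int i - int p\<bar>)) = (\<Sum>i=1..p. \<alpha> i * E (\<lambda>x. real (x $ 0) * real (x $ (p - i))))"
    by (rule sum.cong[OF refl])
  then show ?thesis unfolding d by (simp only: lag_product_def[of p] less_irrefl if_False)
qed

text \<open>
  The second moment of the newest value is that of its conditional mean plus the mean conditional variance; the
  former is expanded with the equations at positive lags.
\<close>

lemma yule_walker_variance:
  "lag_product 0 = (\<Sum>i=1..p. \<alpha> i * lag_product i) + \<mu> * m + (\<Sum>i=1..p. \<alpha> i * (1 - \<alpha> i)) * m + innov_var F"
proof -
  let ?l = "\<lambda>x. lag_mean p \<alpha> (lags x)"
  have sq: "(?l x + \<mu>)^2 = (\<Sum>i=1..p. \<alpha> i * ((?l x + \<mu>) * real (x $ (i - 1)))) + \<mu> * (?l x + \<mu>)" for x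
  proof -
    have "(?l x + \<mu>)^2 = (?l x + \<mu>) * ?l x + \<mu> * (?l x + \<mu>)" by (simp add: power2_eq_square algebra_simps)
    also have "(?l x + \<mu>) * ?l x = (\<Sum>i=1..p. \<alpha> i * ((?l x + \<mu>) * real (x $ (i - 1))))"
      by (subst (2) lag_mean_def) (simp add: sum_distrib_left ac_simps)
    finally show ?thesis .
  qed
  have isq: "integrable \<pi> (\<lambda>x. (?l x + \<mu>)^2)"
    unfolding sq using prediction_product(1) mean_lag_mean(1)
    by (intro Bochner_Integration.integrable_add Bochner_Integration.integrable_sum integrable_mult_right) auto
  have "E (\<lambda>x. (?l x + \<mu>)^2) = (\<Sum>i=1..p. \<alpha> i * E (\<lambda>x. (?l x + \<mu>) * real (x $ (i - 1)))) + \<mu> * (E ?l + \<mu>)"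
    unfolding sq using prediction_product(1) mean_lag_mean(1)
    by (subst Bochner_Integration.integral_add) (auto intro!: Bochner_Integration.integrable_sum simp: Bochner_Integration.integral_sum)
  also have "E ?l + \<mu> = m" using mean_lag_mean(2) stationary_mean by simp
  also have "(\<Sum>i=1..p. \<alpha> i * E (\<lambda>x. (?l x + \<mu>) * real (x $ (i - 1)))) = (\<Sum>i=1..p. \<alpha> i * lag_product i)"
    using prediction_product(2) yule_walker by (intro sum.cong) auto
  finally have esq: "E (\<lambda>x. (?l x + \<mu>)^2) = (\<Sum>i=1..p. \<alpha> i * lag_product i) + \<mu> * m" .
  have "lag_product 0 = E (\<lambda>x. real (x $ 0) ^ 2)" unfolding lag_product_def using p by (simp add: power2_eq_square)
  also have "\<dots> = E (\<lambda>x. measure_pmf.expectation (step x) (\<lambda>y. (1 * real y + 0) ^ 2))"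
    using stationary_expectation[of "\<lambda>x. real (x $ 0) ^ 2"] p integrable_product[of 0 0] step_integrable2
    by (simp add: power2_eq_square)
  also have "\<dots> = E (\<lambda>x. (lag_var p \<alpha> (lags x) + innov_var F) + (?l x + \<mu>)^2)"
    unfolding step_second_moment by simp
  also have "\<dots> = (\<Sum>i=1..p. \<alpha> i * (1 - \<alpha> i)) * m + innov_var F + ((\<Sum>i=1..p. \<alpha> i * lag_product i) + \<mu> * m)"
    using isq esq mean_lag_var by simp
  finally show ?thesis by simp
qed

lemma affine_square_integrable:
  "integrable \<pi> (\<lambda>x. ((\<Sum>a<p. w a * real (x $ a)) + c) ^ 2)"
proof -
  have "((\<Sum>a<p. w a * real (x $ a)) + c) ^ 2 =
    (\<Sum>a<p. \<Sum>b<p. w a * w b * (real (x $ a) * real (x $ b))) + 2 * c * (\<Sum>a<p. w a * real (x $ a)) + c^2" for x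
  proof -
    have "(\<Sum>a<p. w a * real (x $ a)) ^ 2 = (\<Sum>a<p. \<Sum>b<p. w a * w b * (real (x $ a) * real (x $ b)))"
      by (simp add: sum_product power2_eq_square ac_simps)
    then show ?thesis by (simp add: power2_sum)
  qed
  then show ?thesis
    using integrable_product integrable_component
    by (simp only:, intro Bochner_Integration.integrable_add Bochner_Integration.integrable_sum integrable_mult_right) auto
qed

text \<open>
  If an affine function of a stationary state vanishes in mean square, the weight of the newest component is zero,
  because that component carries fresh noise of positive mean conditional variance. By stationarity the function
  with shifted weights vanishes too, and the argument repeats.
\<close>

lemma affine_zero:
  assumes nondeg: "(\<Sum>i=1..p. \<alpha> i) > 0 \<or> innov_var F > 0" and \<mu>: "\<mu> > 0"
    and "E (\<lambda>x. ((\<Sum>a<p. w a * real (x $ a)) + c) ^ 2) = 0"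
  shows "\<And>a. a < p \<Longrightarrow> w a = 0" and "c = 0"
proof -
  have S: "0 \<le> (\<Sum>i=1..p. \<alpha> i)" using \<alpha> by (intro sum_nonneg) auto
  have "m * (1 - (\<Sum>i=1..p. \<alpha> i)) = \<mu>" using stationary_mean by (simp add: algebra_simps)
  then have m: "0 < m" using \<mu> stable by (metis diff_gt_0_iff_gt zero_less_mult_pos2)
  have \<alpha>1: "\<alpha> i < 1" if "i \<in> {1..p}" for i
    using member_le_sum[of i "{1..p}" \<alpha>] that \<alpha> stable by force
  have nn: "0 \<le> \<alpha> i * (1 - \<alpha> i)" if "i \<in> {1..p}" for i using \<alpha>[OF that] by simp
  have v0: "0 \<le> innov_var F" by (auto intro!: integral_nonneg_AE)
  have t0: "0 \<le> (\<Sum>i=1..p. \<alpha> i * (1 - \<alpha> i))" using nn by (rule sum_nonneg)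
  have pos: "0 < (\<Sum>i=1..p. \<alpha> i * (1 - \<alpha> i)) * m + innov_var F"
    using nondeg
  proof
    assume "(\<Sum>i=1..p. \<alpha> i) > 0"
    then obtain i where i: "i \<in> {1..p}" "\<alpha> i > 0"
      by (metis (no_types, lifting) sum_nonpos not_le)
    then have "0 < \<alpha> i * (1 - \<alpha> i)" using \<alpha>1 by simp
    also have "\<dots> \<le> (\<Sum>i=1..p. \<alpha> i * (1 - \<alpha> i))" using i nn by (intro member_le_sum) auto
    finally show ?thesis using m v0 by (simp add: add_pos_nonneg)
  next
    assume "innov_var F > 0"
    then show ?thesis using m t0 by (simp add: add_nonneg_pos)
  qed
  obtain p' where p': "p = Suc p'" using p by (cases p) auto
  have shift: "E (\<lambda>x. ((\<Sum>a<p. w a * real (x $ a)) + c) ^ 2) \<ge> (w 0)^2 * ((\<Sum>i=1..p. \<alpha> i * (1 - \<alpha> i)) * m + innov_var F)"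
    for w :: "nat \<Rightarrow> real"
  proof -
    let ?b = "\<lambda>x. (\<Sum>a<p'. w (Suc a) * real (x $ a)) + c"
    have eq: "(\<Sum>a<p. w a * real (push x y $ a)) + c = w 0 * real y + ?b x" for x y
      unfolding p' by (subst sum.lessThan_Suc_shift) simp
    have inner: "integrable (step x) (\<lambda>y. (w 0 * real y + b) ^ 2)" for x b
      using step_integrable step_integrable2 by (simp add: power2_sum power_mult_distrib mult.assoc)
    let ?q = "\<lambda>x. measure_pmf.expectation (step x) (\<lambda>y. (w 0 * real y + ?b x) ^ 2)"
    have "E (\<lambda>x. ((\<Sum>a<p. w a * real (x $ a)) + c) ^ 2) = E ?q"
      using stationary_expectation[OF affine_square_integrable[of w c]] inner unfolding eq by simp
    moreover have "integrable \<pi> ?q"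
      using expectation_bind_pmf(1)[of \<pi> "\<lambda>x. map_pmf (push x) (step x)" "\<lambda>x. ((\<Sum>a<p. w a * real (x $ a)) + c) ^ 2"]
        affine_square_integrable[of w c] inner unfolding bind_stationary integral_map_pmf integrable_map_pmf_eq eq by simp
    moreover have "E (\<lambda>x. (w 0)^2 * (lag_var p \<alpha> (lags x) + innov_var F)) \<le> E ?q"
      using mean_lag_var(1) by (intro integral_mono calculation(2)) (auto simp: step_second_moment[unfolded One_nat_def])
    ultimately show ?thesis using mean_lag_var by simp
  qed
  have first: "w 0 = 0" if "E (\<lambda>x. ((\<Sum>a<p. w a * real (x $ a)) + c) ^ 2) = 0" for w
  proof (rule ccontr)
    assume "w 0 \<noteq> 0"
    then have "0 < (w 0)^2 * ((\<Sum>i=1..p. \<alpha> i * (1 - \<alpha> i)) * m + innov_var F)" using pos by simp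
    then show False using shift[of w] that by simp
  qed
  have all: "a < p \<Longrightarrow> E (\<lambda>x. ((\<Sum>a<p. w a * real (x $ a)) + c) ^ 2) = 0 \<Longrightarrow> w a = 0" for a w
  proof (induction a arbitrary: w)
    case 0
    then show ?case using first by simp
  next
    case (Suc a)
    let ?w = "\<lambda>a. if Suc a < p then w (Suc a) else 0"
    have w0: "w 0 = 0" using first Suc.prems by simp
    have eq: "(\<Sum>a<p. w a * real (push x y $ a)) + c = (\<Sum>a<p. ?w a * real (x $ a)) + c" for x y
    proof -
      have "(\<Sum>a<p. w a * real (push x y $ a)) = (\<Sum>a<p'. w (Suc a) * real (x $ a))"
        unfolding p' by (subst sum.lessThan_Suc_shift) (simp add: w0)
      also have "\<dots> = (\<Sum>a<p. ?w a * real (x $ a))" unfolding p' by simp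
      finally show ?thesis by simp
    qed
    have "E (\<lambda>x. ((\<Sum>a<p. ?w a * real (x $ a)) + c) ^ 2) = 0"
      using stationary_expectation[OF affine_square_integrable[of w c]] Suc.prems(2) unfolding eq by simp
    then have "?w a = 0" using Suc.IH[of ?w] Suc.prems by simp
    then show ?case using Suc.prems by simp
  qed
  show w: "\<And>a. a < p \<Longrightarrow> w a = 0" using all assms(3) by blast
  then have "E (\<lambda>x. ((\<Sum>a<p. w a * real (x $ a)) + c) ^ 2) = c^2" by simp
  then show "c = 0" using assms(3) by simp
qed

end

section \<open>The law of the path and its martingales\<close>

text \<open>
  A path is a function on the integers, so that every statistic of the process is a function of the path. The
  coordinates after time \<open>k\<close> are those of the initial law.
\<close>

primrec path_law :: "nat \<Rightarrow> (nat \<Rightarrow> real) \<Rightarrow> (int \<Rightarrow> nat) pmf \<Rightarrow> (nat \<Rightarrow> nat pmf) \<Rightarrow> nat \<Rightarrow> (int \<Rightarrow> nat) pmf" where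
  "path_law p \<alpha> I Fs 0 = I"
| "path_law p \<alpha> I Fs (Suc k) = bind_pmf (path_law p \<alpha> I Fs k) (\<lambda>x.
    map_pmf (\<lambda>y. x(int (Suc k) := y)) (step_law p \<alpha> (Fs (Suc k)) (\<lambda>i. x (int (Suc k) - int i))))"

definition depends_upto :: "nat \<Rightarrow> ((int \<Rightarrow> nat) \<Rightarrow> 'b) \<Rightarrow> bool" where
  "depends_upto k f \<longleftrightarrow> (\<forall>x y. (\<forall>j\<le>int k. x j = y j) \<longrightarrow> f x = f y)"

lemma depends_upto_update: "depends_upto k f \<Longrightarrow> k \<le> m \<Longrightarrow> f (x(int (Suc m) := y)) = f x"
  unfolding depends_upto_def by (elim allE impE) auto

lemma nn_integral_path_law_later:
  assumes "depends_upto k f" "k \<le> n"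
  shows "(\<integral>\<^sup>+x. f x \<partial>path_law p \<alpha> I Fs n) = (\<integral>\<^sup>+x. f x \<partial>path_law p \<alpha> I Fs k)"
  using assms(2)
proof (induction n rule: dec_induct)
  case (step m)
  have "f (x(int (Suc m) := y)) = f x" for x y using depends_upto_update[OF assms(1)] step.hyps by blast
  then show ?case using step.IH by (simp del: of_nat_Suc)
qed simp

lemma nn_integral_path_law_Suc_le:
  assumes inner: "\<And>x. integrable (step_law p \<alpha> (Fs (Suc k)) (\<lambda>i. x (int (Suc k) - int i))) (\<lambda>y. g (x(int (Suc k) := y)) :: real)"
    and g: "\<And>x. 0 \<le> g x"
    and le: "\<And>x. measure_pmf.expectation (step_law p \<alpha> (Fs (Suc k)) (\<lambda>i. x (int (Suc k) - int i))) (\<lambda>y. g (x(int (Suc k) := y))) \<le> h x"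
  shows "(\<integral>\<^sup>+x. ennreal (g x) \<partial>path_law p \<alpha> I Fs (Suc k)) \<le> (\<integral>\<^sup>+x. ennreal (h x) \<partial>path_law p \<alpha> I Fs k)"
proof -
  have "(\<integral>\<^sup>+x. ennreal (g x) \<partial>path_law p \<alpha> I Fs (Suc k)) =
    (\<integral>\<^sup>+x. ennreal (measure_pmf.expectation (step_law p \<alpha> (Fs (Suc k)) (\<lambda>i. x (int (Suc k) - int i))) (\<lambda>y. g (x(int (Suc k) := y)))) \<partial>path_law p \<alpha> I Fs k)"
    using g by (simp add: nn_integral_eq_integral[OF inner] del: of_nat_Suc)
  also have "\<dots> \<le> (\<integral>\<^sup>+x. ennreal (h x) \<partial>path_law p \<alpha> I Fs k)"
    using le by (intro nn_integral_mono ennreal_leI)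
  finally show ?thesis .
qed

locale changing_inar = stable_inar +
  fixes F' F'' :: "nat pmf" and I :: "(int \<Rightarrow> nat) pmf"
  assumes F'4: "integrable F' (\<lambda>e. real e ^ 4)" and F''4: "integrable F'' (\<lambda>e. real e ^ 4)"
    and I4: "\<And>i. i < p \<Longrightarrow> integrable I (\<lambda>x. real (x (- int i)) ^ 4)"
begin

text \<open>
  All ways of switching between the two innovation laws. The constants below depend on the two laws only, hence
  serve every sample size and change point at once.
\<close>

definition "regimes = {Fs :: nat \<Rightarrow> nat pmf. \<forall>k. Fs k = F' \<or> Fs k = F''}"

abbreviation "paths Fs n \<equiv> path_law p \<alpha> I Fs n"
abbreviation "lagv x k \<equiv> \<lambda>i. x (int k - int i)"

lemma regimes_fourth: "Fs \<in> regimes \<Longrightarrow> integrable (Fs k) (\<lambda>e. real e ^ 4)"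
  using F'4 F''4 unfolding regimes_def by (metis (mono_tags, lifting) mem_Collect_eq)

text \<open>
  By the drift inequality a new fourth moment is at most a combination, of total weight below one, of \<open>p\<close> earlier
  ones plus a constant, so a large enough bound reproduces itself.
\<close>

lemma fourth_moment_bound:
  obtains B where "0 \<le> B" and
    "\<And>Fs n j. Fs \<in> regimes \<Longrightarrow> - int p < j \<Longrightarrow> j \<le> int n \<Longrightarrow> (\<integral>\<^sup>+x. ennreal (real (x j) ^ 4) \<partial>paths Fs n) \<le> ennreal B"
proof -
  obtain \<beta>' C' where b': "\<And>i. i \<in> {1..p} \<Longrightarrow> 0 \<le> \<beta>' i" "(\<Sum>i=1..p. \<beta>' i) < 1" "0 \<le> C'"
    "\<And>c. measure_pmf.expectation (step_law p \<alpha> F' c) (\<lambda>y. real y ^ 4) \<le> (\<Sum>i=1..p. \<beta>' i * real (c i) ^ 4) + C'"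
    using step_law_drift(2)[OF p \<alpha> stable F'4] by blast
  obtain \<beta>'' C'' where b'': "\<And>i. i \<in> {1..p} \<Longrightarrow> 0 \<le> \<beta>'' i" "(\<Sum>i=1..p. \<beta>'' i) < 1" "0 \<le> C''"
    "\<And>c. measure_pmf.expectation (step_law p \<alpha> F'' c) (\<lambda>y. real y ^ 4) \<le> (\<Sum>i=1..p. \<beta>'' i * real (c i) ^ 4) + C''"
    using step_law_drift(2)[OF p \<alpha> stable F''4] by blast
  define B where "B = (\<Sum>i<p. measure_pmf.expectation I (\<lambda>x. real (x (- int i)) ^ 4)) + C' / (1 - (\<Sum>i=1..p. \<beta>' i)) + C'' / (1 - (\<Sum>i=1..p. \<beta>'' i))"
  have I0: "0 \<le> measure_pmf.expectation I (\<lambda>x. real (x (- int i)) ^ 4)" for i by (intro integral_nonneg_AE) auto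
  have C'B: "C' / (1 - (\<Sum>i=1..p. \<beta>' i)) \<le> B" and C''B: "C'' / (1 - (\<Sum>i=1..p. \<beta>'' i)) \<le> B"
    using b'(2,3) b''(2,3) sum_nonneg[of "{..<p}", OF I0] by (auto simp: B_def)
  have B0: "0 \<le> B" using C'B b'(2,3) by (smt (verit) divide_nonneg_nonneg)
  have IB: "measure_pmf.expectation I (\<lambda>x. real (x (- int i)) ^ 4) \<le> B" if "i < p" for i
  proof -
    have "measure_pmf.expectation I (\<lambda>x. real (x (- int i)) ^ 4) \<le> (\<Sum>i<p. measure_pmf.expectation I (\<lambda>x. real (x (- int i)) ^ 4))"
      using that I0 by (intro member_le_sum) auto
    then show ?thesis unfolding B_def using b'(2,3) b''(2,3) by (smt (verit) divide_nonneg_nonneg)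
  qed
  have bnd': "(\<Sum>i=1..p. \<beta>' i * B) + C' \<le> B" and bnd'': "(\<Sum>i=1..p. \<beta>'' i * B) + C'' \<le> B"
  proof -
    have *: "s * B + C \<le> B" if "C / (1 - s) \<le> B" "s < 1" for s C
      using that by (simp add: field_simps)
    show "(\<Sum>i=1..p. \<beta>' i * B) + C' \<le> B" "(\<Sum>i=1..p. \<beta>'' i * B) + C'' \<le> B"
      using *[OF C'B b'(2)] *[OF C''B b''(2)] by (simp_all add: sum_distrib_right)
  qed
  have "(\<integral>\<^sup>+x. ennreal (real (x j) ^ 4) \<partial>paths Fs n) \<le> ennreal B"
    if Fs: "Fs \<in> regimes" and j: "- int p < j" "j \<le> int n" for Fs n j
    using j
  proof (induction n arbitrary: j)
    case 0
    define i where "i = nat (- j)"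
    have i: "j = - int i" "i < p" using 0 by (auto simp: i_def)
    have "(\<integral>\<^sup>+x. ennreal (real (x j) ^ 4) \<partial>I) = ennreal (measure_pmf.expectation I (\<lambda>x. real (x j) ^ 4))"
      using I4[OF i(2)] i(1) by (intro nn_integral_eq_integral) auto
    then show ?case using IB[OF i(2)] i(1) by (simp add: ennreal_leI)
  next
    case (Suc n)
    show ?case
    proof (cases "j \<le> int n")
      case True
      then have "depends_upto n (\<lambda>x. ennreal (real (x j) ^ 4))" unfolding depends_upto_def by auto
      from nn_integral_path_law_later[OF this, of "Suc n"] show ?thesis
        using Suc.IH[of j] Suc.prems True by (simp del: path_law.simps)
    next
      case False
      then have j: "j = int (Suc n)" using Suc.prems by simp
      have step: "(\<integral>\<^sup>+x. ennreal (real (x j) ^ 4) \<partial>paths Fs (Suc n)) \<le> ennreal B"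
        if \<beta>: "\<And>i. i \<in> {1..p} \<Longrightarrow> 0 \<le> \<beta> i" and C: "0 \<le> C" and bnd: "(\<Sum>i=1..p. \<beta> i * B) + C \<le> B"
          and drift: "\<And>c. measure_pmf.expectation (step_law p \<alpha> (Fs (Suc n)) c) (\<lambda>y. real y ^ 4) \<le> (\<Sum>i=1..p. \<beta> i * real (c i) ^ 4) + C" for \<beta> C
      proof -
        have "(\<integral>\<^sup>+x. ennreal (real (x j) ^ 4) \<partial>paths Fs (Suc n)) \<le>
           (\<integral>\<^sup>+x. ennreal ((\<Sum>i=1..p. \<beta> i * real (lagv x (Suc n) i) ^ 4) + C) \<partial>paths Fs n)"
          unfolding j
          by (rule nn_integral_path_law_Suc_le) (use step_law_drift(1)[OF p \<alpha> stable regimes_fourth[OF Fs]] drift in auto)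
        also have "\<dots> = (\<integral>\<^sup>+x. (\<Sum>i=1..p. ennreal (\<beta> i) * ennreal (real (lagv x (Suc n) i) ^ 4)) + ennreal C \<partial>paths Fs n)"
        proof (intro nn_integral_cong)
          fix x :: "int \<Rightarrow> nat"
          have s0: "0 \<le> (\<Sum>i=1..p. \<beta> i * real (lagv x (Suc n) i) ^ 4)" using \<beta> by (intro sum_nonneg mult_nonneg_nonneg) auto
          have "ennreal (\<Sum>i=1..p. \<beta> i * real (lagv x (Suc n) i) ^ 4) = (\<Sum>i=1..p. ennreal (\<beta> i * real (lagv x (Suc n) i) ^ 4))"
            using \<beta> by (intro sum_ennreal[symmetric] mult_nonneg_nonneg) auto
          also have "\<dots> = (\<Sum>i=1..p. ennreal (\<beta> i) * ennreal (real (lagv x (Suc n) i) ^ 4))"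
            using \<beta> by (intro sum.cong refl ennreal_mult) auto
          finally show "ennreal ((\<Sum>i=1..p. \<beta> i * real (lagv x (Suc n) i) ^ 4) + C) =
            (\<Sum>i=1..p. ennreal (\<beta> i) * ennreal (real (lagv x (Suc n) i) ^ 4)) + ennreal C"
            using ennreal_plus[OF s0 C] by simp
        qed
        also have "\<dots> = (\<Sum>i=1..p. ennreal (\<beta> i) * (\<integral>\<^sup>+x. ennreal (real (lagv x (Suc n) i) ^ 4) \<partial>paths Fs n)) + ennreal C"
          by (simp add: nn_integral_add nn_integral_sum nn_integral_cmult del: of_nat_Suc)
        also have "\<dots> \<le> (\<Sum>i=1..p. ennreal (\<beta> i) * ennreal B) + ennreal C"
          by (intro add_right_mono sum_mono mult_left_mono Suc.IH) auto
        also have "\<dots> = ennreal ((\<Sum>i=1..p. \<beta> i * B) + C)"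
        proof -
          have s0: "0 \<le> (\<Sum>i=1..p. \<beta> i * B)" using \<beta> B0 by (intro sum_nonneg mult_nonneg_nonneg) auto
          have "ennreal (\<Sum>i=1..p. \<beta> i * B) = (\<Sum>i=1..p. ennreal (\<beta> i * B))"
            using \<beta> B0 by (intro sum_ennreal[symmetric] mult_nonneg_nonneg) auto
          also have "\<dots> = (\<Sum>i=1..p. ennreal (\<beta> i) * ennreal B)"
            using \<beta> B0 by (intro sum.cong refl ennreal_mult) auto
          finally show ?thesis using ennreal_plus[OF s0 C] by simp
        qed
        also have "\<dots> \<le> ennreal B" using bnd by (rule ennreal_leI)
        finally show ?thesis .
      qed
      have "Fs (Suc n) = F' \<or> Fs (Suc n) = F''" using Fs unfolding regimes_def by auto
      then show ?thesis
      proof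
        assume "Fs (Suc n) = F'"
        then show ?thesis using step[of \<beta>' C'] b' bnd' by simp
      next
        assume "Fs (Suc n) = F''"
        then show ?thesis using step[of \<beta>'' C''] b'' bnd'' by simp
      qed
    qed
  qed
  then show ?thesis using that[OF B0] by blast
qed

definition moment_bound :: real where
  "moment_bound = (SOME B. 0 \<le> B \<and> (\<forall>Fs n j. Fs \<in> regimes \<longrightarrow> - int p < j \<longrightarrow> j \<le> int n \<longrightarrow>
     (\<integral>\<^sup>+x. ennreal (real (x j) ^ 4) \<partial>paths Fs n) \<le> ennreal B))"

lemma moment_bound:
  shows "0 \<le> moment_bound" and
    "Fs \<in> regimes \<Longrightarrow> - int p < j \<Longrightarrow> j \<le> int n \<Longrightarrow> (\<integral>\<^sup>+x. ennreal (real (x j) ^ 4) \<partial>paths Fs n) \<le> ennreal moment_bound"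
proof -
  have "\<exists>B. 0 \<le> B \<and> (\<forall>Fs n j. Fs \<in> regimes \<longrightarrow> - int p < j \<longrightarrow> j \<le> int n \<longrightarrow>
     (\<integral>\<^sup>+x. ennreal (real (x j) ^ 4) \<partial>paths Fs n) \<le> ennreal B)"
    using fourth_moment_bound by metis
  from someI_ex[OF this, folded moment_bound_def]
  show "0 \<le> moment_bound" and
    "Fs \<in> regimes \<Longrightarrow> - int p < j \<Longrightarrow> j \<le> int n \<Longrightarrow> (\<integral>\<^sup>+x. ennreal (real (x j) ^ 4) \<partial>paths Fs n) \<le> ennreal moment_bound"
    by auto
qed

text \<open>
  Given the past the increment is centred, so the second moment of the sum grows by the mean conditional second
  moment of the increment, which the fourth moments of the path bound.
\<close>

lemma martingale_bound:
  fixes d :: "nat \<Rightarrow> (int \<Rightarrow> nat) \<Rightarrow> real"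
  assumes Fs: "Fs \<in> regimes" and A: "0 \<le> A" and adapted: "\<And>k. depends_upto k (d k)"
    and sq: "\<And>k x. integrable (step_law p \<alpha> (Fs (Suc k)) (lagv x (Suc k))) (\<lambda>y. d (Suc k) (x(int (Suc k) := y)) ^ 2)"
    and cent: "\<And>k x. measure_pmf.expectation (step_law p \<alpha> (Fs (Suc k)) (lagv x (Suc k))) (\<lambda>y. d (Suc k) (x(int (Suc k) := y))) = 0"
    and bd: "\<And>k x. measure_pmf.expectation (step_law p \<alpha> (Fs (Suc k)) (lagv x (Suc k))) (\<lambda>y. d (Suc k) (x(int (Suc k) := y)) ^ 2)
      \<le> A * (1 + (\<Sum>i=1..p. real (lagv x (Suc k) i) ^ 4))"
    and "k \<le> n"
  shows "(\<integral>\<^sup>+x. ennreal ((\<Sum>j=1..k. d j x) ^ 2) \<partial>paths Fs n) \<le> ennreal (A * (1 + real p * moment_bound) * real k)"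
proof -
  have dep: "depends_upto k (\<lambda>x. \<Sum>j=1..k. d j x)" for k
    unfolding depends_upto_def
  proof (intro allI impI sum.cong refl)
    fix x y :: "int \<Rightarrow> nat" and j assume xy: "\<forall>j\<le>int k. x j = y j" and "j \<in> {1..k}"
    then have "\<forall>i\<le>int j. x i = y i" by auto
    then show "d j x = d j y" using adapted[of j] unfolding depends_upto_def by blast
  qed
  have "(\<integral>\<^sup>+x. ennreal ((\<Sum>j=1..k. d j x) ^ 2) \<partial>paths Fs k) \<le> ennreal (A * (1 + real p * moment_bound) * real k)" for k
  proof (induction k)
    case (Suc k)
    let ?T = "\<lambda>x. \<Sum>j=1..k. d j x" and ?q = "\<lambda>x. A * (1 + (\<Sum>i=1..p. real (lagv x (Suc k) i) ^ 4))"
    have upd: "(\<Sum>j=1..Suc k. d j (x(int (Suc k) := y))) = ?T x + d (Suc k) (x(int (Suc k) := y))" for x y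
      using depends_upto_update[OF dep[of k], of k x y] by simp
    have q0: "0 \<le> ?q x" for x using A by (simp add: sum_nonneg)
    have "(\<integral>\<^sup>+x. ennreal ((\<Sum>j=1..Suc k. d j x) ^ 2) \<partial>paths Fs (Suc k)) \<le> (\<integral>\<^sup>+x. ennreal (?T x ^ 2 + ?q x) \<partial>paths Fs k)"
    proof (rule nn_integral_path_law_Suc_le)
      fix x
      let ?S = "step_law p \<alpha> (Fs (Suc k)) (lagv x (Suc k))" and ?d = "\<lambda>y. d (Suc k) (x(int (Suc k) := y))"
      have i1: "integrable ?S ?d"
      proof (rule Bochner_Integration.integrable_bound)
        show "integrable ?S (\<lambda>y. 1 + ?d y ^ 2)" using sq[of k x] by simp
        have "\<bar>z\<bar> \<le> 1 + z^2" for z :: real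
        proof -
          have "0 \<le> (\<bar>z\<bar> - 1)^2" by simp
          then have "2 * \<bar>z\<bar> \<le> 1 + z^2" by (simp add: power2_eq_square algebra_simps)
          then show ?thesis by linarith
        qed
        then show "AE y in measure_pmf ?S. norm (?d y) \<le> norm (1 + ?d y ^ 2)" by (intro always_eventually allI) simp
      qed auto
      have ex: "(?T x + ?d y)^2 = ?T x ^ 2 + 2 * ?T x * ?d y + ?d y ^ 2" for y by (simp add: power2_sum algebra_simps)
      show "integrable ?S (\<lambda>y. (\<Sum>j=1..Suc k. d j (x(int (Suc k) := y))) ^ 2)"
        unfolding upd ex using i1 sq[of k x] by simp
      have "measure_pmf.expectation ?S (\<lambda>y. (?T x + ?d y)^2) = ?T x ^ 2 + 2 * ?T x * measure_pmf.expectation ?S ?d + measure_pmf.expectation ?S (\<lambda>y. ?d y ^ 2)"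
        unfolding ex using i1 sq[of k x] by simp
      then show "measure_pmf.expectation ?S (\<lambda>y. (\<Sum>j=1..Suc k. d j (x(int (Suc k) := y))) ^ 2) \<le> ?T x ^ 2 + ?q x"
        unfolding upd cent using bd[of k x] by simp
    qed simp
    also have "\<dots> = (\<integral>\<^sup>+x. ennreal (?T x ^ 2) + ennreal A * (1 + (\<Sum>i=1..p. ennreal (real (lagv x (Suc k) i) ^ 4))) \<partial>paths Fs k)"
    proof (intro nn_integral_cong)
      fix x
      have "ennreal (?q x) = ennreal A * (1 + (\<Sum>i=1..p. ennreal (real (lagv x (Suc k) i) ^ 4)))"
        using A by (simp add: ennreal_mult sum_nonneg ennreal_plus sum_ennreal del: of_nat_Suc)
      then show "ennreal (?T x ^ 2 + ?q x) = ennreal (?T x ^ 2) + ennreal A * (1 + (\<Sum>i=1..p. ennreal (real (lagv x (Suc k) i) ^ 4)))"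
        using q0[of x] by (simp add: ennreal_plus del: of_nat_Suc)
    qed
    also have "\<dots> = (\<integral>\<^sup>+x. ennreal (?T x ^ 2) \<partial>paths Fs k) + ennreal A * (1 + (\<Sum>i=1..p. \<integral>\<^sup>+x. ennreal (real (lagv x (Suc k) i) ^ 4) \<partial>paths Fs k))"
      by (simp add: nn_integral_add nn_integral_sum nn_integral_cmult del: of_nat_Suc sum_ennreal)
    also have "\<dots> \<le> ennreal (A * (1 + real p * moment_bound) * real k) + ennreal A * (1 + (\<Sum>i=1..p. ennreal moment_bound))"
      by (intro add_mono mult_left_mono sum_mono moment_bound(2)[OF Fs] Suc.IH) auto
    also have "ennreal A * (1 + (\<Sum>i=1..p. ennreal moment_bound)) = ennreal (A * (1 + real p * moment_bound))"
      using A moment_bound(1) by (simp add: ennreal_mult ennreal_plus ennreal_of_nat_eq_real_of_nat)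
    also have "ennreal (A * (1 + real p * moment_bound) * real k) + ennreal (A * (1 + real p * moment_bound)) =
       ennreal (A * (1 + real p * moment_bound) * real (Suc k))"
      using A moment_bound(1) by (subst ennreal_plus[symmetric]) (auto simp: algebra_simps)
    finally show ?case .
  qed simp
  from this[of k] show ?thesis
    using nn_integral_path_law_later[of k "\<lambda>x. ennreal ((\<Sum>j=1..k. d j x) ^ 2)" n p \<alpha> I Fs] dep[of k] \<open>k \<le> n\<close>
    unfolding depends_upto_def by metis
qed

definition dev :: "(nat \<Rightarrow> nat pmf) \<Rightarrow> nat \<Rightarrow> (int \<Rightarrow> nat) \<Rightarrow> real" where
  "dev Fs k x = real (x (int k)) - lag_mean p \<alpha> (lagv x k) - innov_mean (Fs k)"

definition cond_var :: "(nat \<Rightarrow> nat pmf) \<Rightarrow> nat \<Rightarrow> (int \<Rightarrow> nat) \<Rightarrow> real" where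
  "cond_var Fs k x = lag_var p \<alpha> (lagv x k) + innov_var (Fs k)"

lemma lag_cong:
  assumes "\<And>i. i \<in> {1..p} \<Longrightarrow> c i = c' i"
  shows "lag_mean p \<alpha> c = lag_mean p \<alpha> c'" "lag_var p \<alpha> c = lag_var p \<alpha> c'"
  unfolding lag_mean_def lag_var_def using assms by (auto intro!: sum.cong)

lemma lags_update:
  "lag_mean p \<alpha> (lagv (x(int k := y)) k) = lag_mean p \<alpha> (lagv x k)"
  "lag_var p \<alpha> (lagv (x(int k := y)) k) = lag_var p \<alpha> (lagv x k)"
  by (intro lag_cong; simp)+

lemma dev_update: "dev Fs k (x(int k := y)) = real y - lag_mean p \<alpha> (lagv x k) - innov_mean (Fs k)"
  unfolding dev_def lags_update by simp

lemma cond_var_update: "cond_var Fs k (x(int k := y)) = cond_var Fs k x"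
  unfolding cond_var_def lags_update by simp

lemma depends_upto_dev: "depends_upto k (dev Fs k)"
  unfolding depends_upto_def dev_def
proof (intro allI impI)
  fix x y :: "int \<Rightarrow> nat" assume xy: "\<forall>j\<le>int k. x j = y j"
  then have "lag_mean p \<alpha> (lagv x k) = lag_mean p \<alpha> (lagv y k)" by (intro lag_cong) auto
  then show "real (x (int k)) - lag_mean p \<alpha> (lagv x k) - innov_mean (Fs k) = real (y (int k)) - lag_mean p \<alpha> (lagv y k) - innov_mean (Fs k)"
    using xy by simp
qed

lemma depends_upto_cond_var: "depends_upto k (cond_var Fs k)"
  unfolding depends_upto_def cond_var_def
  by (intro allI impI arg_cong2[where f = "(+)"] refl lag_cong) auto

definition noise_const :: real where
  "noise_const = (fourth_const F' + fourth_const F'') * (8 * real p ^ 3)"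

lemma noise_const_nonneg: "0 \<le> noise_const"
  unfolding noise_const_def using fourth_const_ge[of F'] fourth_const_ge[of F''] by simp

lemma fourth_power_lags:
  fixes c :: "nat \<Rightarrow> nat"
  shows "(1 + (\<Sum>i=1..p. real (c i))) ^ 4 \<le> 8 * real p ^ 3 * (1 + (\<Sum>i=1..p. real (c i) ^ 4))"
proof -
  let ?N = "\<Sum>i=1..p. real (c i)" and ?N4 = "\<Sum>i=1..p. real (c i) ^ 4"
  have "(1 + ?N) ^ 4 \<le> 8 * 1 + 8 * ?N ^ 4" using sum_power4_le[of "1/2" "1/2" 1 ?N] by (simp add: power_divide)
  also have "?N ^ 4 \<le> real p ^ 3 * ?N4" using weighted_sum_power4_le[of "{1..p}" "\<lambda>_. 1" "\<lambda>i. real (c i)"] by simp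
  also have "8 * 1 + 8 * (real p ^ 3 * ?N4) \<le> 8 * real p ^ 3 + 8 * (real p ^ 3 * ?N4)" using p by simp
  finally show ?thesis by (simp add: algebra_simps)
qed

lemma noise_bound:
  fixes c :: "nat \<Rightarrow> nat"
  assumes Fs: "Fs \<in> regimes" and z: "z \<le> fourth_const (Fs k) * (1 + (\<Sum>i=1..p. real (c i))) ^ 4"
  shows "z \<le> noise_const * (1 + (\<Sum>i=1..p. real (c i) ^ 4))"
proof -
  have "fourth_const (Fs k) \<le> fourth_const F' + fourth_const F''"
    using Fs fourth_const_ge[of F'] fourth_const_ge[of F''] unfolding regimes_def by (smt (verit) mem_Collect_eq)
  then have "fourth_const (Fs k) * (1 + (\<Sum>i=1..p. real (c i))) ^ 4 \<le>
     (fourth_const F' + fourth_const F'') * (8 * real p ^ 3 * (1 + (\<Sum>i=1..p. real (c i) ^ 4)))"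
    using fourth_const_ge[of F'] fourth_const_ge[of F''] by (intro mult_mono fourth_power_lags) auto
  then show ?thesis using z unfolding noise_const_def by (simp add: mult.assoc)
qed

lemmas lag_var_le = lag_var_bounds[where p = p and \<alpha> = \<alpha>, OF \<alpha>]

lemma innov_var_le: "innov_var F + 1 \<le> fourth_const F" "0 \<le> innov_var F"
proof -
  have "0 \<le> innov_var F" "0 \<le> measure_pmf.expectation F (\<lambda>e. (real e - innov_mean F) ^ 4)"
    by (auto intro!: integral_nonneg_AE)
  then show "innov_var F + 1 \<le> fourth_const F" "0 \<le> innov_var F" unfolding fourth_const_def by linarith+
qed

lemma cond_var_le:
  "lag_var p \<alpha> c + innov_var F \<le> fourth_const F * (1 + (\<Sum>i=1..p. real (c i)))"
proof -
  have N: "0 \<le> (\<Sum>i=1..p. real (c i))" by (intro sum_nonneg) auto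
  have "1 * (\<Sum>i=1..p. real (c i)) + fourth_const F * 1 \<le> fourth_const F * (\<Sum>i=1..p. real (c i)) + fourth_const F * 1"
    using fourth_const_ge[of F] N by (intro add_mono mult_right_mono) auto
  then show ?thesis using lag_var_le[of c] innov_var_le[of F] by (simp add: algebra_simps)
qed

lemma power_one_plus_le:
  fixes N :: real
  assumes "0 \<le> N" "i \<le> j"
  shows "(1 + N) ^ i \<le> (1 + N) ^ j"
  using assms by (intro power_increasing) auto

lemma step_dev:
  fixes k :: nat and c :: "nat \<Rightarrow> nat"
  assumes "Fs \<in> regimes"
  defines "D \<equiv> \<lambda>c y. real y - lag_mean p \<alpha> c - innov_mean (Fs k)"
  shows "integrable (step_law p \<alpha> (Fs k) c) (\<lambda>y. D c y ^ 4)"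
    and "integrable (step_law p \<alpha> (Fs k) c) (\<lambda>y. D c y ^ 2)"
    and "integrable (step_law p \<alpha> (Fs k) c) (D c)"
    and "measure_pmf.expectation (step_law p \<alpha> (Fs k) c) (D c) = 0"
    and "measure_pmf.expectation (step_law p \<alpha> (Fs k) c) (\<lambda>y. D c y ^ 2) = lag_var p \<alpha> c + innov_var (Fs k)"
    and "measure_pmf.expectation (step_law p \<alpha> (Fs k) c) (\<lambda>y. D c y ^ 4) \<le> fourth_const (Fs k) * (1 + (\<Sum>i=1..p. real (c i))) ^ 2"
  unfolding D_def
  using step_law_deviation[where p = p and \<alpha> = \<alpha> and F = "Fs k" and c = c, OF \<alpha> regimes_fourth[OF assms(1)]]
    integrable_lower_moments[OF step_law_deviation(1)[where p = p and \<alpha> = \<alpha> and F = "Fs k" and c = c, OF \<alpha> regimes_fourth[OF assms(1)]]]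
  by simp_all

abbreviation "rate_const \<equiv> noise_const * (1 + real p * moment_bound)"

text \<open>
  This lemma and the next two treat the three martingales behind the law of large numbers; the conditional
  second moments of their increments are at most of order four in the lagged values.
\<close>

lemma dev_martingale:
  assumes Fs: "Fs \<in> regimes" and "k \<le> n"
  shows "(\<integral>\<^sup>+x. ennreal ((\<Sum>j=1..k. dev Fs j x) ^ 2) \<partial>paths Fs n) \<le> ennreal (rate_const * real k)"
proof (rule martingale_bound[OF Fs noise_const_nonneg _ _ _ _ \<open>k \<le> n\<close>])
  fix k x
  let ?c = "lagv x (Suc k)" and ?S = "step_law p \<alpha> (Fs (Suc k)) (lagv x (Suc k))"
  let ?N = "\<Sum>i=1..p. real (?c i)"
  show "integrable ?S (\<lambda>y. dev Fs (Suc k) (x(int (Suc k) := y)) ^ 2)"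
    "measure_pmf.expectation ?S (\<lambda>y. dev Fs (Suc k) (x(int (Suc k) := y))) = 0"
    unfolding dev_update using step_dev[OF Fs] by blast+
  have N: "0 \<le> ?N" by (intro sum_nonneg) auto
  have "measure_pmf.expectation ?S (\<lambda>y. dev Fs (Suc k) (x(int (Suc k) := y)) ^ 2) = lag_var p \<alpha> ?c + innov_var (Fs (Suc k))"
    unfolding dev_update using step_dev(5)[OF Fs] by blast
  also have "\<dots> \<le> fourth_const (Fs (Suc k)) * (1 + ?N) ^ 1" using cond_var_le[of ?c "Fs (Suc k)"] by simp
  also have "\<dots> \<le> fourth_const (Fs (Suc k)) * (1 + ?N) ^ 4"
    using fourth_const_ge[of "Fs (Suc k)"] N by (intro mult_left_mono power_one_plus_le) auto
  finally show "measure_pmf.expectation ?S (\<lambda>y. dev Fs (Suc k) (x(int (Suc k) := y)) ^ 2) \<le> noise_const * (1 + (\<Sum>i=1..p. real (?c i) ^ 4))"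
    by (rule noise_bound[OF Fs])
qed (rule depends_upto_dev)

lemma dev_product_martingale:
  assumes Fs: "Fs \<in> regimes" and d: "d \<in> {1..p}" and "k \<le> n"
  shows "(\<integral>\<^sup>+x. ennreal ((\<Sum>j=1..k. dev Fs j x * real (x (int j - int d))) ^ 2) \<partial>paths Fs n) \<le> ennreal (rate_const * real k)"
proof (rule martingale_bound[OF Fs noise_const_nonneg _ _ _ _ \<open>k \<le> n\<close>])
  fix k x
  let ?c = "lagv x (Suc k)" and ?S = "step_law p \<alpha> (Fs (Suc k)) (lagv x (Suc k))"
  let ?N = "\<Sum>i=1..p. real (?c i)"
  have upd: "dev Fs (Suc k) (x(int (Suc k) := y)) * real ((x(int (Suc k) := y)) (int (Suc k) - int d)) =
     real (?c d) * (real y - lag_mean p \<alpha> ?c - innov_mean (Fs (Suc k)))" for y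
    unfolding dev_update using d by simp
  note D = step_dev[OF Fs, where k = "Suc k" and c = ?c]
  show "integrable ?S (\<lambda>y. (dev Fs (Suc k) (x(int (Suc k) := y)) * real ((x(int (Suc k) := y)) (int (Suc k) - int d))) ^ 2)"
    "measure_pmf.expectation ?S (\<lambda>y. dev Fs (Suc k) (x(int (Suc k) := y)) * real ((x(int (Suc k) := y)) (int (Suc k) - int d))) = 0"
    unfolding upd power_mult_distrib using D(2,4) by simp_all
  have N: "0 \<le> ?N" by (intro sum_nonneg) auto
  have "measure_pmf.expectation ?S (\<lambda>y. (dev Fs (Suc k) (x(int (Suc k) := y)) * real ((x(int (Suc k) := y)) (int (Suc k) - int d))) ^ 2)
     = real (?c d) ^ 2 * (lag_var p \<alpha> ?c + innov_var (Fs (Suc k)))"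
    unfolding upd power_mult_distrib using D(5) by simp
  also have "\<dots> \<le> (1 + ?N) ^ 2 * (fourth_const (Fs (Suc k)) * (1 + ?N))"
  proof (intro mult_mono power_mono cond_var_le)
    have "real (?c d) \<le> ?N" using d by (intro member_le_sum) auto
    then show "real (?c d) \<le> 1 + ?N" by simp
    show "0 \<le> lag_var p \<alpha> ?c + innov_var (Fs (Suc k))" using lag_var_le(1)[of ?c] innov_var_le(2)[of "Fs (Suc k)"] by linarith
  qed auto
  also have "\<dots> = fourth_const (Fs (Suc k)) * (1 + ?N) ^ 3" by (simp add: eval_nat_numeral)
  also have "\<dots> \<le> fourth_const (Fs (Suc k)) * (1 + ?N) ^ 4"
    using fourth_const_ge[of "Fs (Suc k)"] N by (intro mult_left_mono power_one_plus_le) auto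
  finally show "measure_pmf.expectation ?S (\<lambda>y. (dev Fs (Suc k) (x(int (Suc k) := y)) * real ((x(int (Suc k) := y)) (int (Suc k) - int d))) ^ 2)
     \<le> noise_const * (1 + (\<Sum>i=1..p. real (?c i) ^ 4))"
    by (rule noise_bound[OF Fs])
next
  fix k
  have "int k - int d \<le> int k" by simp
  then show "depends_upto k (\<lambda>x. dev Fs k x * real (x (int k - int d)))"
    using depends_upto_dev[of k Fs] unfolding depends_upto_def by metis
qed

lemma dev_square_martingale:
  assumes Fs: "Fs \<in> regimes" and "k \<le> n"
  shows "(\<integral>\<^sup>+x. ennreal ((\<Sum>j=1..k. dev Fs j x ^ 2 - cond_var Fs j x) ^ 2) \<partial>paths Fs n) \<le> ennreal (rate_const * real k)"
proof (rule martingale_bound[OF Fs noise_const_nonneg _ _ _ _ \<open>k \<le> n\<close>])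
  fix k x
  let ?c = "lagv x (Suc k)" and ?S = "step_law p \<alpha> (Fs (Suc k)) (lagv x (Suc k))"
  let ?N = "\<Sum>i=1..p. real (?c i)"
  let ?D = "\<lambda>y. real y - lag_mean p \<alpha> ?c - innov_mean (Fs (Suc k))"
  let ?v = "cond_var Fs (Suc k) x"
  note D = step_dev[OF Fs, where k = "Suc k" and c = ?c]
  have v: "measure_pmf.expectation ?S (\<lambda>y. ?D y ^ 2) = ?v" unfolding cond_var_def by (rule D(5))
  have sq: "(?D y ^ 2 - ?v) ^ 2 = ?D y ^ 4 - 2 * ?v * ?D y ^ 2 + ?v ^ 2" for y
  proof -
    have "(d ^ 2 - v) ^ 2 = d ^ 4 - 2 * v * d ^ 2 + v ^ 2" for d v :: real
      by (simp add: eval_nat_numeral algebra_simps)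
    then show ?thesis .
  qed
  show "integrable ?S (\<lambda>y. (dev Fs (Suc k) (x(int (Suc k) := y)) ^ 2 - cond_var Fs (Suc k) (x(int (Suc k) := y))) ^ 2)"
    unfolding dev_update cond_var_update sq using D(1,2) by simp
  show "measure_pmf.expectation ?S (\<lambda>y. dev Fs (Suc k) (x(int (Suc k) := y)) ^ 2 - cond_var Fs (Suc k) (x(int (Suc k) := y))) = 0"
    unfolding dev_update cond_var_update using D(2) v by simp
  have N: "0 \<le> ?N" by (intro sum_nonneg) auto
  have "measure_pmf.expectation ?S (\<lambda>y. (dev Fs (Suc k) (x(int (Suc k) := y)) ^ 2 - cond_var Fs (Suc k) (x(int (Suc k) := y))) ^ 2)
    = measure_pmf.expectation ?S (\<lambda>y. ?D y ^ 4) - ?v ^ 2"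
    unfolding dev_update cond_var_update sq using D(1,2) v by (simp add: power2_eq_square)
  also have "\<dots> \<le> fourth_const (Fs (Suc k)) * (1 + ?N) ^ 2" using D(6) zero_le_power2[of ?v] by linarith
  also have "\<dots> \<le> fourth_const (Fs (Suc k)) * (1 + ?N) ^ 4"
    using fourth_const_ge[of "Fs (Suc k)"] N by (intro mult_left_mono power_one_plus_le) auto
  finally show "measure_pmf.expectation ?S (\<lambda>y. (dev Fs (Suc k) (x(int (Suc k) := y)) ^ 2 - cond_var Fs (Suc k) (x(int (Suc k) := y))) ^ 2)
     \<le> noise_const * (1 + (\<Sum>i=1..p. real (?c i) ^ 4))"
    by (rule noise_bound[OF Fs])
next
  fix k
  show "depends_upto k (\<lambda>x. dev Fs k x ^ 2 - cond_var Fs k x)"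
    using depends_upto_dev[of k Fs] depends_upto_cond_var[of k Fs] unfolding depends_upto_def by metis
qed

lemma boundary_moment:
  assumes Fs: "Fs \<in> regimes" and "k \<le> n"
  shows "(\<integral>\<^sup>+x. ennreal ((\<Sum>i<p. real (x (int k - int i)) ^ 2) ^ 2) \<partial>paths Fs n) \<le> ennreal (real p ^ 2 * moment_bound)"
proof -
  have "(\<integral>\<^sup>+x. ennreal ((\<Sum>i<p. real (x (int k - int i)) ^ 2) ^ 2) \<partial>paths Fs n) \<le>
     (\<integral>\<^sup>+x. ennreal (real p) * (\<Sum>i<p. ennreal (real (x (int k - int i)) ^ 4)) \<partial>paths Fs n)"
  proof (rule nn_integral_mono)
    fix x :: "int \<Rightarrow> nat"
    have "(\<Sum>i<p. real (x (int k - int i)) ^ 2) ^ 2 \<le> real p * (\<Sum>i<p. real (x (int k - int i)) ^ 4)"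
      using weighted_sum_squared_le[of "{..<p}" "\<lambda>_. 1" "\<lambda>i. real (x (int k - int i)) ^ 2"] by simp
    then show "ennreal ((\<Sum>i<p. real (x (int k - int i)) ^ 2) ^ 2) \<le> ennreal (real p) * (\<Sum>i<p. ennreal (real (x (int k - int i)) ^ 4))"
      by (simp add: ennreal_mult[symmetric] sum_nonneg ennreal_leI)
  qed
  also have "\<dots> = ennreal (real p) * (\<Sum>i<p. \<integral>\<^sup>+x. ennreal (real (x (int k - int i)) ^ 4) \<partial>paths Fs n)"
    by (simp add: nn_integral_cmult nn_integral_sum del: sum_ennreal)
  also have "\<dots> \<le> ennreal (real p) * (\<Sum>i<p. ennreal moment_bound)"
    using \<open>k \<le> n\<close> by (intro mult_left_mono sum_mono moment_bound(2)[OF Fs]) auto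
  also have "\<dots> = ennreal (real p ^ 2 * moment_bound)"
    using moment_bound(1) by (simp add: ennreal_mult[symmetric] power2_eq_square mult.assoc ennreal_of_nat_eq_real_of_nat)
  finally show ?thesis .
qed

text \<open>Everything that has to be small at a time \<open>k\<close> so that the path has the right averages up to \<open>k\<close>.\<close>

definition fluctuation :: "(nat \<Rightarrow> nat pmf) \<Rightarrow> nat \<Rightarrow> (int \<Rightarrow> nat) \<Rightarrow> real" where
  "fluctuation Fs k x = (\<Sum>j=1..k. dev Fs j x) ^ 2 +
    (\<Sum>d=1..p. (\<Sum>j=1..k. dev Fs j x * real (x (int j - int d))) ^ 2) +
    (\<Sum>j=1..k. dev Fs j x ^ 2 - cond_var Fs j x) ^ 2 +
    (\<Sum>i<p. real (x (int k - int i)) ^ 2) ^ 2"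

definition fluct_const :: real where
  "fluct_const = (real p + 2) * rate_const + real p ^ 2 * moment_bound"

lemma fluct_const_nonneg: "0 \<le> fluct_const"
  unfolding fluct_const_def using noise_const_nonneg moment_bound(1) by simp

lemma fluctuation_nonneg: "0 \<le> fluctuation Fs k x"
  unfolding fluctuation_def by (intro add_nonneg_nonneg sum_nonneg) auto

lemma fluctuation_bound:
  assumes Fs: "Fs \<in> regimes" and "k \<le> n" and n: "1 \<le> n"
  shows "(\<integral>\<^sup>+x. ennreal (fluctuation Fs k x) \<partial>paths Fs n) \<le> ennreal (fluct_const * real n)"
proof -
  have r0: "0 \<le> rate_const" using noise_const_nonneg moment_bound(1) by simp
  have kn: "ennreal (rate_const * real k) \<le> ennreal (rate_const * real n)"
    using r0 \<open>k \<le> n\<close> by (intro ennreal_leI mult_left_mono) auto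
  have "(\<integral>\<^sup>+x. ennreal (fluctuation Fs k x) \<partial>paths Fs n) =
    (\<integral>\<^sup>+x. ennreal ((\<Sum>j=1..k. dev Fs j x) ^ 2) \<partial>paths Fs n) +
    (\<Sum>d=1..p. \<integral>\<^sup>+x. ennreal ((\<Sum>j=1..k. dev Fs j x * real (x (int j - int d))) ^ 2) \<partial>paths Fs n) +
    (\<integral>\<^sup>+x. ennreal ((\<Sum>j=1..k. dev Fs j x ^ 2 - cond_var Fs j x) ^ 2) \<partial>paths Fs n) +
    (\<integral>\<^sup>+x. ennreal ((\<Sum>i<p. real (x (int k - int i)) ^ 2) ^ 2) \<partial>paths Fs n)"
    unfolding fluctuation_def
    by (simp add: ennreal_plus sum_nonneg sum_ennreal[symmetric] nn_integral_add nn_integral_sum del: sum_ennreal)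
  also have "\<dots> \<le> ennreal (rate_const * real n) + (\<Sum>d=1..p. ennreal (rate_const * real n)) + ennreal (rate_const * real n)
      + ennreal (real p ^ 2 * moment_bound)"
    using assms by (intro add_mono sum_mono boundary_moment order_trans[OF dev_martingale kn]
        order_trans[OF dev_product_martingale kn] order_trans[OF dev_square_martingale kn])
  also have "\<dots> = ennreal ((real p + 2) * rate_const * real n + real p ^ 2 * moment_bound)"
  proof -
    define R b where "R = rate_const * real n" and "b = real p ^ 2 * moment_bound"
    have Rb: "0 \<le> R" "0 \<le> b" using r0 moment_bound(1) by (auto simp: R_def b_def)
    have "(\<Sum>d=1..p. ennreal R) = ennreal (real p * R)"
      using Rb by (simp add: ennreal_mult ennreal_of_nat_eq_real_of_nat)
    then have "ennreal R + (\<Sum>d=1..p. ennreal R) + ennreal R + ennreal b = ennreal (R + real p * R + R + b)"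
      using Rb by (simp only: ennreal_plus add_nonneg_nonneg mult_nonneg_nonneg of_nat_0_le_iff)
    also have "R + real p * R + R + b = (real p + 2) * rate_const * real n + real p ^ 2 * moment_bound"
      unfolding R_def b_def by (simp add: algebra_simps)
    finally show ?thesis unfolding R_def b_def .
  qed
  also have "\<dots> \<le> ennreal (fluct_const * real n)"
  proof (rule ennreal_leI)
    have "real p ^ 2 * moment_bound * 1 \<le> real p ^ 2 * moment_bound * real n"
      using n moment_bound(1) by (intro mult_left_mono) auto
    then show "(real p + 2) * rate_const * real n + real p ^ 2 * moment_bound \<le> fluct_const * real n"
      unfolding fluct_const_def distrib_right by simp
  qed
  finally show ?thesis .
qed

text \<open>
  Times at distance about \<open>sqrt n\<close>, together with the change point and the final time. They are few enough for a union
  bound by second moments and close enough to interpolate monotone sums.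
\<close>

definition grid :: "nat \<Rightarrow> nat \<Rightarrow> nat set" where
  "grid n t = {k. k \<le> n \<and> nat \<lceil>sqrt (real n)\<rceil> dvd k} \<union> {t, n}"

lemma card_grid:
  assumes n: "1 \<le> n"
  shows "real (card (grid n t)) \<le> 4 * sqrt (real n)" "finite (grid n t)"
proof -
  let ?h = "nat \<lceil>sqrt (real n)\<rceil>"
  have s: "1 \<le> sqrt (real n)" using n by simp
  have h: "sqrt (real n) \<le> real ?h" "0 < ?h" using s by (auto simp: le_nat_iff)
  have sub: "{k. k \<le> n \<and> ?h dvd k} \<subseteq> (\<lambda>m. ?h * m) ` {..n div ?h}"
  proof safe
    fix k assume k: "k \<le> n" "?h dvd k"
    then obtain m where m: "k = ?h * m" by (elim dvdE)
    then have "m = k div ?h" using h by simp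
    then have "m \<le> n div ?h" using k by (simp add: div_le_mono)
    then show "k \<in> (*) ?h ` {..n div ?h}" using m by auto
  qed
  then have fin: "finite {k. k \<le> n \<and> ?h dvd k}" by (rule finite_subset) auto
  then show "finite (grid n t)" unfolding grid_def by simp
  have "card {k. k \<le> n \<and> ?h dvd k} \<le> card {..n div ?h}"
    using surj_card_le[OF _ sub] by simp
  then have c: "card {k. k \<le> n \<and> ?h dvd k} \<le> n div ?h + 1" by simp
  have "real (n div ?h) \<le> real n / real ?h" using h(2) by (metis of_nat_div_le_of_nat)
  also have "\<dots> \<le> real n / sqrt (real n)" using h s by (intro divide_left_mono) auto
  also have "\<dots> = sqrt (real n)" by (simp add: real_div_sqrt)
  finally have d: "real (n div ?h) \<le> sqrt (real n)" .
  have "card (grid n t) \<le> (n div ?h + 1) + 2"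
    unfolding grid_def using c card_Un_le[of "{k. k \<le> n \<and> ?h dvd k}" "{t, n}"] card_insert_le_m1[of 2 "{n}" t] by (simp add: card_insert_if split: if_splits)
  then have "real (card (grid n t)) \<le> real (n div ?h) + 3" by linarith
  then show "real (card (grid n t)) \<le> 4 * sqrt (real n)" using d s by linarith
qed

text \<open>
  Markov's inequality for the sum over the grid: at most \<open>4 sqrt n\<close> points with a mean of order \<open>n\<close> give order
  \<open>n\<^sup>3\<^sup>/\<^sup>2\<close>, which is at most the squared threshold \<open>n\<^sup>2\<^sup>-\<^sup>2\<^sup>\<gamma>\<close> as long as \<open>\<gamma> \<le> 1/4\<close>.
\<close>

lemma fluctuations_small:
  assumes \<gamma>: "\<gamma> \<le> 1 / 4" and \<delta>: "0 < \<delta>"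
  obtains K where "0 < K" and
    "\<And>Fs n t. Fs \<in> regimes \<Longrightarrow> 1 \<le> n \<Longrightarrow> t \<le> n \<Longrightarrow>
      measure_pmf.prob (paths Fs n) {x. \<exists>k\<in>grid n t. (K * real n powr (1 - \<gamma>)) ^ 2 \<le> fluctuation Fs k x} < \<delta>"
proof -
  define K where "K = sqrt (4 * fluct_const / \<delta> + 1) "
  have K2: "K ^ 2 = 4 * fluct_const / \<delta> + 1" unfolding K_def using fluct_const_nonneg \<delta> by simp
  have K0: "0 < K" unfolding K_def using fluct_const_nonneg \<delta> by (simp add: add_nonneg_pos)
  have "measure_pmf.prob (paths Fs n) {x. \<exists>k\<in>grid n t. (K * real n powr (1 - \<gamma>)) ^ 2 \<le> fluctuation Fs k x} < \<delta>"
    if Fs: "Fs \<in> regimes" and n: "1 \<le> n" and t: "t \<le> n" for Fs n t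
  proof -
    let ?L = "paths Fs n" and ?r = "(K * real n powr (1 - \<gamma>)) ^ 2"
    let ?\<Phi> = "\<lambda>x. \<Sum>k\<in>grid n t. fluctuation Fs k x"
    have r0: "0 < ?r" using K0 n by simp
    have gn: "k \<le> n" if "k \<in> grid n t" for k using that t unfolding grid_def by auto
    have rr: "?r = K^2 * real n powr (2 - 2 * \<gamma>)"
      using n by (simp add: power_mult_distrib powr_power)
    have "real n powr (3/2) \<le> real n powr (2 - 2 * \<gamma>)" using n \<gamma> by (intro powr_mono) auto
    then have r_ge: "K^2 * real n powr (3/2) \<le> ?r" unfolding rr using K0 by (intro mult_left_mono) auto
    have n32: "sqrt (real n) * real n = real n powr (3/2)"
    proof -
      have "sqrt (real n) * real n = real n powr (1/2) * real n powr 1" using n by (simp add: powr_half_sqrt)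
      also have "\<dots> = real n powr (3/2)" by (subst powr_add[symmetric]) simp
      finally show ?thesis .
    qed
    have "{x. \<exists>k\<in>grid n t. ?r \<le> fluctuation Fs k x} \<subseteq> {x. ?r \<le> ?\<Phi> x}"
    proof safe
      fix k x assume k: "k \<in> grid n t" and r: "?r \<le> fluctuation Fs k x"
      note r
      also have "fluctuation Fs k x \<le> ?\<Phi> x"
        using k card_grid(2)[OF n] fluctuation_nonneg by (intro member_le_sum) auto
      finally show "?r \<le> ?\<Phi> x" .
    qed
    then have "emeasure ?L {x. \<exists>k\<in>grid n t. ?r \<le> fluctuation Fs k x} \<le> emeasure ?L {x. ?r \<le> ?\<Phi> x}"
      by (intro emeasure_mono) auto
    also have "{x. ?r \<le> ?\<Phi> x} = {x\<in>UNIV. 1 \<le> ennreal (1 / ?r) * ennreal (?\<Phi> x)}"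
    proof -
      have "1 \<le> ennreal (1 / ?r) * ennreal (?\<Phi> x) \<longleftrightarrow> ?r \<le> ?\<Phi> x" for x
      proof -
        have p0: "0 \<le> ?\<Phi> x" by (intro sum_nonneg fluctuation_nonneg)
        then have "ennreal (1 / ?r) * ennreal (?\<Phi> x) = ennreal (?\<Phi> x / ?r)" using r0 by (simp add: ennreal_mult[symmetric])
        then have "1 \<le> ennreal (1 / ?r) * ennreal (?\<Phi> x) \<longleftrightarrow> 1 \<le> ?\<Phi> x / ?r"
          using p0 r0 by (simp add: ennreal_1[symmetric] del: ennreal_1)
        also have "\<dots> \<longleftrightarrow> ?r \<le> ?\<Phi> x" using r0 by (simp add: pos_le_divide_eq)
        finally show ?thesis .
      qed
      then show ?thesis by simp
    qed
    also have "emeasure ?L \<dots> \<le> ennreal (1 / ?r) * (\<integral>\<^sup>+x. ennreal (?\<Phi> x) * indicator UNIV x \<partial>?L)"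
      by (rule nn_integral_Markov_inequality) auto
    also have "(\<integral>\<^sup>+x. ennreal (?\<Phi> x) * indicator UNIV x \<partial>?L) = (\<Sum>k\<in>grid n t. \<integral>\<^sup>+x. ennreal (fluctuation Fs k x) \<partial>?L)"
      by (simp add: sum_ennreal[symmetric] fluctuation_nonneg nn_integral_sum del: sum_ennreal)
    also have "\<dots> \<le> (\<Sum>k\<in>grid n t. ennreal (fluct_const * real n))"
      using n by (intro sum_mono fluctuation_bound[OF Fs gn]) auto
    also have "\<dots> = ennreal (real (card (grid n t)) * (fluct_const * real n))"
      using fluct_const_nonneg by (simp add: ennreal_mult ennreal_of_nat_eq_real_of_nat)
    also have "\<dots> \<le> ennreal (4 * sqrt (real n) * (fluct_const * real n))"
      using card_grid(1)[OF n] fluct_const_nonneg by (intro ennreal_leI mult_right_mono) auto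
    finally have "emeasure ?L {x. \<exists>k\<in>grid n t. ?r \<le> fluctuation Fs k x} \<le>
       ennreal (1 / ?r) * ennreal (4 * sqrt (real n) * (fluct_const * real n))" by (simp add: mult_left_mono)
    also have "\<dots> = ennreal (4 * fluct_const * real n powr (3/2) / ?r)"
      using r0 fluct_const_nonneg n32 by (simp add: ennreal_mult[symmetric] ac_simps)
    finally have "measure_pmf.prob ?L {x. \<exists>k\<in>grid n t. ?r \<le> fluctuation Fs k x} \<le> 4 * fluct_const * real n powr (3/2) / ?r"
      using r0 fluct_const_nonneg by (simp add: measure_pmf.emeasure_eq_measure)
    also have "\<dots> \<le> 4 * fluct_const * real n powr (3/2) / (K^2 * real n powr (3/2))"
      using r_ge K0 n fluct_const_nonneg by (intro divide_left_mono) auto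
    also have "\<dots> = 4 * fluct_const / K^2" using n by simp
    also have "\<dots> < \<delta>" using \<delta> fluct_const_nonneg unfolding K2 by (simp add: field_simps)
    finally show ?thesis .
  qed
  then show ?thesis using that[OF K0] by blast
qed

end

section \<open>Averages along a path with small fluctuations\<close>

lemma sum_shift:
  fixes f :: "int \<Rightarrow> real"
  assumes "a \<le> b"
  shows "(\<Sum>j\<in>{a<..b}. f (int j - int s)) = (\<Sum>j\<in>{a<..b}. f (int j)) + (\<Sum>l<s. f (int a - int l)) - (\<Sum>l<s. f (int b - int l))"
proof (induction s)
  case (Suc s)
  have tele: "(\<Sum>j\<in>{a<..b}. f (int j - int s) - f (int j - int (Suc s))) = f (int b - int s) - f (int a - int s)"
    using assms
  proof (induction b rule: dec_induct)
    case (step b)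
    have "{a<..Suc b} = insert (Suc b) {a<..b}" using step.hyps by auto
    then show ?case using step.IH by (simp add: algebra_simps)
  qed simp
  then show ?case using Suc by (simp add: sum_subtractf)
qed simp

lemma sum_Ioc_eq_diff:
  fixes f :: "nat \<Rightarrow> real"
  assumes "a \<le> b"
  shows "(\<Sum>j\<in>{a<..b}. f j) = (\<Sum>j=1..b. f j) - (\<Sum>j=1..a. f j)"
proof -
  have "{1..b} = {1..a} \<union> {a<..b}" using assms by auto
  then have "(\<Sum>j=1..b. f j) = (\<Sum>j=1..a. f j) + (\<Sum>j\<in>{a<..b}. f j)"
    by (simp add: sum.union_disjoint ivl_disj_int)
  then show ?thesis by simp
qed

lemma product_le_sum_squares:
  fixes x y :: nat
  shows "real x * real y \<le> (real x ^ 2 + real y ^ 2) / 2"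
proof -
  have "0 \<le> (real x - real y)^2" by simp
  then show ?thesis by (simp add: power2_eq_square algebra_simps)
qed

lemma nat_le_square: "real (x :: nat) \<le> real x ^ 2"
  by (cases x) (auto simp: power2_eq_square algebra_simps)

context stable_inar
begin

text \<open>
  The equations for the mean \<open>m\<close> and the lag products \<open>c\<close> of a stationary process whose innovations have mean \<open>\<mu>\<close> and
  variance \<open>v\<close>.
\<close>

definition yule_walker_solution :: "real \<Rightarrow> real \<Rightarrow> real \<Rightarrow> (nat \<Rightarrow> real) \<Rightarrow> bool" where
  "yule_walker_solution \<mu> v m c \<longleftrightarrow>
    m = (\<Sum>i=1..p. \<alpha> i) * m + \<mu> \<and>
    (\<forall>d\<in>{1..p}. c d = (\<Sum>i=1..p. \<alpha> i * c (nat \<bar>int i - int d\<bar>)) + \<mu> * m) \<and>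
    c 0 = (\<Sum>i=1..p. \<alpha> i * c i) + \<mu> * m + (\<Sum>i=1..p. \<alpha> i * (1 - \<alpha> i)) * m + v"

lemma coeff_sum: "0 \<le> (\<Sum>i=1..p. \<alpha> i)" "(\<Sum>i=1..p. \<alpha> i) < 1"
  using \<alpha> stable by (auto intro: sum_nonneg)

lemma yule_walker_mean_nonneg:
  assumes "yule_walker_solution (innov_mean F) v m c"
  shows "0 \<le> m"
proof -
  have "m * (1 - (\<Sum>i=1..p. \<alpha> i)) = innov_mean F"
    using assms unfolding yule_walker_solution_def by (auto simp: algebra_simps)
  moreover have "0 \<le> innov_mean F" by (auto intro!: integral_nonneg_AE)
  ultimately show ?thesis using coeff_sum by (metis diff_gt_0_iff_gt zero_le_mult_iff not_le)
qed

lemma coefficient_sum_le: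
  fixes w :: "nat \<Rightarrow> real"
  assumes "\<And>i. i \<in> {1..p} \<Longrightarrow> \<bar>w i\<bar> \<le> B"
  shows "\<bar>\<Sum>i=1..p. \<alpha> i * w i\<bar> \<le> (\<Sum>i=1..p. \<alpha> i) * B"
proof -
  have "\<bar>\<Sum>i=1..p. \<alpha> i * w i\<bar> \<le> (\<Sum>i=1..p. \<bar>\<alpha> i * w i\<bar>)" by (rule sum_abs)
  also have "\<dots> \<le> (\<Sum>i=1..p. \<alpha> i * B)"
    using \<alpha> assms by (intro sum_mono) (auto simp: abs_mult intro: mult_left_mono)
  finally show ?thesis by (simp add: sum_distrib_right)
qed

lemma coefficient_average_le:
  fixes w :: "nat \<Rightarrow> real"
  assumes "\<And>i. i \<in> {1..p} \<Longrightarrow> \<bar>w i\<bar> \<le> B" "0 \<le> B"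
  shows "\<bar>\<Sum>i=1..p. \<alpha> i * w i\<bar> \<le> B"
proof -
  have "\<bar>\<Sum>i=1..p. \<alpha> i * w i\<bar> \<le> (\<Sum>i=1..p. \<alpha> i) * B" using assms(1) by (rule coefficient_sum_le)
  also have "\<dots> \<le> B" using coeff_sum assms(2) by (intro mult_left_le_one_le) auto
  finally show ?thesis .
qed

text \<open>
  The inequality is read at an index where \<open>\<bar>\<delta>\<bar>\<close> is largest. The values \<open>w i\<close> stand for \<open>\<delta>\<close> at the reflected lag
  \<open>\<bar>i - d\<bar>\<close>, which again lies in \<open>{0..p}\<close>.
\<close>

lemma sup_norm_contraction:
  fixes \<delta> :: "nat \<Rightarrow> real"
  assumes "\<And>d. d \<le> p \<Longrightarrow> \<exists>w. (\<forall>i\<in>{1..p}. \<exists>l\<le>p. w i = \<delta> l) \<and> \<bar>\<delta> d - (\<Sum>i=1..p. \<alpha> i * w i)\<bar> \<le> E"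
    and "d \<le> p"
  shows "\<bar>\<delta> d\<bar> \<le> E / (1 - (\<Sum>i=1..p. \<alpha> i))"
proof -
  define D where "D = Max ((\<lambda>l. \<bar>\<delta> l\<bar>) ` {..p})"
  have D: "\<bar>\<delta> l\<bar> \<le> D" if "l \<le> p" for l unfolding D_def using that by (intro Max_ge) auto
  have "D \<in> (\<lambda>l. \<bar>\<delta> l\<bar>) ` {..p}" unfolding D_def by (intro Max_in) auto
  then obtain l where l: "l \<le> p" "D = \<bar>\<delta> l\<bar>" by auto
  obtain w where w: "\<forall>i\<in>{1..p}. \<exists>l\<le>p. w i = \<delta> l" "\<bar>\<delta> l - (\<Sum>i=1..p. \<alpha> i * w i)\<bar> \<le> E"
    using assms(1)[OF l(1)] by blast
  have "\<bar>\<Sum>i=1..p. \<alpha> i * w i\<bar> \<le> (\<Sum>i=1..p. \<alpha> i) * D"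
    using w(1) D by (intro coefficient_sum_le) metis
  then have "D * (1 - (\<Sum>i=1..p. \<alpha> i)) \<le> E" using w(2) l(2) by (simp add: algebra_simps)
  then have "D \<le> E / (1 - (\<Sum>i=1..p. \<alpha> i))" using coeff_sum by (simp add: pos_le_divide_eq)
  then show ?thesis using D[OF assms(2)] by linarith
qed

definition mean_const :: real where "mean_const = 3 / (1 - (\<Sum>i=1..p. \<alpha> i))"

definition product_const :: "real \<Rightarrow> real" where
  "product_const \<mu> = (2 + \<bar>\<mu>\<bar> * (1 + mean_const) + mean_const) / (1 - (\<Sum>i=1..p. \<alpha> i)) + 1"

lemma mean_const_ge: "3 \<le> mean_const"
  unfolding mean_const_def using coeff_sum by (simp add: field_simps)

text \<open>
  The sums of \<open>X\<^sub>j\<close> and of \<open>X\<^sub>j X\<^sub>j\<^sub>-\<^sub>d\<close> over the segment satisfy the Yule-Walker equations up to the martingale sums and to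
  boundary terms that arise when lags are shifted. Subtracting the exact equations, multiplied by the length of the
  segment, and using the contraction bounds the errors by a multiple of \<open>\<kappa>\<close>.
\<close>

lemma segment_averages:
  fixes x :: "int \<Rightarrow> nat" and \<mu> v m \<kappa> :: real and c :: "nat \<Rightarrow> real"
  defines "e \<equiv> \<lambda>j::nat. real (x (int j)) - lag_mean p \<alpha> (\<lambda>i. x (int j - int i)) - \<mu>"
  assumes ab: "a \<le> b" and yw: "yule_walker_solution \<mu> v m c"
    and e1: "\<bar>\<Sum>j\<in>{a<..b}. e j\<bar> \<le> \<kappa>"
    and e2: "\<And>d. d \<in> {1..p} \<Longrightarrow> \<bar>\<Sum>j\<in>{a<..b}. e j * real (x (int j - int d))\<bar> \<le> \<kappa>"
    and e3: "\<bar>\<Sum>j\<in>{a<..b}. e j ^ 2 - (lag_var p \<alpha> (\<lambda>i. x (int j - int i)) + v)\<bar> \<le> \<kappa>"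
    and ba: "(\<Sum>i<p. real (x (int a - int i)) ^ 2) \<le> \<kappa>" and bb: "(\<Sum>i<p. real (x (int b - int i)) ^ 2) \<le> \<kappa>"
  shows "\<And>i. i \<le> p \<Longrightarrow> \<bar>(\<Sum>j\<in>{a<..b}. real (x (int j - int i))) - real (b - a) * m\<bar> \<le> mean_const * \<kappa>"
    and "\<And>i d. i \<le> p \<Longrightarrow> d \<le> p \<Longrightarrow>
      \<bar>(\<Sum>j\<in>{a<..b}. real (x (int j - int i)) * real (x (int j - int d))) - real (b - a) * c (nat \<bar>int i - int d\<bar>)\<bar>
        \<le> product_const \<mu> * \<kappa>"
proof -
  let ?J = "{a<..b}" and ?S = "\<Sum>i=1..p. \<alpha> i" and ?N = "real (b - a)"
  let ?x = "\<lambda>j i. real (x (int j - int i))"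
  have S: "0 \<le> ?S" "?S < 1" by (rule coeff_sum)+
  have \<kappa>: "0 \<le> \<kappa>" using e1 by linarith
  have cardJ: "real (card ?J) = ?N" by simp
  have m: "m = ?S * m + \<mu>" and cd: "\<And>d. d \<in> {1..p} \<Longrightarrow> c d = (\<Sum>i=1..p. \<alpha> i * c (nat \<bar>int i - int d\<bar>)) + \<mu> * m"
    and c0: "c 0 = (\<Sum>i=1..p. \<alpha> i * c i) + \<mu> * m + (\<Sum>i=1..p. \<alpha> i * (1 - \<alpha> i)) * m + v"
    using yw unfolding yule_walker_solution_def by auto
  define A where "A i = (\<Sum>j\<in>?J. ?x j i)" for i
  define P where "P i d = (\<Sum>j\<in>?J. ?x j i * ?x j d)" for i d
  have boundary1: "0 \<le> (\<Sum>l<i. ?x t l) \<and> (\<Sum>l<i. ?x t l) \<le> \<kappa>" if "i \<le> p" "t = a \<or> t = b" for i t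
  proof -
    have "(\<Sum>l<i. ?x t l) \<le> (\<Sum>l<i. ?x t l ^ 2)" by (intro sum_mono nat_le_square)
    also have "\<dots> \<le> (\<Sum>l<p. ?x t l ^ 2)" using that by (intro sum_mono2) auto
    also have "\<dots> \<le> \<kappa>" using ba bb that by auto
    finally show ?thesis by (auto intro: sum_nonneg)
  qed
  have shiftA: "\<bar>A i - A 0\<bar> \<le> \<kappa>" if "i \<le> p" for i
    using sum_shift[OF ab, of "\<lambda>j. real (x j)" i] boundary1[OF that, of a] boundary1[OF that, of b]
    unfolding A_def by (simp del: of_nat_le_iff) linarith
  have x_eq: "?x j 0 = (\<Sum>i=1..p. \<alpha> i * ?x j i) + \<mu> + e j" for j unfolding e_def lag_mean_def by simp
  have "A 0 = (\<Sum>i=1..p. \<alpha> i * A i) + ?N * \<mu> + (\<Sum>j\<in>?J. e j)"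
    unfolding A_def x_eq sum.distrib by (subst sum.swap) (simp add: sum_distrib_left cardJ)
  also have "(\<Sum>i=1..p. \<alpha> i * A i) = ?S * A 0 + (\<Sum>i=1..p. \<alpha> i * (A i - A 0))"
    by (simp add: right_diff_distrib sum_subtractf sum_distrib_right)
  finally have "(A 0 - ?N * m) * (1 - ?S) = (\<Sum>i=1..p. \<alpha> i * (A i - A 0)) + (\<Sum>j\<in>?J. e j) + ?N * (\<mu> - m * (1 - ?S))"
    by (simp add: algebra_simps)
  also have "\<mu> - m * (1 - ?S) = 0" using m by (simp add: algebra_simps)
  finally have "(A 0 - ?N * m) * (1 - ?S) = (\<Sum>i=1..p. \<alpha> i * (A i - A 0)) + (\<Sum>j\<in>?J. e j)" by simp
  moreover have "\<bar>\<Sum>i=1..p. \<alpha> i * (A i - A 0)\<bar> \<le> \<kappa>" using shiftA \<kappa> by (intro coefficient_average_le) auto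
  ultimately have "\<bar>(A 0 - ?N * m) * (1 - ?S)\<bar> \<le> 2 * \<kappa>" using e1 by linarith
  then have "\<bar>A 0 - ?N * m\<bar> * (1 - ?S) \<le> 2 * \<kappa>" using S by (simp add: abs_mult)
  then have A0: "\<bar>A 0 - ?N * m\<bar> \<le> 2 * \<kappa> / (1 - ?S)" using S by (simp add: pos_le_divide_eq)
  have k1: "\<kappa> \<le> \<kappa> / (1 - ?S)" using S \<kappa> by (simp add: pos_le_divide_eq mult_left_le)
  have Ai: "\<bar>A i - ?N * m\<bar> \<le> mean_const * \<kappa>" if "i \<le> p" for i
  proof -
    have "\<bar>A i - ?N * m\<bar> \<le> 2 * \<kappa> / (1 - ?S) + \<kappa> / (1 - ?S)" using A0 shiftA[OF that] k1 by linarith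
    also have "\<dots> = mean_const * \<kappa>" unfolding mean_const_def by (simp add: add_divide_distrib[symmetric])
    finally show ?thesis .
  qed
  then show "\<And>i. i \<le> p \<Longrightarrow> \<bar>(\<Sum>j\<in>?J. ?x j i) - ?N * m\<bar> \<le> mean_const * \<kappa>" unfolding A_def .
  have boundary2: "0 \<le> (\<Sum>l<s. ?x t l * ?x t (l + d)) \<and> (\<Sum>l<s. ?x t l * ?x t (l + d)) \<le> \<kappa>" if "s + d \<le> p" "t = a \<or> t = b" for s d t
  proof -
    have "(\<Sum>l<s. ?x t l * ?x t (l + d)) \<le> (\<Sum>l<s. (?x t l ^ 2 + ?x t (l + d) ^ 2) / 2)"
      by (intro sum_mono product_le_sum_squares)
    also have "\<dots> = ((\<Sum>l<s. ?x t l ^ 2) + (\<Sum>l<s. ?x t (l + d) ^ 2)) / 2" by (simp add: sum.distrib sum_divide_distrib[symmetric])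
    also have "(\<Sum>l<s. ?x t (l + d) ^ 2) = (\<Sum>l\<in>{d..<s + d}. ?x t l ^ 2)"
      using sum.shift_bounds_nat_ivl[of "\<lambda>l. ?x t l ^ 2" 0 d s] by (simp add: atLeast0LessThan)
    also have "\<dots> \<le> (\<Sum>l<p. ?x t l ^ 2)" using that by (intro sum_mono2) auto
    also have "(\<Sum>l<s. ?x t l ^ 2) \<le> (\<Sum>l<p. ?x t l ^ 2)" using that by (intro sum_mono2) auto
    also have "((\<Sum>l<p. ?x t l ^ 2) + (\<Sum>l<p. ?x t l ^ 2)) / 2 \<le> \<kappa>" using ba bb that by auto
    finally show ?thesis by (auto intro: sum_nonneg)
  qed
  have shift_le: "\<bar>P s (s + d) - P 0 d\<bar> \<le> \<kappa>" if "s + d \<le> p" for s d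
  proof -
    have "P s (s + d) = P 0 d + (\<Sum>l<s. ?x a l * ?x a (l + d)) - (\<Sum>l<s. ?x b l * ?x b (l + d))"
      using sum_shift[OF ab, of "\<lambda>j. real (x j) * real (x (j - int d))" s]
      unfolding P_def by (simp add: algebra_simps)
    then show ?thesis using boundary2[OF that, of a] boundary2[OF that, of b] by linarith
  qed
  have shiftP: "\<bar>P i d - P 0 (nat \<bar>int i - int d\<bar>)\<bar> \<le> \<kappa>" if "i \<le> p" "d \<le> p" for i d
  proof (cases "i \<le> d")
    case True
    then have "nat \<bar>int i - int d\<bar> = d - i" by simp
    then show ?thesis using shift_le[of i "d - i"] True that by simp
  next
    case False
    then have "nat \<bar>int i - int d\<bar> = i - d" by simp
    moreover have "P i d = P d i" unfolding P_def by (simp add: mult.commute)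
    ultimately show ?thesis using shift_le[of d "i - d"] False that by simp
  qed
  define \<delta> where "\<delta> d = P 0 d - ?N * c d" for d
  let ?E = "(2 + \<bar>\<mu>\<bar> * (1 + mean_const) + mean_const) * \<kappa>"
  have mc: "3 \<le> mean_const" by (rule mean_const_ge)
  have \<mu>k: "\<bar>\<mu> * z\<bar> \<le> \<bar>\<mu>\<bar> * mean_const * \<kappa>" if "\<bar>z\<bar> \<le> mean_const * \<kappa>" for z
    using that mult_left_mono[OF that, of "\<bar>\<mu>\<bar>"] by (simp add: abs_mult mult.assoc)
  have contr: "\<exists>w. (\<forall>i\<in>{1..p}. \<exists>l\<le>p. w i = \<delta> l) \<and> \<bar>\<delta> d - (\<Sum>i=1..p. \<alpha> i * w i)\<bar> \<le> ?E" if d: "d \<le> p" for d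
  proof (cases "d = 0")
    case False
    then have d1: "d \<in> {1..p}" using d by auto
    define w where "w i = \<delta> (nat \<bar>int i - int d\<bar>)" for i
    let ?R = "\<Sum>j\<in>?J. e j * ?x j d"
    have "P 0 d = (\<Sum>i=1..p. \<alpha> i * P i d) + \<mu> * A d + ?R"
    proof -
      have "P 0 d = (\<Sum>j\<in>?J. (\<Sum>i=1..p. \<alpha> i * (?x j i * ?x j d)) + \<mu> * ?x j d + e j * ?x j d)"
        unfolding P_def x_eq by (simp add: distrib_right sum_distrib_right mult.assoc)
      also have "\<dots> = (\<Sum>i=1..p. \<alpha> i * P i d) + \<mu> * A d + ?R"
        unfolding sum.distrib A_def P_def by (subst sum.swap) (simp add: sum_distrib_left)
      finally show ?thesis .
    qed
    then have "\<delta> d = (\<Sum>i=1..p. \<alpha> i * P i d) - ?N * (\<Sum>i=1..p. \<alpha> i * c (nat \<bar>int i - int d\<bar>)) + \<mu> * (A d - ?N * m) + ?R"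
      unfolding \<delta>_def cd[OF d1] by (simp add: algebra_simps)
    also have "(\<Sum>i=1..p. \<alpha> i * P i d) - ?N * (\<Sum>i=1..p. \<alpha> i * c (nat \<bar>int i - int d\<bar>)) =
      (\<Sum>i=1..p. \<alpha> i * w i) + (\<Sum>i=1..p. \<alpha> i * (P i d - P 0 (nat \<bar>int i - int d\<bar>)))"
      unfolding w_def \<delta>_def sum_distrib_left sum_subtractf[symmetric] sum.distrib[symmetric] by (simp add: algebra_simps)
    finally have eq: "\<delta> d - (\<Sum>i=1..p. \<alpha> i * w i) =
       (\<Sum>i=1..p. \<alpha> i * (P i d - P 0 (nat \<bar>int i - int d\<bar>))) + \<mu> * (A d - ?N * m) + ?R" by simp
    have "\<bar>\<Sum>i=1..p. \<alpha> i * (P i d - P 0 (nat \<bar>int i - int d\<bar>))\<bar> \<le> \<kappa>" using shiftP d \<kappa> by (intro coefficient_average_le) auto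
    then have "\<bar>\<delta> d - (\<Sum>i=1..p. \<alpha> i * w i)\<bar> \<le> \<kappa> + \<bar>\<mu>\<bar> * mean_const * \<kappa> + \<kappa>"
      unfolding eq using \<mu>k[OF Ai[OF d]] e2[OF d1] by linarith
    also have "\<dots> \<le> ?E"
    proof -
      have "0 \<le> \<bar>\<mu>\<bar> * \<kappa> + mean_const * \<kappa>" using mc \<kappa> by simp
      then show ?thesis by (simp add: algebra_simps)
    qed
    finally have "\<bar>\<delta> d - (\<Sum>i=1..p. \<alpha> i * w i)\<bar> \<le> ?E" .
    moreover have "nat \<bar>int i - int d\<bar> \<le> p" if "i \<in> {1..p}" for i using that d by auto
    then have "\<forall>i\<in>{1..p}. \<exists>l\<le>p. w i = \<delta> l" unfolding w_def by blast
    ultimately show ?thesis by blast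
  next
    case True
    let ?Rd = "\<lambda>i. \<Sum>j\<in>?J. e j * ?x j i" and ?R1 = "\<Sum>j\<in>?J. e j"
    let ?R3 = "\<Sum>j\<in>?J. e j ^ 2 - (lag_var p \<alpha> (\<lambda>i. x (int j - int i)) + v)"
    have xe: "?x j 0 * e j = (\<Sum>i=1..p. \<alpha> i * (e j * ?x j i)) + \<mu> * e j + (e j ^ 2 - (lag_var p \<alpha> (\<lambda>i. x (int j - int i)) + v))
        + ((\<Sum>i=1..p. \<alpha> i * (1 - \<alpha> i) * ?x j i) + v)" for j
    proof -
      have "?x j 0 * e j = (\<Sum>i=1..p. \<alpha> i * (e j * ?x j i)) + \<mu> * e j + e j ^ 2"
        by (subst x_eq) (simp add: algebra_simps sum_distrib_left power2_eq_square)
      then show ?thesis unfolding lag_var_def by simp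
    qed
    have "P 0 0 = (\<Sum>j\<in>?J. (\<Sum>i=1..p. \<alpha> i * (?x j 0 * ?x j i)) + \<mu> * ?x j 0 + ?x j 0 * e j)"
      unfolding P_def by (subst (2) x_eq) (simp add: distrib_left sum_distrib_left ac_simps)
    also have "\<dots> = (\<Sum>i=1..p. \<alpha> i * P 0 i) + \<mu> * A 0 + (\<Sum>j\<in>?J. ?x j 0 * e j)"
      unfolding sum.distrib A_def P_def by (subst sum.swap) (simp add: sum_distrib_left)
    also have "(\<Sum>j\<in>?J. ?x j 0 * e j) = (\<Sum>i=1..p. \<alpha> i * ?Rd i) + \<mu> * ?R1 + ?R3 + ((\<Sum>i=1..p. \<alpha> i * (1 - \<alpha> i) * A i) + ?N * v)"
    proof -
      have sw: "(\<Sum>j\<in>?J. \<Sum>i=1..p. h i * g j i) = (\<Sum>i=1..p. h i * (\<Sum>j\<in>?J. g j i))" for h :: "nat \<Rightarrow> real" and g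
        by (subst sum.swap) (simp add: sum_distrib_left)
      show ?thesis unfolding xe
        unfolding sum.distrib sw A_def by (simp add: sum_distrib_left cardJ)
    qed
    finally have "\<delta> 0 - (\<Sum>i=1..p. \<alpha> i * \<delta> i) = \<mu> * (A 0 - ?N * m) + (\<Sum>i=1..p. \<alpha> i * ?Rd i) + \<mu> * ?R1 + ?R3
       + ((\<Sum>i=1..p. \<alpha> i * (1 - \<alpha> i) * A i) - ?N * ((\<Sum>i=1..p. \<alpha> i * (1 - \<alpha> i)) * m))"
      unfolding \<delta>_def c0 by (simp add: algebra_simps sum_subtractf sum_distrib_left)
    also have "(\<Sum>i=1..p. \<alpha> i * (1 - \<alpha> i) * A i) - ?N * ((\<Sum>i=1..p. \<alpha> i * (1 - \<alpha> i)) * m) =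
       (\<Sum>i=1..p. \<alpha> i * ((1 - \<alpha> i) * (A i - ?N * m)))"
      by (simp add: sum_distrib_right sum_distrib_left sum_subtractf[symmetric] algebra_simps)
    finally have eq: "\<delta> 0 - (\<Sum>i=1..p. \<alpha> i * \<delta> i) = \<mu> * (A 0 - ?N * m) + (\<Sum>i=1..p. \<alpha> i * ?Rd i) + \<mu> * ?R1 + ?R3
       + (\<Sum>i=1..p. \<alpha> i * ((1 - \<alpha> i) * (A i - ?N * m)))" .
    have t1: "\<bar>\<Sum>i=1..p. \<alpha> i * ?Rd i\<bar> \<le> \<kappa>" using e2 \<kappa> by (intro coefficient_average_le) auto
    have t2: "\<bar>\<Sum>i=1..p. \<alpha> i * ((1 - \<alpha> i) * (A i - ?N * m))\<bar> \<le> mean_const * \<kappa>"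
    proof (rule coefficient_average_le)
      fix i assume i: "i \<in> {1..p}"
      have "\<bar>(1 - \<alpha> i) * (A i - ?N * m)\<bar> \<le> 1 * \<bar>A i - ?N * m\<bar>"
        unfolding abs_mult using \<alpha>[OF i] by (intro mult_right_mono) auto
      then show "\<bar>(1 - \<alpha> i) * (A i - ?N * m)\<bar> \<le> mean_const * \<kappa>" using Ai[of i] i by simp
    qed (use mc \<kappa> in auto)
    have t3: "\<bar>\<mu> * ?R1\<bar> \<le> \<bar>\<mu>\<bar> * \<kappa>" unfolding abs_mult using e1 by (intro mult_left_mono) auto
    have "\<bar>\<delta> 0 - (\<Sum>i=1..p. \<alpha> i * \<delta> i)\<bar> \<le> \<bar>\<mu>\<bar> * mean_const * \<kappa> + \<kappa> + \<bar>\<mu>\<bar> * \<kappa> + \<kappa> + mean_const * \<kappa>"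
      unfolding eq
      by (intro order_trans[OF abs_triangle_ineq add_mono] t1 t2 t3 \<mu>k[OF Ai[OF le0]] e3)
    also have "\<dots> = ?E" by (simp add: algebra_simps)
    finally show ?thesis unfolding True by (intro exI[of _ \<delta>]) auto
  qed
  have \<delta>: "\<bar>\<delta> d\<bar> \<le> ?E / (1 - ?S)" if "d \<le> p" for d by (rule sup_norm_contraction[OF contr that])
  fix i d assume id: "i \<le> p" "d \<le> p"
  then have "nat \<bar>int i - int d\<bar> \<le> p" by auto
  from \<delta>[OF this] shiftP[OF id] have "\<bar>P i d - ?N * c (nat \<bar>int i - int d\<bar>)\<bar> \<le> ?E / (1 - ?S) + \<kappa>"
    unfolding \<delta>_def by linarith
  also have "\<dots> = product_const \<mu> * \<kappa>" unfolding product_const_def by (simp add: distrib_right)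
  finally show "\<bar>(\<Sum>j\<in>?J. ?x j i * ?x j d) - ?N * c (nat \<bar>int i - int d\<bar>)\<bar> \<le> product_const \<mu> * \<kappa>"
    unfolding P_def .
qed

end

context changing_inar
begin

definition regime :: "nat \<Rightarrow> nat \<Rightarrow> nat pmf" where
  "regime t k = (if k \<le> t then F' else F'')"

lemma regime_in_regimes: "regime t \<in> regimes"
  unfolding regime_def regimes_def by auto

text \<open>The limiting growth of the partial sums of the process, kinked at the change point.\<close>

definition growth :: "real \<Rightarrow> real \<Rightarrow> nat \<Rightarrow> nat \<Rightarrow> real" where
  "growth m' m'' t k = m' * real (min k t) + m'' * real (k - min k t)"

lemma growth_lipschitz:
  assumes "0 \<le> m'" "0 \<le> m''" "k \<le> l"
  shows "growth m' m'' t k \<le> growth m' m'' t l"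
    and "growth m' m'' t l \<le> growth m' m'' t k + (m' + m'') * real (l - k)"
proof -
  have 1: "min k t \<le> min l t" "k - min k t \<le> l - min l t" using assms(3) by auto
  show "growth m' m'' t k \<le> growth m' m'' t l"
    unfolding growth_def using 1 assms by (intro add_mono mult_left_mono) auto
  have 2: "real (min l t) \<le> real (min k t) + real (l - k)" "real (l - min l t) \<le> real (k - min k t) + real (l - k)"
    using assms(3) by auto
  have "growth m' m'' t l \<le> m' * (real (min k t) + real (l - k)) + m'' * (real (k - min k t) + real (l - k))"
    unfolding growth_def using 2 assms by (intro add_mono mult_left_mono) auto
  then show "growth m' m'' t l \<le> growth m' m'' t k + (m' + m'') * real (l - k)"
    unfolding growth_def by (simp add: algebra_simps)
qed

lemma grid_segment:
  fixes x :: "int \<Rightarrow> nat"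
  assumes small: "\<And>k. k \<in> G \<Longrightarrow> fluctuation Fs k x < \<kappa> ^ 2" and \<kappa>: "0 \<le> \<kappa>"
    and ab: "a \<in> G" "b \<in> G" "a \<le> b" and F: "\<And>j. j \<in> {a<..b} \<Longrightarrow> Fs j = F"
    and yw: "yule_walker_solution (innov_mean F) (innov_var F) m c"
  shows "\<And>i. i \<le> p \<Longrightarrow> \<bar>(\<Sum>j\<in>{a<..b}. real (x (int j - int i))) - real (b - a) * m\<bar> \<le> mean_const * (2 * \<kappa>)"
    and "\<And>i d. i \<le> p \<Longrightarrow> d \<le> p \<Longrightarrow>
      \<bar>(\<Sum>j\<in>{a<..b}. real (x (int j - int i)) * real (x (int j - int d))) - real (b - a) * c (nat \<bar>int i - int d\<bar>)\<bar>
        \<le> product_const (innov_mean F) * (2 * \<kappa>)"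
proof -
  have sq: "\<bar>z\<bar> \<le> \<kappa>" if "z ^ 2 \<le> fluctuation Fs k x" "k \<in> G" for z k
  proof -
    have "\<bar>z\<bar> ^ 2 \<le> \<kappa> ^ 2" using that small[of k] by simp
    then show ?thesis using \<kappa> by (rule power2_le_imp_le)
  qed
  have nn: "0 \<le> (\<Sum>d=1..p. (\<Sum>j=1..k. dev Fs j x * real (x (int j - int d))) ^ 2)" for k by (intro sum_nonneg) auto
  have f1: "\<bar>\<Sum>j=1..k. dev Fs j x\<bar> \<le> \<kappa>" if "k \<in> G" for k
    by (rule sq[OF _ that]) (use nn[of k] in \<open>simp add: fluctuation_def\<close>)
  have f2: "\<bar>\<Sum>j=1..k. dev Fs j x * real (x (int j - int d))\<bar> \<le> \<kappa>" if "k \<in> G" "d \<in> {1..p}" for k d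
  proof (rule sq[OF _ that(1)])
    have "(\<Sum>j=1..k. dev Fs j x * real (x (int j - int d))) ^ 2 \<le> (\<Sum>d=1..p. (\<Sum>j=1..k. dev Fs j x * real (x (int j - int d))) ^ 2)"
      using that(2) by (intro member_le_sum[of d "{1..p}" "\<lambda>d. (\<Sum>j=1..k. dev Fs j x * real (x (int j - int d))) ^ 2"]) auto
    then show "(\<Sum>j=1..k. dev Fs j x * real (x (int j - int d))) ^ 2 \<le> fluctuation Fs k x"
      unfolding fluctuation_def by (smt (verit) zero_le_power2)
  qed
  have f3: "\<bar>\<Sum>j=1..k. dev Fs j x ^ 2 - cond_var Fs j x\<bar> \<le> \<kappa>" if "k \<in> G" for k
    by (rule sq[OF _ that]) (use nn[of k] in \<open>simp add: fluctuation_def\<close>)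
  have f4: "(\<Sum>i<p. real (x (int k - int i)) ^ 2) \<le> \<kappa>" if "k \<in> G" for k
    by (rule order_trans[OF abs_ge_self sq[OF _ that]]) (use nn[of k] in \<open>simp add: fluctuation_def\<close>)
  have e: "real (x (int j)) - lag_mean p \<alpha> (\<lambda>i. x (int j - int i)) - innov_mean F = dev Fs j x"
    "lag_var p \<alpha> (\<lambda>i. x (int j - int i)) + innov_var F = cond_var Fs j x" if "j \<in> {a<..b}" for j
    unfolding dev_def cond_var_def F[OF that] by simp_all
  have s1: "\<bar>\<Sum>j\<in>{a<..b}. real (x (int j)) - lag_mean p \<alpha> (\<lambda>i. x (int j - int i)) - innov_mean F\<bar> \<le> 2 * \<kappa>"
  proof -
    have "(\<Sum>j\<in>{a<..b}. real (x (int j)) - lag_mean p \<alpha> (\<lambda>i. x (int j - int i)) - innov_mean F) = (\<Sum>j\<in>{a<..b}. dev Fs j x)"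
      by (intro sum.cong refl e(1))
    then show ?thesis unfolding sum_Ioc_eq_diff[OF ab(3), of "\<lambda>j. dev Fs j x"] using f1[OF ab(1)] f1[OF ab(2)] by linarith
  qed
  have s2: "\<bar>\<Sum>j\<in>{a<..b}. (real (x (int j)) - lag_mean p \<alpha> (\<lambda>i. x (int j - int i)) - innov_mean F) * real (x (int j - int d))\<bar> \<le> 2 * \<kappa>"
    if "d \<in> {1..p}" for d
  proof -
    have "(\<Sum>j\<in>{a<..b}. (real (x (int j)) - lag_mean p \<alpha> (\<lambda>i. x (int j - int i)) - innov_mean F) * real (x (int j - int d))) =
       (\<Sum>j\<in>{a<..b}. dev Fs j x * real (x (int j - int d)))"
      by (intro sum.cong refl arg_cong2[where f = "(*)"] e(1))
    then show ?thesis unfolding sum_Ioc_eq_diff[OF ab(3), of "\<lambda>j. dev Fs j x * real (x (int j - int d))"]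
      using f2[OF ab(1) that] f2[OF ab(2) that] by linarith
  qed
  have s3: "\<bar>\<Sum>j\<in>{a<..b}. (real (x (int j)) - lag_mean p \<alpha> (\<lambda>i. x (int j - int i)) - innov_mean F) ^ 2 -
      (lag_var p \<alpha> (\<lambda>i. x (int j - int i)) + innov_var F)\<bar> \<le> 2 * \<kappa>"
  proof -
    have "(\<Sum>j\<in>{a<..b}. (real (x (int j)) - lag_mean p \<alpha> (\<lambda>i. x (int j - int i)) - innov_mean F) ^ 2 -
      (lag_var p \<alpha> (\<lambda>i. x (int j - int i)) + innov_var F)) = (\<Sum>j\<in>{a<..b}. dev Fs j x ^ 2 - cond_var Fs j x)"
      by (intro sum.cong refl arg_cong2[where f = "(-)"] arg_cong2[where f = "(^)"] e)
    then show ?thesis unfolding sum_Ioc_eq_diff[OF ab(3), of "\<lambda>j. dev Fs j x ^ 2 - cond_var Fs j x"]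
      using f3[OF ab(1)] f3[OF ab(2)] by linarith
  qed
  have s4: "(\<Sum>i<p. real (x (int a - int i)) ^ 2) \<le> 2 * \<kappa>" "(\<Sum>i<p. real (x (int b - int i)) ^ 2) \<le> 2 * \<kappa>"
    using f4[OF ab(1)] f4[OF ab(2)] \<kappa> by linarith+
  note seg = segment_averages[OF ab(3) yw s1 s2 s3 s4]
  show "\<And>i. i \<le> p \<Longrightarrow> \<bar>(\<Sum>j\<in>{a<..b}. real (x (int j - int i))) - real (b - a) * m\<bar> \<le> mean_const * (2 * \<kappa>)"
    "\<And>i d. i \<le> p \<Longrightarrow> d \<le> p \<Longrightarrow>
      \<bar>(\<Sum>j\<in>{a<..b}. real (x (int j - int i)) * real (x (int j - int d))) - real (b - a) * c (nat \<bar>int i - int d\<bar>)\<bar>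
        \<le> product_const (innov_mean F) * (2 * \<kappa>)"
    using seg by blast+
qed

definition sum_const :: "real \<Rightarrow> real \<Rightarrow> real \<Rightarrow> real" where
  "sum_const K m' m'' = 4 * K * mean_const + K + (m' + m'') * (2 + real p)"

definition path_const :: "real \<Rightarrow> real \<Rightarrow> real \<Rightarrow> real" where
  "path_const K m' m'' = sum_const K m' m'' + 2 * K * (product_const (innov_mean F') + product_const (innov_mean F''))"

lemma product_const_nonneg: "0 \<le> product_const \<mu>"
  unfolding product_const_def using coeff_sum mean_const_ge by (intro add_nonneg_nonneg divide_nonneg_nonneg mult_nonneg_nonneg) auto

lemma path_const_nonneg:
  assumes "0 \<le> K" "0 \<le> m'" "0 \<le> m''"
  shows "0 \<le> path_const K m' m''"
  unfolding path_const_def sum_const_def using assms product_const_nonneg mean_const_ge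
  by (intro add_nonneg_nonneg mult_nonneg_nonneg) auto

text \<open>
  Splitting at the change point gives the sums up to grid times. Partial sums of nonnegative values are monotone and
  \<open>growth\<close> is Lipschitz, so the approximation extends to all times at the cost of the mesh of the grid, which is of
  order \<open>sqrt n \<le> r\<close>.
\<close>

lemma good_path_averages:
  fixes x :: "int \<Rightarrow> nat"
  assumes yw': "yule_walker_solution (innov_mean F') (innov_var F') m' c'"
    and yw'': "yule_walker_solution (innov_mean F'') (innov_var F'') m'' c''"
    and K: "0 \<le> K" and n: "1 \<le> n" and t: "t \<le> n" and r: "sqrt (real n) \<le> r"
    and small: "\<And>k. k \<in> grid n t \<Longrightarrow> fluctuation (regime t) k x < (K * r) ^ 2"
  shows "\<And>i d. i \<le> p \<Longrightarrow> d \<le> p \<Longrightarrow>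
      \<bar>(\<Sum>j=1..n. real (x (int j - int i)) * real (x (int j - int d)))
        - (real t * c' (nat \<bar>int i - int d\<bar>) + real (n - t) * c'' (nat \<bar>int i - int d\<bar>))\<bar> \<le> path_const K m' m'' * r"
    and "\<And>i k. i \<le> p \<Longrightarrow> k \<le> n \<Longrightarrow>
      \<bar>(\<Sum>j=1..k. real (x (int j - int i))) - growth m' m'' t k\<bar> \<le> path_const K m' m'' * r"
proof -
  let ?G = "grid n t" and ?Fs = "regime t" and ?g = "growth m' m'' t"
  have m: "0 \<le> m'" "0 \<le> m''" using yule_walker_mean_nonneg yw' yw'' by blast+
  have r1: "1 \<le> r" using r n by (smt (verit) of_nat_1 of_nat_mono real_sqrt_ge_1_iff)
  have Kr: "0 \<le> K * r" using K r1 by simp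
  have mc: "3 \<le> mean_const" by (rule mean_const_ge)
  have sc0: "0 \<le> sum_const K m' m''" unfolding sum_const_def using K m mc by simp
  have pc: "0 \<le> 2 * K * (product_const (innov_mean F') + product_const (innov_mean F''))"
    using K product_const_nonneg by simp
  have G: "0 \<in> ?G" "t \<in> ?G" "n \<in> ?G" unfolding grid_def by auto
  have seg': "\<bar>(\<Sum>j\<in>{0<..b}. real (x (int j - int i))) - real b * m'\<bar> \<le> mean_const * (2 * (K * r))"
    "d \<le> p \<Longrightarrow> \<bar>(\<Sum>j\<in>{0<..b}. real (x (int j - int i)) * real (x (int j - int d))) - real b * c' (nat \<bar>int i - int d\<bar>)\<bar>
        \<le> product_const (innov_mean F') * (2 * (K * r))" if "b \<in> ?G" "b \<le> t" "i \<le> p" for b i d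
  proof -
    have F: "?Fs j = F'" if "j \<in> {0<..b}" for j using that \<open>b \<le> t\<close> unfolding regime_def by auto
    from grid_segment[OF small Kr G(1) that(1) _ F yw'] that(3)
    show "\<bar>(\<Sum>j\<in>{0<..b}. real (x (int j - int i))) - real b * m'\<bar> \<le> mean_const * (2 * (K * r))"
    "d \<le> p \<Longrightarrow> \<bar>(\<Sum>j\<in>{0<..b}. real (x (int j - int i)) * real (x (int j - int d))) - real b * c' (nat \<bar>int i - int d\<bar>)\<bar>
        \<le> product_const (innov_mean F') * (2 * (K * r))" by simp_all
  qed
  have seg'': "\<bar>(\<Sum>j\<in>{t<..b}. real (x (int j - int i))) - real (b - t) * m''\<bar> \<le> mean_const * (2 * (K * r))"
    "d \<le> p \<Longrightarrow> \<bar>(\<Sum>j\<in>{t<..b}. real (x (int j - int i)) * real (x (int j - int d))) - real (b - t) * c'' (nat \<bar>int i - int d\<bar>)\<bar>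
        \<le> product_const (innov_mean F'') * (2 * (K * r))" if "b \<in> ?G" "t \<le> b" "i \<le> p" for b i d
  proof -
    have F: "?Fs j = F''" if "j \<in> {t<..b}" for j using that unfolding regime_def by auto
    from grid_segment[OF small Kr G(2) that(1) that(2) F yw''] that(3)
    show "\<bar>(\<Sum>j\<in>{t<..b}. real (x (int j - int i))) - real (b - t) * m''\<bar> \<le> mean_const * (2 * (K * r))"
    "d \<le> p \<Longrightarrow> \<bar>(\<Sum>j\<in>{t<..b}. real (x (int j - int i)) * real (x (int j - int d))) - real (b - t) * c'' (nat \<bar>int i - int d\<bar>)\<bar>
        \<le> product_const (innov_mean F'') * (2 * (K * r))" by simp_all
  qed
  have zero: "(\<Sum>j=1..b. f j) = (\<Sum>j\<in>{0<..b}. f j)" for f :: "nat \<Rightarrow> real" and b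
    using sum_Ioc_eq_diff[of 0 b f] by simp
  have split: "(\<Sum>j=1..b. f j) = (\<Sum>j\<in>{0<..t}. f j) + (\<Sum>j\<in>{t<..b}. f j)" if "t \<le> b" for f :: "nat \<Rightarrow> real" and b
    using sum_Ioc_eq_diff[OF that, of f] zero[of f t] by simp
  show "\<bar>(\<Sum>j=1..n. real (x (int j - int i)) * real (x (int j - int d)))
        - (real t * c' (nat \<bar>int i - int d\<bar>) + real (n - t) * c'' (nat \<bar>int i - int d\<bar>))\<bar> \<le> path_const K m' m'' * r"
    if "i \<le> p" "d \<le> p" for i d
  proof -
    have "\<bar>(\<Sum>j=1..n. real (x (int j - int i)) * real (x (int j - int d)))
        - (real t * c' (nat \<bar>int i - int d\<bar>) + real (n - t) * c'' (nat \<bar>int i - int d\<bar>))\<bar> \<le>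
        product_const (innov_mean F') * (2 * (K * r)) + product_const (innov_mean F'') * (2 * (K * r))"
      using seg'(2)[OF G(2) order_refl that] seg''(2)[OF G(3) t that] unfolding split[OF t] by linarith
    also have "\<dots> = (2 * K * (product_const (innov_mean F') + product_const (innov_mean F''))) * r" by (simp add: algebra_simps)
    also have "\<dots> \<le> path_const K m' m'' * r" unfolding path_const_def using sc0 r1 by (intro mult_right_mono) auto
    finally show ?thesis .
  qed
  define S where "S k = (\<Sum>j=1..k. real (x (int j)))" for k
  let ?E = "4 * K * mean_const * r"
  have S_grid: "\<bar>S k - ?g k\<bar> \<le> ?E" if k: "k \<in> ?G" for k
  proof (cases "k \<le> t")
    case True
    have "\<bar>S k - ?g k\<bar> \<le> mean_const * (2 * (K * r))"
      using seg'(1)[OF k True, of 0] True unfolding S_def zero growth_def by (simp add: mult.commute)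
    then show ?thesis using Kr mc mult_nonneg_nonneg[of mean_const "K * r"] by (simp add: algebra_simps)
  next
    case False
    have S: "S k = (\<Sum>j\<in>{0<..t}. real (x (int j - int 0))) + (\<Sum>j\<in>{t<..k}. real (x (int j - int 0)))"
      unfolding S_def using False by (subst split) auto
    have g: "?g k = real t * m' + real (k - t) * m''"
      unfolding growth_def using False by (simp add: mult.commute)
    have "t \<le> k" using False by simp
    then have "\<bar>S k - ?g k\<bar> \<le> mean_const * (2 * (K * r)) + mean_const * (2 * (K * r))"
      using seg'(1)[OF G(2) order_refl le0] seg''(1)[OF k _ le0] unfolding S g by linarith
    then show ?thesis by (simp add: algebra_simps)
  qed
  have S_mono: "S k \<le> S l" if "k \<le> l" for k l unfolding S_def using that by (intro sum_mono2) auto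
  let ?h = "nat \<lceil>sqrt (real n)\<rceil>"
  have h: "0 < ?h" using n by simp
  have "real ?h \<le> sqrt (real n) + 1" by (simp add: of_nat_nat)
  then have h2: "real ?h \<le> 2 * r" using r r1 by linarith
  have S_all: "\<bar>S k - ?g k\<bar> \<le> ?E + (m' + m'') * (2 * r)" if k: "k \<le> n" for k
  proof -
    define k1 where "k1 = ?h * (k div ?h)"
    define k2 where "k2 = min (k1 + ?h) n"
    have "k = k1 + k mod ?h" unfolding k1_def by simp
    moreover have "k mod ?h < ?h" using h by simp
    ultimately have kk: "k1 \<le> k" "k \<le> k2" "k2 - k \<le> ?h" "k - k1 \<le> ?h" unfolding k2_def using k by linarith+
    have "k1 \<le> n" using kk(1) k by linarith
    moreover have "?h dvd k1" unfolding k1_def by simp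
    ultimately have "k1 \<in> ?G" unfolding grid_def by blast
    moreover have "k2 \<in> ?G" unfolding grid_def k2_def k1_def by (auto simp: min_def)
    ultimately have g: "\<bar>S k1 - ?g k1\<bar> \<le> ?E" "\<bar>S k2 - ?g k2\<bar> \<le> ?E" by (auto intro: S_grid)
    have lip: "(m' + m'') * real (l - k') \<le> (m' + m'') * (2 * r)" if "l - k' \<le> ?h" for l k'
      using order_trans[OF of_nat_mono[OF that] h2] m by (intro mult_left_mono) auto
    have "?g k2 \<le> ?g k + (m' + m'') * (2 * r)" "?g k \<le> ?g k1 + (m' + m'') * (2 * r)"
      using growth_lipschitz(2)[OF m kk(2), of t] growth_lipschitz(2)[OF m kk(1), of t] lip[OF kk(3)] lip[OF kk(4)] by linarith+
    then show ?thesis using g S_mono[OF kk(1)] S_mono[OF kk(2)] by linarith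
  qed
  show "\<bar>(\<Sum>j=1..k. real (x (int j - int i))) - ?g k\<bar> \<le> path_const K m' m'' * r" if i: "i \<le> p" and k: "k \<le> n" for i k
  proof -
    let ?T = "\<Sum>j=1..k. real (x (int j - int i))"
    have "fluctuation ?Fs 0 x < (K * r)^2" using small[OF G(1)] .
    moreover have "(\<Sum>l<p. real (x (int 0 - int l)) ^ 2) ^ 2 \<le> fluctuation ?Fs 0 x" unfolding fluctuation_def by simp
    ultimately have "(\<Sum>l<p. real (x (int 0 - int l)) ^ 2) ^ 2 \<le> (K * r)^2" by linarith
    then have b0: "(\<Sum>l<p. real (x (int 0 - int l)) ^ 2) \<le> K * r" using Kr by (rule power2_le_imp_le)
    have "(\<Sum>l<i. real (x (int 0 - int l))) \<le> (\<Sum>l<i. real (x (int 0 - int l)) ^ 2)" by (intro sum_mono nat_le_square)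
    also have "\<dots> \<le> (\<Sum>l<p. real (x (int 0 - int l)) ^ 2)" using i by (intro sum_mono2) auto
    finally have init: "(\<Sum>l<i. real (x (int 0 - int l))) \<le> K * r" using b0 by linarith
    have "?T = S k + (\<Sum>l<i. real (x (int 0 - int l))) - (\<Sum>l<i. real (x (int k - int l)))"
      using sum_shift[of 0 k "\<lambda>j. real (x j)" i] unfolding zero S_def by simp
    moreover have "0 \<le> (\<Sum>l<i. real (x (int k - int l)))" by (intro sum_nonneg) auto
    ultimately have upper: "?T \<le> S k + K * r" using init by linarith
    \<comment> \<open>The last \<open>i\<close> values before \<open>k\<close> are not bounded individually, so the lower bound drops to time \<open>k - i\<close>;
      truncated subtraction covers \<open>k < i\<close>, where the bound is zero.\<close>
    have "S (k - i) = (\<Sum>j\<in>{1 + i..k - i + i}. real (x (int j - int i)))"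
      unfolding S_def by (subst sum.shift_bounds_cl_nat_ivl) (auto intro!: sum.cong arg_cong[where f = "\<lambda>z. real (x z)"])
    also have "\<dots> \<le> ?T"
    proof (cases "i \<le> k")
      case True
      then show ?thesis by (intro sum_mono2) auto
    next
      case False
      then show ?thesis by (simp add: sum_nonneg)
    qed
    finally have lower: "S (k - i) \<le> ?T" .
    have ki: "k - i \<le> n" "k - i \<le> k" "k - (k - i) \<le> p" using k i by auto
    have "?g k \<le> ?g (k - i) + (m' + m'') * real (k - (k - i))" by (rule growth_lipschitz(2)[OF m ki(2)])
    also have "(m' + m'') * real (k - (k - i)) \<le> (m' + m'') * (real p * r)"
    proof (rule mult_left_mono)
      have "real (k - (k - i)) \<le> real p" using ki(3) by linarith
      also have "\<dots> \<le> real p * r" using r1 by (simp add: mult_le_cancel_left1)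
      finally show "real (k - (k - i)) \<le> real p * r" .
    qed (use m in auto)
    finally have gk: "?g k \<le> ?g (k - i) + (m' + m'') * (real p * r)" by simp
    have mp: "0 \<le> (m' + m'') * (real p * r)" using m r1 by simp
    have "\<bar>?T - ?g k\<bar> \<le> ?E + (m' + m'') * (2 * r) + K * r + (m' + m'') * (real p * r)"
      using S_all[OF k] S_all[OF ki(1)] upper lower gk mp Kr by linarith
    also have "\<dots> = sum_const K m' m'' * r" unfolding sum_const_def by (simp add: algebra_simps)
    also have "\<dots> \<le> path_const K m' m'' * r" unfolding path_const_def using pc r1 by (intro mult_right_mono) auto
    finally show ?thesis .
  qed
qed

end

section \<open>Positive definite matrices and perturbed linear systems\<close>

lemma mult_mat_vec_index_sum:
  assumes "A \<in> carrier_mat N N" "v \<in> carrier_vec N" "a < N"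
  shows "(A *\<^sub>v v) $ a = (\<Sum>b<N. A $$ (a, b) * v $ b)"
  using assms by (auto simp: scalar_prod_def atLeast0LessThan intro!: sum.cong)

lemma scalar_prod_sum:
  assumes "w \<in> carrier_vec N"
  shows "v \<bullet> w = (\<Sum>b<N. v $ b * w $ b)"
  using assms by (auto simp: scalar_prod_def atLeast0LessThan)

lemma inverse_mat_correct:
  assumes A: "A \<in> carrier_mat N N" and inj: "\<And>v. v \<in> carrier_vec N \<Longrightarrow> A *\<^sub>v v = 0\<^sub>v N \<Longrightarrow> v = 0\<^sub>v N"
  shows "inverse_mat A \<in> carrier_mat N N" "A * inverse_mat A = 1\<^sub>m N" "inverse_mat A * A = 1\<^sub>m N" "invertible_mat A"
proof -
  have "det A \<noteq> 0" using det_0_iff_vec_prod_zero_field[OF A] inj by blast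
  then have "A \<in> Units (ring_mat TYPE(real) N ())" by (rule det_non_zero_imp_unit[OF A])
  then obtain B where B: "mat_inverse A = Some B" using mat_inverse(1)[OF A, where b = "()"] by (cases "mat_inverse A") auto
  from mat_inverse(2)[OF A B] have *: "A * B = 1\<^sub>m N" "B * A = 1\<^sub>m N" "B \<in> carrier_mat N N" by auto
  moreover have "inverse_mat A = B" unfolding inverse_mat_def B by simp
  ultimately show "inverse_mat A \<in> carrier_mat N N" "A * inverse_mat A = 1\<^sub>m N" "inverse_mat A * A = 1\<^sub>m N" by auto
  show "invertible_mat A" unfolding invertible_mat_def inverts_mat_def square_mat.simps using A * by (intro conjI exI[of _ B]) auto
qed

definition pos_def :: "nat \<Rightarrow> real mat \<Rightarrow> bool" where
  "pos_def N A \<longleftrightarrow> A \<in> carrier_mat N N \<and> (\<forall>v\<in>carrier_vec N. v \<noteq> 0\<^sub>v N \<longrightarrow> 0 < v \<bullet> (A *\<^sub>v v))"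

lemma pos_def_nonneg:
  assumes "pos_def N A" "v \<in> carrier_vec N"
  shows "0 \<le> v \<bullet> (A *\<^sub>v v)"
proof (cases "v = 0\<^sub>v N")
  case True
  have "A *\<^sub>v 0\<^sub>v N \<in> carrier_vec N" using assms unfolding pos_def_def by auto
  then show ?thesis using True by simp
qed (use assms in \<open>auto simp: pos_def_def intro: less_imp_le\<close>)

lemma pos_def_injective:
  assumes "pos_def N A" "v \<in> carrier_vec N" "A *\<^sub>v v = 0\<^sub>v N"
  shows "v = 0\<^sub>v N"
proof (rule ccontr)
  assume "v \<noteq> 0\<^sub>v N"
  then have "0 < v \<bullet> (A *\<^sub>v v)" using assms unfolding pos_def_def by auto
  then show False using assms by simp
qed

lemma mixture_mult_vec:
  assumes C': "C' \<in> carrier_mat N N" and C'': "C'' \<in> carrier_mat N N" and v: "v \<in> carrier_vec N"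
  shows "(\<rho> \<cdot>\<^sub>m C' + \<sigma> \<cdot>\<^sub>m C'') *\<^sub>v v = \<rho> \<cdot>\<^sub>v (C' *\<^sub>v v) + \<sigma> \<cdot>\<^sub>v (C'' *\<^sub>v (v :: real vec))"
  using assms by (intro eq_vecI) (auto simp: scalar_prod_def sum.distrib[symmetric] sum_distrib_left algebra_simps intro!: sum.cong)

lemma pos_def_mixture:
  assumes C': "pos_def N C'" and C'': "pos_def N C''" and \<rho>: "0 < \<rho>" "\<rho> < 1"
  shows "pos_def N (\<rho> \<cdot>\<^sub>m C' + (1 - \<rho>) \<cdot>\<^sub>m C'')"
  unfolding pos_def_def
proof (intro conjI ballI impI)
  have c: "C' \<in> carrier_mat N N" "C'' \<in> carrier_mat N N" using assms unfolding pos_def_def by auto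
  then show "\<rho> \<cdot>\<^sub>m C' + (1 - \<rho>) \<cdot>\<^sub>m C'' \<in> carrier_mat N N" by simp
  fix v :: "real vec" assume v: "v \<in> carrier_vec N" "v \<noteq> 0\<^sub>v N"
  have cv: "C' *\<^sub>v v \<in> carrier_vec N" "C'' *\<^sub>v v \<in> carrier_vec N" using c v by auto
  have "v \<bullet> ((\<rho> \<cdot>\<^sub>m C' + (1 - \<rho>) \<cdot>\<^sub>m C'') *\<^sub>v v) = \<rho> * (v \<bullet> (C' *\<^sub>v v)) + (1 - \<rho>) * (v \<bullet> (C'' *\<^sub>v v))"
    unfolding mixture_mult_vec[OF c v(1)] using v cv by (simp add: scalar_prod_add_distrib[of _ N])
  also have "\<dots> > 0" using assms v unfolding pos_def_def by (intro add_pos_pos mult_pos_pos) auto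
  finally show "0 < v \<bullet> ((\<rho> \<cdot>\<^sub>m C' + (1 - \<rho>) \<cdot>\<^sub>m C'') *\<^sub>v v)" .
qed

text \<open>The matrix \<open>C'' Q\<inverse> C'\<close> is the inverse of a convex combination of \<open>C'\<inverse>\<close> and \<open>C''\<inverse>\<close>, hence
positive definite; written with \<open>v = Q\<inverse> C' e\<close> 
\<open>e \<bullet> C'' v\<close> becomes a positive combination of two quadratic forms.\<close>

lemma parallel_sum_positive:
  assumes C': "pos_def N C'" and C'': "pos_def N C''" and \<rho>: "0 < \<rho>" "\<rho> < 1"
    and e: "e \<in> carrier_vec N" "e \<noteq> 0\<^sub>v N" and v: "v \<in> carrier_vec N"
    and Qv: "(\<rho> \<cdot>\<^sub>m C' + (1 - \<rho>) \<cdot>\<^sub>m C'') *\<^sub>v v = C' *\<^sub>v e"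
  shows "0 < e \<bullet> (C'' *\<^sub>v v)"
proof -
  have c: "C' \<in> carrier_mat N N" "C'' \<in> carrier_mat N N" using assms unfolding pos_def_def by auto
  define z where "z = e - \<rho> \<cdot>\<^sub>v v"
  have z: "z \<in> carrier_vec N" unfolding z_def using e v by simp
  have cv: "C' *\<^sub>v v \<in> carrier_vec N" "C'' *\<^sub>v v \<in> carrier_vec N" "C' *\<^sub>v e \<in> carrier_vec N" using c v e by auto
  have eq: "\<rho> \<cdot>\<^sub>v (C' *\<^sub>v v) + (1 - \<rho>) \<cdot>\<^sub>v (C'' *\<^sub>v v) = C' *\<^sub>v e"
    using Qv unfolding mixture_mult_vec[OF c v] .
  have zc: "(1 - \<rho>) \<cdot>\<^sub>v (C'' *\<^sub>v v) = C' *\<^sub>v z"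
  proof -
    have "C' *\<^sub>v z = C' *\<^sub>v e - \<rho> \<cdot>\<^sub>v (C' *\<^sub>v v)"
      unfolding z_def using c e v by (simp add: mult_minus_distrib_mat_vec[of _ N N] mult_mat_vec[of _ N N])
    also have "\<dots> = (1 - \<rho>) \<cdot>\<^sub>v (C'' *\<^sub>v v)" unfolding eq[symmetric] using c by (intro eq_vecI) auto
    finally show ?thesis by simp
  qed
  have ez: "e = z + \<rho> \<cdot>\<^sub>v v" unfolding z_def using e v by (intro eq_vecI) auto
  have "(1 - \<rho>) * (e \<bullet> (C'' *\<^sub>v v)) = e \<bullet> ((1 - \<rho>) \<cdot>\<^sub>v (C'' *\<^sub>v v))" using e cv by simp
  also have "\<dots> = z \<bullet> ((1 - \<rho>) \<cdot>\<^sub>v (C'' *\<^sub>v v)) + \<rho> * (1 - \<rho>) * (v \<bullet> (C'' *\<^sub>v v))"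
    by (subst ez) (use z v cv in \<open>simp add: add_scalar_prod_distrib[of _ N] algebra_simps\<close>)
  also have "z \<bullet> ((1 - \<rho>) \<cdot>\<^sub>v (C'' *\<^sub>v v)) = z \<bullet> (C' *\<^sub>v z)" unfolding zc ..
  finally have main: "(1 - \<rho>) * (e \<bullet> (C'' *\<^sub>v v)) = z \<bullet> (C' *\<^sub>v z) + \<rho> * (1 - \<rho>) * (v \<bullet> (C'' *\<^sub>v v))" .
  have "v \<noteq> 0\<^sub>v N"
  proof
    assume "v = 0\<^sub>v N"
    then have "C' *\<^sub>v e = 0\<^sub>v N" using eq[symmetric] c by auto
    then show False using pos_def_injective[OF C' e(1)] e(2) by simp
  qed
  then have "0 < v \<bullet> (C'' *\<^sub>v v)" using C'' v unfolding pos_def_def by auto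
  then have "0 < \<rho> * (1 - \<rho>) * (v \<bullet> (C'' *\<^sub>v v))" using \<rho> by simp
  then have "0 < (1 - \<rho>) * (e \<bullet> (C'' *\<^sub>v v))" unfolding main using pos_def_nonneg[OF C' z] by linarith
  then show ?thesis using \<rho> by (simp add: zero_less_mult_iff)
qed

definition inverse_bounded :: "nat \<Rightarrow> real mat \<Rightarrow> real \<Rightarrow> bool" where
  "inverse_bounded N Q c \<longleftrightarrow> (\<forall>u\<in>carrier_vec N. \<forall>B.
    (\<forall>a<N. \<bar>(Q *\<^sub>v u) $ a\<bar> \<le> B) \<longrightarrow> (\<forall>a<N. \<bar>u $ a\<bar> \<le> c * B))"

lemma inverse_bound:
  assumes Q: "Q \<in> carrier_mat N N" and inj: "\<And>v. v \<in> carrier_vec N \<Longrightarrow> Q *\<^sub>v v = 0\<^sub>v N \<Longrightarrow> v = 0\<^sub>v N"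
  obtains c :: real where "0 < c" and "inverse_bounded N Q c"
proof -
  let ?R = "inverse_mat Q"
  note R = inverse_mat_correct[OF Q inj]
  define c where "c = (\<Sum>a<N. \<Sum>b<N. \<bar>?R $$ (a, b)\<bar>) + 1"
  have c: "0 < c" unfolding c_def by (intro add_nonneg_pos sum_nonneg) auto
  have "\<bar>u $ a\<bar> \<le> c * B" if u: "u \<in> carrier_vec N" and B: "\<And>a. a < N \<Longrightarrow> \<bar>(Q *\<^sub>v u) $ a\<bar> \<le> B" and a: "a < N" for u B a
  proof -
    have B0: "0 \<le> B" using B[OF a] by linarith
    have Qu: "Q *\<^sub>v u \<in> carrier_vec N" using Q u by simp
    have "u = (?R * Q) *\<^sub>v u" using R u by simp
    also have "\<dots> = ?R *\<^sub>v (Q *\<^sub>v u)" by (rule assoc_mult_mat_vec[OF R(1) Q u])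
    finally have "u $ a = (\<Sum>b<N. ?R $$ (a, b) * (Q *\<^sub>v u) $ b)"
      using mult_mat_vec_index_sum[OF R(1) Qu a] by simp
    then have "\<bar>u $ a\<bar> \<le> (\<Sum>b<N. \<bar>?R $$ (a, b) * (Q *\<^sub>v u) $ b\<bar>)" using sum_abs by metis
    also have "\<dots> \<le> (\<Sum>b<N. \<bar>?R $$ (a, b)\<bar> * B)" using B by (intro sum_mono) (auto simp: abs_mult intro: mult_left_mono)
    also have "\<dots> = (\<Sum>b<N. \<bar>?R $$ (a, b)\<bar>) * B" by (simp add: sum_distrib_right)
    also have "\<dots> \<le> c * B"
    proof (intro mult_right_mono B0)
      have "(\<Sum>b<N. \<bar>?R $$ (a, b)\<bar>) \<le> (\<Sum>a<N. \<Sum>b<N. \<bar>?R $$ (a, b)\<bar>)"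
        using a by (intro member_le_sum[of a "{..<N}" "\<lambda>a. \<Sum>b<N. \<bar>?R $$ (a, b)\<bar>"]) (auto intro: sum_nonneg)
      then show "(\<Sum>b<N. \<bar>?R $$ (a, b)\<bar>) \<le> c" unfolding c_def by simp
    qed
    finally show ?thesis .
  qed
  then have "inverse_bounded N Q c" unfolding inverse_bounded_def by blast
  then show ?thesis using that[OF c] by blast
qed

text \<open>
  A matrix close to \<open>s Q\<close> inherits the bound on the inverse of \<open>Q\<close> up to a factor two, because the perturbation is
  absorbed at a component where \<open>u\<close> is largest. The case \<open>B = 0\<close> shows that such a matrix is injective.
\<close>

lemma perturbed_inverse_bound:
  fixes s :: real
  assumes Q: "Q \<in> carrier_mat N N" and A: "A \<in> carrier_mat N N" and c: "0 < c"
    and bound: "inverse_bounded N Q c"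
    and s: "0 < s" and close: "\<And>a b. a < N \<Longrightarrow> b < N \<Longrightarrow> \<bar>A $$ (a, b) - s * Q $$ (a, b)\<bar> \<le> E"
    and E: "2 * c * real N * E \<le> s"
    and u: "u \<in> carrier_vec N" and Au: "\<And>a. a < N \<Longrightarrow> \<bar>(A *\<^sub>v u) $ a\<bar> \<le> B" and a: "a < N"
  shows "\<bar>u $ a\<bar> \<le> 2 * c * B / s"
proof -
  define U where "U = Max ((\<lambda>a. \<bar>u $ a\<bar>) ` {..<N})"
  have ne: "{..<N} \<noteq> {}" using a by auto
  have U: "\<bar>u $ b\<bar> \<le> U" if "b < N" for b unfolding U_def using that by (intro Max_ge) auto
  have "U \<in> (\<lambda>a. \<bar>u $ a\<bar>) ` {..<N}" unfolding U_def using ne by (intro Max_in) auto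
  then obtain k where k: "k < N" "U = \<bar>u $ k\<bar>" by auto
  have E0: "0 \<le> E" using close[OF a a] by linarith
  have "\<bar>(Q *\<^sub>v u) $ b\<bar> \<le> (B + real N * E * U) / s" if b: "b < N" for b
  proof -
    have "s * (Q *\<^sub>v u) $ b = (A *\<^sub>v u) $ b - (\<Sum>j<N. (A $$ (b, j) - s * Q $$ (b, j)) * u $ j)"
      unfolding mult_mat_vec_index_sum[OF Q u b] mult_mat_vec_index_sum[OF A u b]
      by (simp add: sum_subtractf left_diff_distrib sum_distrib_left mult.assoc)
    moreover have "\<bar>\<Sum>j<N. (A $$ (b, j) - s * Q $$ (b, j)) * u $ j\<bar> \<le> real N * E * U"
    proof -
      have "\<bar>\<Sum>j<N. (A $$ (b, j) - s * Q $$ (b, j)) * u $ j\<bar> \<le> (\<Sum>j<N. \<bar>(A $$ (b, j) - s * Q $$ (b, j)) * u $ j\<bar>)" by (rule sum_abs)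
      also have "\<dots> \<le> (\<Sum>j<N. E * U)" unfolding abs_mult using close b U E0 by (intro sum_mono mult_mono) auto
      finally show ?thesis by simp
    qed
    ultimately have "\<bar>s * (Q *\<^sub>v u) $ b\<bar> \<le> B + real N * E * U" using Au[OF b] by linarith
    then show ?thesis using s by (simp add: abs_mult pos_le_divide_eq mult.commute)
  qed
  then have "\<bar>u $ k\<bar> \<le> c * ((B + real N * E * U) / s)" using bound u k(1) unfolding inverse_bounded_def by blast
  then have "U \<le> c * ((B + real N * E * U) / s)" using k by simp
  then have "U * s \<le> c * B + (c * real N * E) * U" using s by (simp add: field_simps)
  also have "(c * real N * E) * U \<le> s / 2 * U" using E U[OF a] by (intro mult_right_mono) auto
  finally have "U * s \<le> 2 * c * B" by (simp add: field_simps)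
  then have "U \<le> 2 * c * B / s" using s by (simp add: pos_le_divide_eq)
  then show ?thesis using U[OF a] by linarith
qed

context stable_inar
begin

text \<open>
  The second moments of the extended state vector; index \<open>p\<close> belongs to its constant component.
\<close>

definition moment_matrix :: "real \<Rightarrow> (nat \<Rightarrow> real) \<Rightarrow> real mat" where
  "moment_matrix m c = mat (p + 1) (p + 1) (\<lambda>(a, b).
    if a < p \<and> b < p then c (nat \<bar>int a - int b\<bar>) else if a < p \<or> b < p then m else 1)"

definition true_param :: "real \<Rightarrow> real vec" where
  "true_param \<mu> = vec (p + 1) (\<lambda>a. if a < p then \<alpha> (a + 1) else \<mu>)"

lemma moment_matrix_carrier [simp]: "moment_matrix m c \<in> carrier_mat (p + 1) (p + 1)"
  unfolding moment_matrix_def by simp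

lemma true_param_carrier [simp]: "true_param \<mu> \<in> carrier_vec (p + 1)"
  unfolding true_param_def by simp

text \<open>
  The Yule-Walker equations, read as the normal equations of the best linear prediction of the next value.
\<close>

lemma moment_matrix_true_param:
  assumes yw: "yule_walker_solution \<mu> v m c" and a: "a < p + 1"
  shows "(moment_matrix m c *\<^sub>v true_param \<mu>) $ a = (if a < p then c (a + 1) else m)"
proof -
  have m: "m = (\<Sum>i=1..p. \<alpha> i) * m + \<mu>" and cd: "\<And>d. d \<in> {1..p} \<Longrightarrow> c d = (\<Sum>i=1..p. \<alpha> i * c (nat \<bar>int i - int d\<bar>)) + \<mu> * m"
    using yw unfolding yule_walker_solution_def by auto
  have "(moment_matrix m c *\<^sub>v true_param \<mu>) $ a = (\<Sum>b<p. moment_matrix m c $$ (a, b) * \<alpha> (b + 1)) + moment_matrix m c $$ (a, p) * \<mu>"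
    unfolding mult_mat_vec_index_sum[OF moment_matrix_carrier true_param_carrier a] by (simp add: true_param_def)
  also have "(\<Sum>b<p. moment_matrix m c $$ (a, b) * \<alpha> (b + 1)) = (\<Sum>i=1..p. moment_matrix m c $$ (a, i - 1) * \<alpha> i)"
    using sum.atLeast1_atMost_eq[of "\<lambda>i. moment_matrix m c $$ (a, i - 1) * \<alpha> i" p] by simp
  also have "\<dots> + moment_matrix m c $$ (a, p) * \<mu> = (if a < p then c (a + 1) else m)"
  proof (cases "a < p")
    case True
    have "moment_matrix m c $$ (a, i - 1) * \<alpha> i = \<alpha> i * c (nat \<bar>int i - int (a + 1)\<bar>)" if "i \<in> {1..p}" for i
    proof -
      have "moment_matrix m c $$ (a, i - 1) = c (nat \<bar>int a - int (i - 1)\<bar>)"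
        using True that unfolding moment_matrix_def by (subst index_mat) auto
      also have "\<bar>int a - int (i - 1)\<bar> = \<bar>int i - int (a + 1)\<bar>" using that by auto
      finally show ?thesis by simp
    qed
    then have "(\<Sum>i=1..p. moment_matrix m c $$ (a, i - 1) * \<alpha> i) = (\<Sum>i=1..p. \<alpha> i * c (nat \<bar>int i - int (a + 1)\<bar>))"
      by (rule sum.cong[OF refl])
    then show ?thesis using cd[of "a + 1"] True unfolding moment_matrix_def by simp
  next
    case False
    then have ap: "a = p" using a by simp
    have "moment_matrix m c $$ (p, i - 1) = m" if "i \<in> {1..p}" for i
    proof -
      have "i - 1 < p" using that by auto
      then show ?thesis unfolding moment_matrix_def by simp
    qed
    then have "(\<Sum>i=1..p. moment_matrix m c $$ (a, i - 1) * \<alpha> i) = (\<Sum>i=1..p. m * \<alpha> i)"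
      unfolding ap by (intro sum.cong refl arg_cong2[where f = "(*)"])
    then show ?thesis using m unfolding ap moment_matrix_def by (simp add: sum_distrib_left mult.commute)
  qed
  finally show ?thesis .
qed

end

context stationary_inar
begin

lemma yule_walker_solution: "yule_walker_solution \<mu> (innov_var F) m lag_product"
  unfolding yule_walker_solution_def using stationary_mean yule_walker yule_walker_variance by blast

lemma state_dimension: "x \<in> set_pmf \<pi> \<Longrightarrow> dim_vec x = p"
  using stat unfolding inar_stationary_def carrier_vec_def by auto

lemma second_moment_eq: "second_moment p \<pi> = moment_matrix m lag_product"
proof (rule eq_matI)
  fix a b assume "a < dim_row (moment_matrix m lag_product)" "b < dim_col (moment_matrix m lag_product)"
  then have ab: "a < p + 1" "b < p + 1" unfolding moment_matrix_def by auto
  let ?r = "\<lambda>x a. if a < p then real (x $ a) else 1"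
  have "second_moment p \<pi> $$ (a, b) = E (\<lambda>x. ?r x a * ?r x b)"
    unfolding second_moment_def using ab
    by (auto intro!: integral_cong_AE simp: AE_measure_pmf_iff regressor_def state_dimension)
  also have "\<dots> = moment_matrix m lag_product $$ (a, b)"
    unfolding moment_matrix_def using ab product_eq_lag_product mean_component by simp
  finally show "second_moment p \<pi> $$ (a, b) = moment_matrix m lag_product $$ (a, b)" .
qed (auto simp: second_moment_def moment_matrix_def)

lemma second_moment_pos_def:
  assumes nondeg: "(\<Sum>i=1..p. \<alpha> i) > 0 \<or> innov_var F > 0" and \<mu>: "\<mu> > 0"
  shows "pos_def (p + 1) (second_moment p \<pi>)"
  unfolding pos_def_def
proof (intro conjI ballI impI)
  let ?C = "second_moment p \<pi>"
  show C: "?C \<in> carrier_mat (p + 1) (p + 1)" unfolding second_moment_def by simp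
  fix v :: "real vec" assume v: "v \<in> carrier_vec (p + 1)" "v \<noteq> 0\<^sub>v (p + 1)"
  let ?r = "\<lambda>x a. if a < p then real (x $ a) else 1"
  let ?L = "\<lambda>x. (\<Sum>a<p. v $ a * real (x $ a)) + v $ p"
  have ent: "?C $$ (a, b) = E (\<lambda>x. ?r x a * ?r x b)" if "a < p + 1" "b < p + 1" for a b
    unfolding second_moment_def using that
    by (auto intro!: integral_cong_AE simp: AE_measure_pmf_iff regressor_def state_dimension)
  have int: "integrable \<pi> (\<lambda>x. ?r x a * ?r x b)" for a b
    
    using integrable_product[of a b] integrable_component[of a] integrable_component[of b]
    by (cases "a < p"; cases "b < p") auto
  have "v \<bullet> (?C *\<^sub>v v) = (\<Sum>a<p + 1. v $ a * (\<Sum>b<p + 1. ?C $$ (a, b) * v $ b))"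
  proof -
    have "?C *\<^sub>v v \<in> carrier_vec (p + 1)" using C v(1) by simp
    from scalar_prod_sum[OF this, of v] show ?thesis
      by (simp only:, intro sum.cong refl arg_cong2[where f = "(*)"] mult_mat_vec_index_sum[OF C v(1)]) auto
  qed
  also have "\<dots> = (\<Sum>a<p + 1. \<Sum>b<p + 1. E (\<lambda>x. v $ a * v $ b * (?r x a * ?r x b)))"
    by (auto intro!: sum.cong simp del: sum.lessThan_Suc simp: sum_distrib_left ent mult.assoc) 
  also have "\<dots> = (\<Sum>a<p + 1. E (\<lambda>x. \<Sum>b<p + 1. v $ a * v $ b * (?r x a * ?r x b)))"
    by (intro sum.cong refl Bochner_Integration.integral_sum[symmetric] integrable_mult_right int)
  also have "\<dots> = E (\<lambda>x. \<Sum>a<p + 1. \<Sum>b<p + 1. v $ a * v $ b * (?r x a * ?r x b))"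
    by (intro Bochner_Integration.integral_sum[symmetric] Bochner_Integration.integrable_sum integrable_mult_right int)
  also have "\<dots> = E (\<lambda>x. ?L x ^ 2)"
  proof (intro arg_cong[where f = E] ext)
    fix x
    have "?L x = (\<Sum>a<p + 1. v $ a * ?r x a)" by simp
    then have "?L x ^ 2 = (\<Sum>a<p + 1. v $ a * ?r x a) * (\<Sum>b<p + 1. v $ b * ?r x b)" by (simp add: power2_eq_square)
    also have "\<dots> = (\<Sum>a<p + 1. \<Sum>b<p + 1. v $ a * v $ b * (?r x a * ?r x b))"
      unfolding sum_product by (intro sum.cong refl) simp
    finally show "(\<Sum>a<p + 1. \<Sum>b<p + 1. v $ a * v $ b * (?r x a * ?r x b)) = ?L x ^ 2" by simp
  qed
  finally have eq: "v \<bullet> (?C *\<^sub>v v) = E (\<lambda>x. ?L x ^ 2)" .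
  have ne: "E (\<lambda>x. ?L x ^ 2) \<noteq> 0"
  proof
    assume 0: "E (\<lambda>x. ?L x ^ 2) = 0"
    have "v $ a = 0" if "a < p + 1" for a
      using affine_zero[OF nondeg \<mu> 0] that by (cases "a < p") (auto simp: less_Suc_eq)
    then have "v = 0\<^sub>v (p + 1)" using v(1) by (intro eq_vecI) auto
    then show False using v(2) by simp
  qed
  have nn: "0 \<le> E (\<lambda>x. ?L x ^ 2)" by (intro integral_nonneg_AE) auto
  show "0 < v \<bullet> (?C *\<^sub>v v)" unfolding eq using le_neq_trans[OF nn ne[symmetric]] .
qed

end

section \<open>Residuals along a path with small fluctuations\<close>

lemma state_regressor:
  assumes "a < p + 1"
  shows "regressor (state p X (int k - 1) \<omega>) $ a = (if a < p then real (X (int k - int (a + 1)) \<omega>) else 1)"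
  using assms unfolding regressor_def state_def by (auto simp: algebra_simps)

context changing_inar
begin

text \<open>
  Under the bounds of \<open>good_path_averages\<close> the least squares matrix and vector divided by \<open>n\<close> are close to \<open>Q\<close> and \<open>Q \<theta>0\<close>,
  so the matrix is invertible and the estimator is close to \<open>\<theta>0\<close>. The cumulated residuals are then close to the
  function \<open>h\<close>, which increases up to the change point and decreases afterwards. The slope after the change is
  computed from \<open>\<theta>0\<close>; the slope before it follows from the last normal equation, which says that \<open>h\<close> would return to zero if
  the change occurred at the exact fraction \<open>\<rho>\<close>.
\<close>

lemma residual_max_approx:
  fixes \<rho> :: real
  assumes yw': "yule_walker_solution (innov_mean F') (innov_var F') m' c'"
    and yw'': "yule_walker_solution (innov_mean F'') (innov_var F'') m'' c''"
    and pd': "pos_def (p + 1) (moment_matrix m' c')" and pd'': "pos_def (p + 1) (moment_matrix m'' c'')"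
    and \<rho>: "0 < \<rho>" "\<rho> < 1" and change: "innov_mean F'' < innov_mean F'" and K: "0 \<le> K"
  defines "Q \<equiv> \<rho> \<cdot>\<^sub>m moment_matrix m' c' + (1 - \<rho>) \<cdot>\<^sub>m moment_matrix m'' c''"
  defines "\<psi> \<equiv> \<rho> * (1 - \<rho>) * (innov_mean F' - innov_mean F'') *
      (unit_vec (p + 1) p \<bullet> ((moment_matrix m'' c'' * inverse_mat Q * moment_matrix m' c') *\<^sub>v unit_vec (p + 1) p))"
  shows "0 < \<psi>"
    and "\<exists>K2 c0. 0 \<le> K2 \<and> 0 \<le> c0 \<and> (\<forall>n t r x \<theta>. 1 \<le> n \<longrightarrow> 1 \<le> t \<longrightarrow> t \<le> n \<longrightarrow> \<bar>real t - real n * \<rho>\<bar> \<le> 1 \<longrightarrow>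
      sqrt (real n) \<le> r \<longrightarrow> r \<le> real n \<longrightarrow> c0 * r \<le> real n \<longrightarrow>
      (\<forall>k\<in>grid n t. fluctuation (regime t) k x < (K * r) ^ 2) \<longrightarrow>
      \<theta> x \<in> carrier_vec (p + 1) \<longrightarrow>
      (invertible_mat (Q_matrix p n (\<lambda>j x. x j) x) \<longrightarrow>
        \<theta> x = inverse_mat (Q_matrix p n (\<lambda>j x. x j) x) *\<^sub>v XY_vector p n (\<lambda>j x. x j) x) \<longrightarrow>
      \<bar>(MAX k\<in>{1..n}. \<Sum>j=1..k. residual p (\<lambda>j x. x j) \<theta> j x) - real n * \<psi>\<bar> \<le> K2 * r)" (is ?approximation)
proof -
  let ?N = "p + 1" and ?e = "unit_vec (p + 1) p :: real vec"
  let ?C' = "moment_matrix m' c'" and ?C'' = "moment_matrix m'' c''"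
  let ?\<Delta> = "innov_mean F' - innov_mean F''"
  have C: "?C' \<in> carrier_mat ?N ?N" "?C'' \<in> carrier_mat ?N ?N" by (rule moment_matrix_carrier)+
  have pdQ: "pos_def ?N Q" unfolding Q_def by (rule pos_def_mixture[OF pd' pd'' \<rho>])
  then have Q: "Q \<in> carrier_mat ?N ?N" unfolding pos_def_def by simp
  note Qinv = inverse_mat_correct[OF Q pos_def_injective[OF pdQ]]
  have e: "?e \<in> carrier_vec ?N" "?e \<noteq> 0\<^sub>v ?N" by auto
  define v where "v = inverse_mat Q *\<^sub>v (?C' *\<^sub>v ?e)"
  have C'e: "?C' *\<^sub>v ?e \<in> carrier_vec ?N" using mult_mat_vec_carrier[OF C(1) e(1)] .
  have v: "v \<in> carrier_vec ?N" unfolding v_def using mult_mat_vec_carrier[OF Qinv(1) C'e] .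
  have Qv: "Q *\<^sub>v v = ?C' *\<^sub>v ?e"
    unfolding v_def using assoc_mult_mat_vec[OF Q Qinv(1) C'e] Qinv(2) C'e by simp
  define \<kappa> where "\<kappa> = (?C'' *\<^sub>v v) $ p"
  have C''v: "?C'' *\<^sub>v v \<in> carrier_vec ?N" using mult_mat_vec_carrier[OF C(2) v] .
  have scal: "?e \<bullet> (?C'' *\<^sub>v v) = \<kappa>" unfolding \<kappa>_def using C''v by simp
  have "(?C'' * inverse_mat Q * ?C') *\<^sub>v ?e = ?C'' *\<^sub>v v"
    unfolding v_def using assoc_mult_mat_vec[OF mult_carrier_mat[OF C(2) Qinv(1)] C(1) e(1)] assoc_mult_mat_vec[OF C(2) Qinv(1) C'e] by simp
  then have \<psi>\<kappa>: "\<psi> = \<rho> * (1 - \<rho>) * ?\<Delta> * \<kappa>" unfolding \<psi>_def using scal by simp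
  have "0 < ?e \<bullet> (?C'' *\<^sub>v v)"
    by (rule parallel_sum_positive[OF pd' pd'' \<rho> e v Qv[unfolded Q_def]])
  then have \<kappa>pos: "0 < \<kappa>" using scal by simp
  show \<psi>pos: "0 < \<psi>" unfolding \<psi>\<kappa> using \<rho> change \<kappa>pos by simp
  have m': "m' = (\<Sum>i=1..p. \<alpha> i) * m' + innov_mean F'" and m'': "m'' = (\<Sum>i=1..p. \<alpha> i) * m'' + innov_mean F''"
    using yw' yw'' unfolding yule_walker_solution_def by auto
  have mm: "0 \<le> m'" "0 \<le> m''" using yule_walker_mean_nonneg yw' yw'' by blast+
  \<comment> \<open>The limit of the estimator; it solves \<open>Q \<theta>0 = \<rho> C' \<theta>' + (1 - \<rho>) C'' \<theta>''\<close>, whose components are \<open>L\<close>.\<close>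
  define \<theta>0 where "\<theta>0 = true_param (innov_mean F'') + (\<rho> * ?\<Delta>) \<cdot>\<^sub>v v"
  have \<theta>0: "\<theta>0 \<in> carrier_vec ?N" unfolding \<theta>0_def
    by (intro add_carrier_vec true_param_carrier smult_carrier_vec[THEN iffD2, OF v])
  define L where "L a = (if a < p then \<rho> * c' (a + 1) + (1 - \<rho>) * c'' (a + 1) else \<rho> * m' + (1 - \<rho>) * m'')" for a
  have Q\<theta>0: "(Q *\<^sub>v \<theta>0) $ a = L a" if a: "a < ?N" for a
  proof -
    have tp: "true_param (innov_mean F') = true_param (innov_mean F'') + ?\<Delta> \<cdot>\<^sub>v ?e"
      unfolding true_param_def by (intro eq_vecI) auto
    let ?t' = "true_param (innov_mean F')" and ?t'' = "true_param (innov_mean F'')"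
    have t: "?t' \<in> carrier_vec ?N" "?t'' \<in> carrier_vec ?N" by (rule true_param_carrier)+
    have "Q *\<^sub>v \<theta>0 = Q *\<^sub>v ?t'' + (\<rho> * ?\<Delta>) \<cdot>\<^sub>v (?C' *\<^sub>v ?e)"
      unfolding \<theta>0_def using mult_add_distrib_mat_vec[OF Q t(2) smult_carrier_vec[THEN iffD2, OF v]] mult_mat_vec[OF Q v] Qv by simp
    then have "(Q *\<^sub>v \<theta>0) $ a = \<rho> * (?C' *\<^sub>v ?t'') $ a + (1 - \<rho>) * (?C'' *\<^sub>v ?t'') $ a + \<rho> * ?\<Delta> * (?C' *\<^sub>v ?e) $ a"
      using a C C'e t unfolding Q_def mixture_mult_vec[OF C t(2)] by auto
    also have "\<dots> = \<rho> * (?C' *\<^sub>v ?t') $ a + (1 - \<rho>) * (?C'' *\<^sub>v ?t'') $ a"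
    proof -
      have "?C' *\<^sub>v ?t' = ?C' *\<^sub>v ?t'' + ?\<Delta> \<cdot>\<^sub>v (?C' *\<^sub>v ?e)"
        unfolding tp using mult_add_distrib_mat_vec[OF C(1) t(2) smult_carrier_vec[THEN iffD2, OF e(1)]] mult_mat_vec[OF C(1) e(1)] by simp
      then have f: "(?C' *\<^sub>v ?t') $ a = (?C' *\<^sub>v ?t'') $ a + ?\<Delta> * (?C' *\<^sub>v ?e) $ a"
        using a C C'e t by auto
      show ?thesis unfolding f by (simp add: algebra_simps)
    qed
    also have "\<dots> = L a"
      unfolding moment_matrix_true_param[OF yw' a] moment_matrix_true_param[OF yw'' a] L_def by simp
    finally show ?thesis .
  qed
  let ?\<sigma> = "\<Sum>a<p. \<theta>0 $ a"
  define s' where "s' = m' * (1 - ?\<sigma>) - \<theta>0 $ p"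
  define s'' where "s'' = m'' * (1 - ?\<sigma>) - \<theta>0 $ p"
  have last_row: "(moment_matrix m c *\<^sub>v w) $ p = m * (\<Sum>a<p. w $ a) + w $ p" if "w \<in> carrier_vec ?N" for m c and w :: "real vec"
    using mult_mat_vec_index_sum[OF moment_matrix_carrier that, of p] by (simp add: moment_matrix_def sum_distrib_left)
  have s'': "s'' = - (\<psi> / (1 - \<rho>))"
  proof -
    have sum\<theta>: "?\<sigma> = (\<Sum>i=1..p. \<alpha> i) + \<rho> * ?\<Delta> * (\<Sum>a<p. v $ a)"
    proof -
      have "?\<sigma> = (\<Sum>a<p. \<alpha> (Suc a) + \<rho> * ?\<Delta> * v $ a)"
        unfolding \<theta>0_def true_param_def using v by (intro sum.cong) auto
      then show ?thesis using sum.atLeast1_atMost_eq[of \<alpha> p] by (simp add: sum.distrib sum_distrib_left)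
    qed
    have \<theta>p: "\<theta>0 $ p = innov_mean F'' + \<rho> * ?\<Delta> * v $ p" unfolding \<theta>0_def true_param_def using v by auto
    have "s'' = (m'' - (\<Sum>i=1..p. \<alpha> i) * m'' - innov_mean F'') - \<rho> * ?\<Delta> * (m'' * (\<Sum>a<p. v $ a) + v $ p)"
      unfolding s''_def sum\<theta> \<theta>p by (simp add: algebra_simps)
    also have "\<dots> = - (\<rho> * ?\<Delta> * \<kappa>)" unfolding \<kappa>_def last_row[OF v] using m'' by simp
    also have "\<dots> = - (\<psi> / (1 - \<rho>))" unfolding \<psi>\<kappa> using \<rho> by simp
    finally show ?thesis .
  qed
  have s': "s' = \<psi> / \<rho>"
  proof -
    have "L p = \<rho> * (m' * ?\<sigma> + \<theta>0 $ p) + (1 - \<rho>) * (m'' * ?\<sigma> + \<theta>0 $ p)"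
      using Q\<theta>0[of p] C \<theta>0 unfolding Q_def mixture_mult_vec[OF C \<theta>0]
      by (simp add: last_row[OF \<theta>0, of m' c'] last_row[OF \<theta>0, of m'' c''])
    then have "\<rho> * s' + (1 - \<rho>) * s'' = 0" unfolding L_def s'_def s''_def by (simp add: algebra_simps)
    moreover have "(1 - \<rho>) * s'' = - \<psi>" unfolding s'' using \<rho> by simp
    ultimately have "\<rho> * s' = \<psi>" by linarith
    then show ?thesis using \<rho> by (simp add: field_simps)
  qed
  obtain c where c: "0 < c" and Qbound: "inverse_bounded ?N Q c"
    using inverse_bound[OF Q pos_def_injective[OF pdQ]] by blast
  define P where "P = path_const K m' m''"
  define D where "D = (\<Sum>d\<le>p. \<bar>c' d\<bar> + \<bar>c'' d\<bar>) + (m' + m'')"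
  define E where "E = P + D"
  define \<Theta> where "\<Theta> = (\<Sum>a<?N. \<bar>\<theta>0 $ a\<bar>)"
  define B where "B = E + real ?N * E * \<Theta>"
  define H where "H = 2 * c * B"
  define K2 where "K2 = P + real p * ((\<Theta> + H) * P) + real p * (H * (m' + m'')) + H + \<psi> / \<rho>"
  define c0 where "c0 = 2 * c * real ?N * E"
  have P0: "0 \<le> P" unfolding P_def by (rule path_const_nonneg[OF K mm])
  have D0: "0 \<le> D" unfolding D_def using mm by (intro add_nonneg_nonneg sum_nonneg) auto
  have E0: "0 \<le> E" unfolding E_def using P0 D0 by simp
  have \<Theta>0: "0 \<le> \<Theta>" unfolding \<Theta>_def by (intro sum_nonneg) auto
  have B0: "0 \<le> B" unfolding B_def using E0 \<Theta>0 by simp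
  have H0: "0 \<le> H" unfolding H_def using B0 c by simp
  have K20: "0 \<le> K2" unfolding K2_def using P0 \<Theta>0 H0 mm \<psi>pos \<rho> by simp
  have c00: "0 \<le> c0" unfolding c0_def using c E0 by simp
  have main: "\<bar>(MAX k\<in>{1..n}. \<Sum>j=1..k. residual p (\<lambda>j x. x j) \<theta> j x) - real n * \<psi>\<bar> \<le> K2 * r"
    if n: "1 \<le> n" and t: "1 \<le> t" "t \<le> n" "\<bar>real t - real n * \<rho>\<bar> \<le> 1" and r: "sqrt (real n) \<le> r" "r \<le> real n" "c0 * r \<le> real n"
      and small: "\<forall>k\<in>grid n t. fluctuation (regime t) k x < (K * r) ^ 2"
      and \<theta>: "\<theta> x \<in> carrier_vec ?N"
      and est: "invertible_mat (Q_matrix p n (\<lambda>j x. x j) x) \<longrightarrow>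
        \<theta> x = inverse_mat (Q_matrix p n (\<lambda>j x. x j) x) *\<^sub>v XY_vector p n (\<lambda>j x. x j) x"
    for n t r and x :: "int \<Rightarrow> nat" and \<theta>
  proof -
    have r1: "1 \<le> r" using r n by (smt (verit) of_nat_1 of_nat_mono real_sqrt_ge_1_iff)
    let ?x = "\<lambda>j i. real (x (int j - int i))"
    let ?T = "\<lambda>i k. \<Sum>j=1..k. ?x j i"
    note good = good_path_averages[OF yw' yw'' K n t(2) r(1), of x, folded P_def]
    have gP: "\<bar>(\<Sum>j=1..n. ?x j i * ?x j d) - (real t * c' (nat \<bar>int i - int d\<bar>) + real (n - t) * c'' (nat \<bar>int i - int d\<bar>))\<bar> \<le> P * r"
      if "i \<le> p" "d \<le> p" for i d using good(1) small that by blast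
    have gT: "\<bar>?T i k - growth m' m'' t k\<bar> \<le> P * r" if "i \<le> p" "k \<le> n" for i k using good(2) small that by blast
    have gn: "growth m' m'' t n = real t * m' + real (n - t) * m''" unfolding growth_def using t by (simp add: mult.commute)
    have mix: "\<bar>z - real n * (\<rho> * a + (1 - \<rho>) * b)\<bar> \<le> E * r"
      if "\<bar>z - (real t * a + real (n - t) * b)\<bar> \<le> P * r" "\<bar>a\<bar> + \<bar>b\<bar> \<le> D" for z a b
    proof -
      define y where "y = real t * a + real (n - t) * b"
      define w where "w = real n * (\<rho> * a + (1 - \<rho>) * b)"
      have yw: "y - w = (real t - real n * \<rho>) * (a - b)"
        unfolding y_def w_def using t by (simp add: of_nat_diff algebra_simps)
      have "\<bar>(real t - real n * \<rho>) * (a - b)\<bar> \<le> 1 * (\<bar>a\<bar> + \<bar>b\<bar>)"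
        unfolding abs_mult using t(3) by (intro mult_mono) auto
      also have "\<dots> \<le> D" using that(2) by simp
      also have "\<dots> \<le> D * r" using D0 r1 by (simp add: mult_le_cancel_left1)
      finally have "\<bar>y - w\<bar> \<le> D * r" unfolding yw .
      moreover have "\<bar>z - y\<bar> \<le> P * r" using that(1) unfolding y_def .
      moreover have "\<bar>z - w\<bar> \<le> \<bar>z - y\<bar> + \<bar>y - w\<bar>" using abs_triangle_ineq[of "z - y" "y - w"] by simp
      ultimately show ?thesis unfolding E_def w_def[symmetric] distrib_right by linarith
    qed
    have Dc: "\<bar>c' d\<bar> + \<bar>c'' d\<bar> \<le> D" if "d \<le> p" for d
    proof -
      have "\<bar>c' d\<bar> + \<bar>c'' d\<bar> \<le> (\<Sum>d\<le>p. \<bar>c' d\<bar> + \<bar>c'' d\<bar>)"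
        using that by (intro member_le_sum[of d "{..p}" "\<lambda>d. \<bar>c' d\<bar> + \<bar>c'' d\<bar>"]) auto
      then show ?thesis unfolding D_def using mm by linarith
    qed
    have Dm: "\<bar>m'\<bar> + \<bar>m''\<bar> \<le> D" unfolding D_def using mm by (simp add: sum_nonneg)
    have mixP: "\<bar>(\<Sum>j=1..n. ?x j i * ?x j d) - real n * (\<rho> * c' (nat \<bar>int i - int d\<bar>) + (1 - \<rho>) * c'' (nat \<bar>int i - int d\<bar>))\<bar> \<le> E * r"
      if "i \<le> p" "d \<le> p" for i d
    proof -
      have "nat \<bar>int i - int d\<bar> \<le> p" using that by auto
      then show ?thesis by (intro mix gP that Dc)
    qed
    have mixT: "\<bar>?T i n - real n * (\<rho> * m' + (1 - \<rho>) * m'')\<bar> \<le> E * r" if "i \<le> p" for i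
      using gT[OF that order_refl] unfolding gn by (intro mix Dm)
    define A where "A = Q_matrix p n (\<lambda>j x. x j) x"
    define Y where "Y = XY_vector p n (\<lambda>j x. x j) x"
    have A: "A \<in> carrier_mat ?N ?N" unfolding A_def Q_matrix_def by simp
    have Y: "Y \<in> carrier_vec ?N" unfolding Y_def XY_vector_def by simp
    have close: "\<bar>A $$ (a, b) - real n * Q $$ (a, b)\<bar> \<le> E * r" if ab: "a < ?N" "b < ?N" for a b
    proof -
      have Aab: "A $$ (a, b) = (\<Sum>j=1..n. (if a < p then ?x j (a + 1) else 1) * (if b < p then ?x j (b + 1) else 1))"
        unfolding A_def Q_matrix_def using ab by (simp only: index_mat case_prod_conv state_regressor)
      have Qab: "Q $$ (a, b) = \<rho> * ?C' $$ (a, b) + (1 - \<rho>) * ?C'' $$ (a, b)"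
        unfolding Q_def using ab C by auto
      have Er: "0 \<le> E * r" using E0 r1 by simp
      show ?thesis
      proof (cases "a < p"; cases "b < p")
        assume "a < p" "b < p"
        then show ?thesis using mixP[of "a + 1" "b + 1"] ab unfolding Aab Qab moment_matrix_def by simp
      next
        assume "a < p" "\<not> b < p"
        then show ?thesis using mixT[of "a + 1"] ab unfolding Aab Qab moment_matrix_def by simp
      next
        assume "\<not> a < p" "b < p"
        then show ?thesis using mixT[of "b + 1"] ab unfolding Aab Qab moment_matrix_def by simp
      next
        assume "\<not> a < p" "\<not> b < p"
        then show ?thesis using ab Er unfolding Aab Qab moment_matrix_def by simp
      qed
    qed
    have closeY: "\<bar>Y $ a - real n * L a\<bar> \<le> E * r" if a: "a < ?N" for a
    proof -
      have Ya: "Y $ a = (\<Sum>j=1..n. ?x j 0 * (if a < p then ?x j (a + 1) else 1))"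
        unfolding Y_def XY_vector_def using a by (simp only: index_vec state_regressor; simp)
      show ?thesis
      proof (cases "a < p")
        case True
        have lag: "nat \<bar>int 0 - int (a + 1)\<bar> = a + 1" by simp
        show ?thesis using mixP[of 0 "a + 1", unfolded lag] True unfolding Ya L_def by simp
      next
        case False
        then show ?thesis using mixT[of 0] unfolding Ya L_def by simp
      qed
    qed
    have n0: "0 < real n" using n by simp
    have Ebig: "2 * c * real ?N * (E * r) \<le> real n" using r(3) unfolding c0_def by (simp add: mult.assoc)
    have pert: "\<bar>u $ a\<bar> \<le> 2 * c * B / real n" if "u \<in> carrier_vec ?N" "\<And>a. a < ?N \<Longrightarrow> \<bar>(A *\<^sub>v u) $ a\<bar> \<le> B" "a < ?N" for u B a
      by (rule perturbed_inverse_bound[where Q = Q and A = A and N = ?N and c = c and s = "real n" and E = "E * r"];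
          fact Q A c Qbound n0 close Ebig that)
    have injA: "w = 0\<^sub>v ?N" if w: "w \<in> carrier_vec ?N" "A *\<^sub>v w = 0\<^sub>v ?N" for w
    proof (rule eq_vecI)
      fix a assume "a < dim_vec (0\<^sub>v ?N :: real vec)"
      then have a: "a < ?N" by simp
      have "\<bar>w $ a\<bar> \<le> 2 * c * 0 / real n" by (rule pert[OF w(1) _ a]) (use w(2) in simp)
      then show "w $ a = 0\<^sub>v ?N $ a" using a by simp
    qed (use w in simp)
    note Ainv = inverse_mat_correct[OF A injA]
    have \<theta>eq: "\<theta> x = inverse_mat A *\<^sub>v Y" using est Ainv(4) unfolding A_def Y_def by blast
    have A\<theta>: "A *\<^sub>v \<theta> x = Y" unfolding \<theta>eq using assoc_mult_mat_vec[OF A Ainv(1) Y] Ainv(2) Y by simp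
    define u where "u = \<theta> x - \<theta>0"
    have u: "u \<in> carrier_vec ?N" unfolding u_def using \<theta> \<theta>0 by simp
    have Au: "\<bar>(A *\<^sub>v u) $ a\<bar> \<le> B * r" if a: "a < ?N" for a
    proof -
      have "(A *\<^sub>v u) $ a = Y $ a - (A *\<^sub>v \<theta>0) $ a"
        unfolding u_def mult_minus_distrib_mat_vec[OF A \<theta> \<theta>0] A\<theta> using a A \<theta>0 by simp
      also have "(A *\<^sub>v \<theta>0) $ a = real n * L a + (\<Sum>b<?N. (A $$ (a, b) - real n * Q $$ (a, b)) * \<theta>0 $ b)"
        unfolding Q\<theta>0[OF a, symmetric] mult_mat_vec_index_sum[OF A \<theta>0 a] mult_mat_vec_index_sum[OF Q \<theta>0 a]
        by (simp only: left_diff_distrib sum_subtractf sum_distrib_left mult.assoc)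
      finally have eq: "(A *\<^sub>v u) $ a = (Y $ a - real n * L a) - (\<Sum>b<?N. (A $$ (a, b) - real n * Q $$ (a, b)) * \<theta>0 $ b)" by simp
      have "\<bar>\<Sum>b<?N. (A $$ (a, b) - real n * Q $$ (a, b)) * \<theta>0 $ b\<bar> \<le> (\<Sum>b<?N. \<bar>(A $$ (a, b) - real n * Q $$ (a, b)) * \<theta>0 $ b\<bar>)" by (rule sum_abs)
      also have "\<dots> \<le> (\<Sum>b<?N. E * r * \<Theta>)"
      proof (intro sum_mono)
        fix b assume b: "b \<in> {..<?N}"
        have "\<bar>\<theta>0 $ b\<bar> \<le> \<Theta>" unfolding \<Theta>_def using b by (intro member_le_sum) auto
        then show "\<bar>(A $$ (a, b) - real n * Q $$ (a, b)) * \<theta>0 $ b\<bar> \<le> E * r * \<Theta>"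
          unfolding abs_mult using close[OF a, of b] b E0 r1 by (intro mult_mono) auto
      qed
      also have "\<dots> = real ?N * E * \<Theta> * r" by (simp only: sum_constant card_lessThan; simp add: ac_simps)
      finally show ?thesis unfolding eq B_def using closeY[OF a] by (simp add: distrib_right)
    qed
    have u_small: "\<bar>u $ a\<bar> \<le> H * r / real n" if "a < ?N" for a
      using pert[OF u Au that] unfolding H_def by (simp add: mult.assoc)
    have u_le: "\<bar>u $ a\<bar> \<le> H" if "a < ?N" for a
    proof -
      have "H * r / real n \<le> H" using H0 r(2) n0 by (simp add: pos_divide_le_eq mult_left_mono)
      then show ?thesis using u_small[OF that] by linarith
    qed
    have \<theta>a: "\<theta> x $ a = \<theta>0 $ a + u $ a" if "a < ?N" for a unfolding u_def using that \<theta> \<theta>0 by simp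
    have \<theta>_le: "\<bar>\<theta> x $ a\<bar> \<le> \<Theta> + H" if a: "a < ?N" for a
    proof -
      have "\<bar>\<theta>0 $ a\<bar> \<le> \<Theta>" unfolding \<Theta>_def using a by (intro member_le_sum) auto
      then show ?thesis using u_le[OF a] \<theta>a[OF a] by linarith
    qed
    define R where "R k = (\<Sum>j=1..k. residual p (\<lambda>j x. x j) \<theta> j x)" for k
    define h where "h k = s' * real (min k t) + s'' * real (k - min k t)" for k
    have R: "R k = ?T 0 k - (\<Sum>a<p. \<theta> x $ a * ?T (a + 1) k) - \<theta> x $ p * real k" for k
    proof -
      have rc: "regressor y \<in> carrier_vec (dim_vec y + 1)" for y unfolding regressor_def by simp
      have "residual p (\<lambda>j x. x j) \<theta> j x = ?x j 0 - (\<Sum>a<p. \<theta> x $ a * ?x j (a + 1)) - \<theta> x $ p" for j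
      proof -
        have "regressor (state p (\<lambda>j x. x j) (int j - 1) x) \<in> carrier_vec ?N"
          using rc[of "state p (\<lambda>j x. x j) (int j - 1) x"] by (simp add: state_def)
        from scalar_prod_sum[OF this, of "\<theta> x"]
        have "\<theta> x \<bullet> regressor (state p (\<lambda>j x. x j) (int j - 1) x) =
          (\<Sum>a<?N. \<theta> x $ a * (if a < p then ?x j (a + 1) else 1))"
          by (simp only:, intro sum.cong refl arg_cong2[where f = "(*)"] state_regressor[where X = "\<lambda>j x. x j" and \<omega> = x]) auto
        then show ?thesis unfolding residual_def by simp
      qed
      then have "R k = (\<Sum>j=1..k. ?x j 0 - (\<Sum>a<p. \<theta> x $ a * ?x j (a + 1)) - \<theta> x $ p)" unfolding R_def by simp
      also have "\<dots> = ?T 0 k - (\<Sum>j=1..k. \<Sum>a<p. \<theta> x $ a * ?x j (a + 1)) - \<theta> x $ p * real k"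
        by (simp only: sum_subtractf; simp)
      also have "(\<Sum>j=1..k. \<Sum>a<p. \<theta> x $ a * ?x j (a + 1)) = (\<Sum>a<p. \<theta> x $ a * ?T (a + 1) k)"
        by (subst sum.swap) (simp only: sum_distrib_left)
      finally show ?thesis .
    qed
    have h: "h k = growth m' m'' t k * (1 - ?\<sigma>) - \<theta>0 $ p * real k" for k
    proof -
      have "real k = real (min k t) + real (k - min k t)" by simp
      then show ?thesis unfolding h_def s'_def s''_def growth_def by (simp add: algebra_simps)
    qed
    have Rh: "\<bar>R k - h k\<bar> \<le> (K2 - \<psi> / \<rho>) * r" if k: "k \<le> n" for k
    proof -
      let ?g = "growth m' m'' t k"
      have "min k t \<le> n" "k - min k t \<le> n" using k by auto
      then have gk: "0 \<le> ?g" "?g \<le> (m' + m'') * real n"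
        unfolding growth_def distrib_right using mm by (auto intro!: add_mono mult_left_mono)
      have eq: "R k - h k = (?T 0 k - ?g) - (\<Sum>a<p. \<theta> x $ a * (?T (a + 1) k - ?g)) - (\<Sum>a<p. u $ a * ?g) - u $ p * real k"
      proof -
        have 1: "(\<Sum>a<p. \<theta> x $ a * (?T (a + 1) k - ?g)) = (\<Sum>a<p. \<theta> x $ a * ?T (a + 1) k) - (\<Sum>a<p. \<theta> x $ a) * ?g"
          by (simp only: right_diff_distrib sum_subtractf sum_distrib_right)
        have 2: "(\<Sum>a<p. \<theta> x $ a) = ?\<sigma> + (\<Sum>a<p. u $ a)"
          unfolding sum.distrib[symmetric] by (intro sum.cong refl \<theta>a) auto
        have 3: "(\<Sum>a<p. u $ a * ?g) = (\<Sum>a<p. u $ a) * ?g" by (rule sum_distrib_right[symmetric])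
        have 4: "\<theta> x $ p = \<theta>0 $ p + u $ p" by (rule \<theta>a) simp
        show ?thesis unfolding R h 1 2 3 4 by (simp add: algebra_simps)
      qed
      have b1: "\<bar>?T 0 k - ?g\<bar> \<le> P * r" by (rule gT[OF le0 k])
      have b2: "\<bar>\<Sum>a<p. \<theta> x $ a * (?T (a + 1) k - ?g)\<bar> \<le> real p * ((\<Theta> + H) * (P * r))"
      proof -
        have "\<bar>\<Sum>a<p. \<theta> x $ a * (?T (a + 1) k - ?g)\<bar> \<le> (\<Sum>a<p. \<bar>\<theta> x $ a * (?T (a + 1) k - ?g)\<bar>)" by (rule sum_abs)
        also have "\<dots> \<le> (\<Sum>a<p. (\<Theta> + H) * (P * r))"
        proof (intro sum_mono)
          fix a assume a: "a \<in> {..<p}"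
          then have "\<bar>?T (a + 1) k - ?g\<bar> \<le> P * r" by (intro gT k) auto
          then show "\<bar>\<theta> x $ a * (?T (a + 1) k - ?g)\<bar> \<le> (\<Theta> + H) * (P * r)"
            unfolding abs_mult using \<theta>_le[of a] a \<Theta>0 H0 by (intro mult_mono) auto
        qed
        finally show ?thesis by simp
      qed
      have b3: "\<bar>\<Sum>a<p. u $ a * ?g\<bar> \<le> real p * (H * (m' + m'') * r)"
      proof -
        have "\<bar>\<Sum>a<p. u $ a * ?g\<bar> \<le> (\<Sum>a<p. \<bar>u $ a * ?g\<bar>)" by (rule sum_abs)
        also have "\<dots> \<le> (\<Sum>a<p. H * r / real n * ((m' + m'') * real n))"
          unfolding abs_mult using u_small gk H0 r1 by (intro sum_mono mult_mono) auto
        also have "\<dots> = real p * (H * (m' + m'') * r)" using n0 by simp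
        finally show ?thesis .
      qed
      have b4: "\<bar>u $ p * real k\<bar> \<le> H * r"
      proof -
        have "\<bar>u $ p * real k\<bar> \<le> H * r / real n * real n"
          unfolding abs_mult using u_small[of p] k H0 r1 by (intro mult_mono) auto
        then show ?thesis using n0 by simp
      qed
      have "\<bar>R k - h k\<bar> \<le> P * r + real p * ((\<Theta> + H) * (P * r)) + real p * (H * (m' + m'') * r) + H * r"
        unfolding eq using b1 b2 b3 b4 by linarith
      also have "\<dots> = (K2 - \<psi> / \<rho>) * r" unfolding K2_def by (simp add: algebra_simps)
      finally show ?thesis .
    qed
    have ht: "h t = real t * (\<psi> / \<rho>)" unfolding h_def s' by simp
    have h_le: "h k \<le> h t" for k
    proof -
      have "s' * real (min k t) \<le> s' * real t" unfolding s' using \<psi>pos \<rho> by (intro mult_left_mono) auto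
      moreover have "s'' * real (k - min k t) \<le> 0" unfolding s'' using \<psi>pos \<rho> by (simp add: mult_nonneg_nonneg)
      ultimately show ?thesis unfolding h_def by simp
    qed
    have htn: "\<bar>h t - real n * \<psi>\<bar> \<le> \<psi> / \<rho> * r"
    proof -
      have "h t - real n * \<psi> = (real t - real n * \<rho>) * (\<psi> / \<rho>)" unfolding ht using \<rho> by (simp add: field_simps)
      then have "\<bar>h t - real n * \<psi>\<bar> \<le> 1 * (\<psi> / \<rho>)"
        using t(3) \<psi>pos \<rho> by (simp only: abs_mult) (intro mult_mono, auto)
      also have "\<dots> \<le> \<psi> / \<rho> * r" using mult_left_mono[OF r1, of "\<psi> / \<rho>"] \<psi>pos \<rho> by simp
      finally show ?thesis .
    qed
    let ?M = "MAX k\<in>{1..n}. R k"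
    have ne: "{1..n} \<noteq> {}" using n by simp
    have "R t \<le> ?M" using t by (intro Max_ge) auto
    then have lower: "h t - (K2 - \<psi> / \<rho>) * r \<le> ?M" using Rh[OF t(2)] by linarith
    have "?M \<in> R ` {1..n}" using ne by (intro Max_in) auto
    then obtain k where k: "k \<in> {1..n}" "?M = R k" by auto
    have upper: "?M \<le> h t + (K2 - \<psi> / \<rho>) * r" using Rh[of k] h_le[of k] k by (auto; linarith)
    have "\<bar>?M - real n * \<psi>\<bar> \<le> (K2 - \<psi> / \<rho>) * r + \<psi> / \<rho> * r" using lower upper htn by linarith
    also have "\<dots> = K2 * r" by (simp add: left_diff_distrib)
    finally show ?thesis unfolding R_def .
  qed
  show ?approximation
    using K20 c00 main by blast
qed

end

section \<open>The law of the observed path\<close>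

lemma step_law_cong:
  assumes "\<And>i. i \<in> {1..p} \<Longrightarrow> c i = c' i"
  shows "step_law p \<alpha> F c = step_law p \<alpha> F c'"
proof -
  have "(SIGMA i:{1..p}. {1..c i}) = (SIGMA i:{1..p}. {1..c' i})" using assms by auto
  moreover have "(\<Sum>i=1..p. \<Sum>j=1..c i. b (i, j)) = (\<Sum>i=1..p. \<Sum>j=1..c' i. b (i, j))" for b :: "nat \<times> nat \<Rightarrow> nat"
    using assms by (intro sum.cong) auto
  ultimately show ?thesis unfolding step_law_def by simp
qed

lemma path_law_support:
  assumes "\<And>x j. x \<in> set_pmf I \<Longrightarrow> 0 < j \<Longrightarrow> x j = 0" "x \<in> set_pmf (path_law p \<alpha> I Fs k)" "int k < j"
  shows "x j = 0"
  using assms(2,3)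
proof (induction k arbitrary: x)
  case 0
  then show ?case using assms(1) by simp
next
  case (Suc k)
  then obtain x' y where "x' \<in> set_pmf (path_law p \<alpha> I Fs k)" "x = x'(int (Suc k) := y)" by auto
  then show ?case using Suc.IH[of x'] Suc.prems by auto
qed

text \<open>
  A path determines its past, so conditioning on the path up to time \<open>k\<close> leaves a single term of the mixture.
\<close>

lemma pmf_path_law:
  assumes I: "\<And>x j. x \<in> set_pmf I \<Longrightarrow> 0 < j \<Longrightarrow> x j = 0" and h: "\<And>j. int k < j \<Longrightarrow> h j = 0"
  shows "pmf (path_law p \<alpha> I Fs k) h =
    pmf I (\<lambda>j. if j \<le> 0 then h j else 0) * (\<Prod>j=1..k. pmf (step_law p \<alpha> (Fs j) (\<lambda>i. h (int j - int i))) (h (int j)))"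
  using h
proof (induction k arbitrary: h)
  case 0
  then have "(\<lambda>j. if j \<le> 0 then h j else 0) = h" by (auto simp: fun_eq_iff)
  then show ?case by simp
next
  case (Suc k)
  let ?K = "int (Suc k)" and ?L = "path_law p \<alpha> I Fs k"
  let ?s = "\<lambda>x. step_law p \<alpha> (Fs (Suc k)) (\<lambda>i. x (?K - int i))"
  let ?a = "h(?K := 0)"
  have inner: "pmf (map_pmf (\<lambda>y. x(?K := y)) (?s x)) h = pmf (?s ?a) (h ?K) * indicator {?a} x" if x: "x \<in> set_pmf ?L" for x
  proof (cases "x = ?a")
    case True
    have inj: "inj (\<lambda>y. x(?K := y))" by (auto simp: inj_def fun_eq_iff split: if_splits)
    have "h = x(?K := h ?K)" unfolding True by simp
    then have "pmf (map_pmf (\<lambda>y. x(?K := y)) (?s x)) h = pmf (?s x) (h ?K)"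
      using pmf_map_inj'[OF inj, of "?s x" "h ?K"] by simp
    then show ?thesis using True by simp
  next
    case False
    have "x ?K = 0" by (rule path_law_support[where I = I, OF _ x]) (use I in auto)
    have "h \<noteq> x(?K := y)" for y
    proof
      assume eq: "h = x(?K := y)"
      have "x = ?a" unfolding eq using \<open>x ?K = 0\<close> by (auto simp: fun_eq_iff)
      then show False using False by simp
    qed
    then have "h \<notin> set_pmf (map_pmf (\<lambda>y. x(?K := y)) (?s x))" by auto
    then show ?thesis using False by (simp add: pmf_eq_0_set_pmf)
  qed
  have "pmf (path_law p \<alpha> I Fs (Suc k)) h = (\<integral>x. pmf (?s ?a) (h ?K) * indicator {?a} x \<partial>?L)"
    unfolding path_law.simps pmf_bind using inner by (intro integral_cong_AE) (auto simp: AE_measure_pmf_iff)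
  also have "\<dots> = pmf (?s ?a) (h ?K) * pmf ?L ?a" by (simp add: measure_pmf_single)
  also have "pmf ?L ?a = pmf I (\<lambda>j. if j \<le> 0 then ?a j else 0) * (\<Prod>j=1..k. pmf (step_law p \<alpha> (Fs j) (\<lambda>i. ?a (int j - int i))) (?a (int j)))"
    using Suc.prems by (intro Suc.IH) auto
  also have "(\<lambda>j. if j \<le> 0 then ?a j else 0) = (\<lambda>j. if j \<le> 0 then h j else 0)" by (auto simp: fun_eq_iff)
  also have "(\<Prod>j=1..k. pmf (step_law p \<alpha> (Fs j) (\<lambda>i. ?a (int j - int i))) (?a (int j))) =
     (\<Prod>j=1..k. pmf (step_law p \<alpha> (Fs j) (\<lambda>i. h (int j - int i))) (h (int j)))"
    by (intro prod.cong refl arg_cong2[where f = pmf] step_law_cong) auto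
  also have "?s ?a = step_law p \<alpha> (Fs (Suc k)) (\<lambda>i. h (?K - int i))" by (intro step_law_cong) auto
  finally show ?case by (simp add: ac_simps)
qed

lemma measurable_nat_sum:
  fixes f :: "'i \<Rightarrow> 'b \<Rightarrow> nat"
  assumes "\<And>a. a \<in> A \<Longrightarrow> f a \<in> measurable N (count_space UNIV)"
  shows "(\<lambda>x. \<Sum>a\<in>A. f a x) \<in> measurable N (count_space UNIV)"
  using assms
proof (induction A rule: infinite_finite_induct)
  case (insert a A)
  have "(\<lambda>x. f a x + (\<Sum>a\<in>A. f a x)) \<in> measurable N (count_space UNIV)"
  proof (rule measurable_compose_countable[where g = "f a"])
    show "(\<lambda>x. i + (\<Sum>a\<in>A. f a x)) \<in> measurable N (count_space UNIV)" for i
      by (rule measurable_compose[of "\<lambda>x. \<Sum>a\<in>A. f a x" N "count_space UNIV" "\<lambda>y. i + y"]) (use insert in auto)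
    show "f a \<in> measurable N (count_space UNIV)" using insert.prems by simp
  qed
  then show ?case using insert.hyps by simp
qed auto

lemma (in prob_space) indep_vars_measurable: "indep_vars M' N I \<Longrightarrow> s \<in> I \<Longrightarrow> N s \<in> measurable M (M' s)"
  unfolding indep_vars_def by blast

lemma (in prob_space) prob_indep_points:
  assumes indep: "indep_vars (\<lambda>_. count_space UNIV) N I" and J: "finite J" "J \<subseteq> I"
    and law: "\<And>s. s \<in> J \<Longrightarrow> distr M (count_space UNIV) (N s) = measure_pmf (P s)"
  shows "prob {\<omega>\<in>space M. \<forall>s\<in>J. N s \<omega> = b s} = (\<Prod>s\<in>J. pmf (P s) (b s))"
proof (cases "J = {}")
  case True
  then show ?thesis by (simp add: prob_space)
next
  case False
  have meas: "N s \<in> measurable M (count_space UNIV)" if "s \<in> J" for s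
    using indep_vars_measurable[OF indep, of s] that J by auto
  have "{\<omega>\<in>space M. \<forall>s\<in>J. N s \<omega> = b s} = (\<Inter>s\<in>J. N s -` {b s} \<inter> space M)" using False by auto
  then have "prob {\<omega>\<in>space M. \<forall>s\<in>J. N s \<omega> = b s} = (\<Prod>s\<in>J. prob (N s -` {b s} \<inter> space M))"
    using indep_varsD[OF indep False J, of "\<lambda>s. {b s}"] by simp
  also have "\<dots> = (\<Prod>s\<in>J. pmf (P s) (b s))"
  proof (intro prod.cong refl)
    fix s assume s: "s \<in> J"
    have "prob (N s -` {b s} \<inter> space M) = measure (distr M (count_space UNIV) (N s)) {b s}"
      using meas[OF s] by (simp add: measure_distr)
    then show "prob (N s -` {b s} \<inter> space M) = pmf (P s) (b s)" unfolding law[OF s] by (simp add: measure_pmf_single)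
  qed
  finally show ?thesis .
qed

lemma countable_PiE_dflt:
  assumes "finite A"
  shows "countable (PiE_dflt A 0 (\<lambda>_. UNIV :: nat set))"
proof (rule countable_subset)
  show "countable ((\<lambda>f a. if a \<in> A then f a else 0) ` (PiE A (\<lambda>_. UNIV :: nat set)))"
    using assms by (intro countable_image countable_PiE) auto
  show "PiE_dflt A 0 (\<lambda>_. UNIV :: nat set) \<subseteq> (\<lambda>f a. if a \<in> A then f a else 0) ` (PiE A (\<lambda>_. UNIV :: nat set))"
  proof
    fix g assume "g \<in> PiE_dflt A 0 (\<lambda>_. UNIV :: nat set)"
    then show "g \<in> (\<lambda>f a. if a \<in> A then f a else 0) ` (PiE A (\<lambda>_. UNIV :: nat set))"
      by (intro image_eqI[where x = "restrict g A"]) (auto simp: PiE_dflt_def fun_eq_iff)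
  qed
qed

lemma noise_indices_iff [simp]:
  "Inl (i, k, l) \<in> noise_indices p n \<longleftrightarrow> i \<in> {1..p} \<and> k \<in> {1..n} \<and> 1 \<le> l"
  "Inr k \<in> noise_indices p n \<longleftrightarrow> k \<in> {1..n}"
  by (auto simp: noise_indices_def)

definition init_law :: "nat \<Rightarrow> nat vec pmf \<Rightarrow> (int \<Rightarrow> nat) pmf" where
  "init_law p G = map_pmf (\<lambda>v j. if - int p < j \<and> j \<le> 0 then v $ nat (- j) else 0) G"

context inar_with_change
begin

definition path :: "nat \<Rightarrow> 'a \<Rightarrow> int \<Rightarrow> nat" where
  "path k \<omega> = (\<lambda>j. if - int p < j \<and> j \<le> int k then X j \<omega> else 0)"

definition innov_law :: "nat \<Rightarrow> nat pmf" where
  "innov_law k = (if k \<le> \<tau> then F' else F'')"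

text \<open>The value of \<open>X k\<close> on the event that the lagged counts are \<open>c\<close>.\<close>

definition response :: "nat \<Rightarrow> (nat \<Rightarrow> nat) \<Rightarrow> 'a \<Rightarrow> nat" where
  "response k c \<omega> = (\<Sum>i=1..p. \<Sum>l=1..c i. \<xi> i k l \<omega>) + \<epsilon> k \<omega>"

lemma noise_measurable: "s \<in> noise_indices p n \<Longrightarrow> noise \<xi> \<epsilon> s \<in> measurable M (count_space UNIV)"
  using indep_vars_measurable[OF noise_indep] by blast

lemma innovation_measurable: "k \<in> {1..n} \<Longrightarrow> \<epsilon> k \<in> measurable M (count_space UNIV)"
  using noise_measurable[of "Inr k"] by (auto simp: noise_def)

text \<open>
  For fixed counts the response is a function of finitely many noise variables, whose joint law is a product.
\<close>

lemma prob_response: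
  assumes k: "k \<in> {1..n}"
  shows "prob {\<omega>\<in>space M. response k c \<omega> = y} = pmf (step_law p \<alpha> (innov_law k) c) y"
proof -
  let ?A = "SIGMA i:{1..p}. {1..c i}" and ?P = "\<lambda>(i, j). bernoulli_nat (\<alpha> i)"
  define Z where "Z \<omega> = ((\<lambda>a. if a \<in> ?A then \<xi> (fst a) k (snd a) \<omega> else 0), \<epsilon> k \<omega>)" for \<omega>
  let ?R = "pair_pmf (Pi_pmf ?A 0 ?P) (innov_law k)"
  let ?\<Omega> = "PiE_dflt ?A 0 (\<lambda>_. UNIV :: nat set) \<times> (UNIV :: nat set)"
  have fin: "finite ?A" by auto
  have cnt: "countable ?\<Omega>" using countable_PiE_dflt[OF fin] by (intro countable_SIGMA) auto
  have Zin: "Z \<omega> \<in> ?\<Omega>" for \<omega> unfolding Z_def PiE_dflt_def by auto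
  have point: "{\<omega>\<in>space M. Z \<omega> = (b, e)} = {\<omega>\<in>space M. (\<forall>s\<in>Inl ` ((\<lambda>(i, l). (i, k, l)) ` ?A) \<union> {Inr k}. noise \<xi> \<epsilon> s \<omega> = case_sum (\<lambda>(i, k, l). b (i, l)) (\<lambda>_. e) s)}"
    if "b \<in> PiE_dflt ?A 0 (\<lambda>_. UNIV :: nat set)" for b e
  proof -
    have "Z \<omega> = (b, e) \<longleftrightarrow> (\<forall>a\<in>?A. \<xi> (fst a) k (snd a) \<omega> = b a) \<and> \<epsilon> k \<omega> = e" for \<omega>
      using that unfolding Z_def PiE_dflt_def by (auto simp: fun_eq_iff)
    then show ?thesis by (auto simp: noise_def)
  qed
  have pointprob: "prob {\<omega>\<in>space M. Z \<omega> = (b, e)} = pmf ?R (b, e)" if b: "b \<in> PiE_dflt ?A 0 (\<lambda>_. UNIV :: nat set)" for b e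
  proof -
    let ?J = "Inl ` ((\<lambda>(i, l). (i, k, l)) ` ?A) \<union> {Inr k}"
    let ?Q = "case_sum (\<lambda>(i, k, l). bernoulli_nat (\<alpha> i)) (\<lambda>k. innov_law k)"
    have J: "finite ?J" "?J \<subseteq> noise_indices p n" using k by auto
    have law: "distr M (count_space UNIV) (noise \<xi> \<epsilon> s) = measure_pmf (?Q s)" if "s \<in> ?J" for s
      using that k thinning_law innovation_law by (auto simp: noise_def innov_law_def)
    have inj: "inj_on Inl ((\<lambda>(i, l). (i, k, l)) ` ?A)" "inj_on (\<lambda>(i, l). (i, k, l)) ?A" by (auto simp: inj_on_def)
    have "prob {\<omega>\<in>space M. Z \<omega> = (b, e)} = (\<Prod>s\<in>?J. pmf (?Q s) (case_sum (\<lambda>(i, k, l). b (i, l)) (\<lambda>_. e) s))"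
      unfolding point[OF b] by (rule prob_indep_points[OF noise_indep J law])
    also have "\<dots> = (\<Prod>a\<in>?A. pmf (?P a) (b a)) * pmf (innov_law k) e"
    proof (subst prod.union_disjoint)
      show "(\<Prod>s\<in>Inl ` (\<lambda>(i, l). (i, k, l)) ` ?A. pmf (?Q s) (case_sum (\<lambda>(i, k, l). b (i, l)) (\<lambda>_. e) s)) *
          (\<Prod>s\<in>{Inr k}. pmf (?Q s) (case_sum (\<lambda>(i, k, l). b (i, l)) (\<lambda>_. e) s)) = (\<Prod>a\<in>?A. pmf (?P a) (b a)) * pmf (innov_law k) e"
        unfolding prod.reindex[OF inj(1)] prod.reindex[OF inj(2)] comp_def by (simp add: case_prod_unfold)
    qed auto
    also have "(\<Prod>a\<in>?A. pmf (?P a) (b a)) = pmf (Pi_pmf ?A 0 ?P) b"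
    proof -
      have "b a = 0" if "a \<notin> ?A" for a using b that unfolding PiE_dflt_def by blast
      then show ?thesis using pmf_Pi'[OF fin, of b 0 ?P] by simp
    qed
    finally show ?thesis by (simp add: pmf_pair)
  qed
  have meas1: "{\<omega>\<in>space M. Z \<omega> = z} \<in> sets M" for z
  proof (cases "z \<in> ?\<Omega>")
    case True
    then obtain b e where z: "z = (b, e)" "b \<in> PiE_dflt ?A 0 (\<lambda>_. UNIV :: nat set)" by auto
    let ?J = "Inl ` ((\<lambda>(i, l). (i, k, l)) ` ?A) \<union> {Inr k}"
    have J: "finite ?J" "?J \<subseteq> noise_indices p n" using k by auto
    have "{\<omega>\<in>space M. \<forall>s\<in>?J. noise \<xi> \<epsilon> s \<omega> = case_sum (\<lambda>(i, k, l). b (i, l)) (\<lambda>_. e) s} \<in> sets M"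
    proof (rule sets.sets_Collect_finite_All[OF _ J(1)])
      fix s assume "s \<in> ?J"
      then have "noise \<xi> \<epsilon> s \<in> measurable M (count_space UNIV)" using noise_measurable J by blast
      from measurable_sets[OF this, of "{case_sum (\<lambda>(i, k, l). b (i, l)) (\<lambda>_. e) s}"]
      show "{\<omega>\<in>space M. noise \<xi> \<epsilon> s \<omega> = case_sum (\<lambda>(i, k, l). b (i, l)) (\<lambda>_. e) s} \<in> sets M"
        by (simp add: vimage_def Int_def conj_commute)
    qed
    then show ?thesis unfolding z(1) point[OF z(2)] .
  next
    case False
    then have empty: "{\<omega>\<in>space M. Z \<omega> = z} = {}" using Zin by auto
    show ?thesis unfolding empty by simp
  qed
  have measZ: "Z \<in> measurable M (count_space UNIV)"
  proof (rule measurableI)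
    fix A
    have "Z -` A \<inter> space M = (\<Union>z\<in>?\<Omega> \<inter> A. {\<omega>\<in>space M. Z \<omega> = z})" using Zin by blast
    also have "\<dots> \<in> sets M" using cnt meas1 by (intro sets.countable_UN') auto
    finally show "Z -` A \<inter> space M \<in> sets M" .
  qed simp
  have lawZ: "distr M (count_space UNIV) Z = measure_pmf ?R"
  proof (rule measure_eqI_countable_AE[OF _ _ _ _ cnt])
    show "AE z in distr M (count_space UNIV) Z. z \<in> ?\<Omega>"
      by (subst AE_distr_iff[OF measZ]) (simp, intro always_eventually allI Zin)
    show "AE z in measure_pmf ?R. z \<in> ?\<Omega>"
      using set_Pi_pmf_subset[OF fin, of 0 ?P] by (auto simp: AE_measure_pmf_iff PiE_dflt_def)
    fix z assume "z \<in> ?\<Omega>"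
    then obtain b e where z: "z = (b, e)" "b \<in> PiE_dflt ?A 0 (\<lambda>_. UNIV :: nat set)" by auto
    have "emeasure (distr M (count_space UNIV) Z) {z} = emeasure M {\<omega>\<in>space M. Z \<omega> = z}"
      by (subst emeasure_distr[OF measZ]) (auto intro!: arg_cong[where f = "emeasure M"])
    also have "\<dots> = ennreal (pmf ?R z)" using pointprob[OF z(2), of e] unfolding z(1) by (simp add: emeasure_eq_measure)
    finally show "emeasure (distr M (count_space UNIV) Z) {z} = emeasure (measure_pmf ?R) {z}"
      by (simp add: emeasure_pmf_single)
  qed auto
  let ?f = "\<lambda>z. (\<Sum>i=1..p. \<Sum>j=1..c i. fst z (i, j)) + snd z"
  have step: "step_law p \<alpha> (innov_law k) c = map_pmf ?f ?R"
    unfolding step_law_def pair_pmf_def by (simp add: map_pmf_def bind_assoc_pmf bind_return_pmf)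
  have "response k c \<omega> = ?f (Z \<omega>)" for \<omega>
    unfolding response_def Z_def fst_conv snd_conv by (intro arg_cong2[where f = "(+)"] sum.cong refl) auto
  then have "prob {\<omega>\<in>space M. response k c \<omega> = y} = prob (Z -` (?f -` {y}) \<inter> space M)"
    by (intro arg_cong[where f = prob]) auto
  also have "\<dots> = measure (distr M (count_space UNIV) Z) (?f -` {y})" using measZ by (simp add: measure_distr)
  also have "\<dots> = pmf (map_pmf ?f ?R) y" unfolding lawZ by (simp add: pmf_map)
  finally show ?thesis unfolding step .
qed

abbreviation "noise_at k \<equiv> {s \<in> noise_indices p n. case s of Inl (i, k', l) \<Rightarrow> k' = k | Inr k' \<Rightarrow> k' = k}"

definition response_of :: "nat \<Rightarrow> (nat \<Rightarrow> nat) \<Rightarrow> (noise_index \<Rightarrow> nat) \<Rightarrow> nat" where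
  "response_of k c f = (\<Sum>i=1..p. \<Sum>l=1..c i. f (Inl (i, k, l))) + f (Inr k)"

lemma response_of_measurable:
  assumes "k \<in> {1..n}" "noise_at k \<subseteq> K"
  shows "response_of k c \<in> measurable (PiM K (\<lambda>_. count_space UNIV)) (count_space UNIV)"
proof -
  have comp: "(\<lambda>f. f s :: nat) \<in> measurable (PiM K (\<lambda>_. count_space UNIV)) (count_space UNIV)" if "s \<in> noise_at k" for s
    using that assms(2) by (intro measurable_component_singleton) auto
  have 1: "(\<lambda>f. \<Sum>i=1..p. \<Sum>l=1..c i. f (Inl (i, k, l)) :: nat) \<in> measurable (PiM K (\<lambda>_. count_space UNIV)) (count_space UNIV)"
    by (rule measurable_nat_sum, rule measurable_nat_sum, rule comp) (use assms(1) in auto)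
  have 2: "(\<lambda>f. f (Inr k) :: nat) \<in> measurable (PiM K (\<lambda>_. count_space UNIV)) (count_space UNIV)"
    using assms(1) by (intro comp) auto
  show ?thesis unfolding response_of_def
    by (rule measurable_compose_countable[OF _ 1]) (rule measurable_compose[OF 2], simp)
qed

lemma response_eq_response_of:
  assumes "k \<in> {1..n}" "noise_at k \<subseteq> K"
  shows "response_of k c (restrict (\<lambda>s. noise \<xi> \<epsilon> s \<omega>) K) = response k c \<omega>"
proof -
  have "Inl (i, k, l) \<in> K" if "i \<in> {1..p}" "l \<in> {1..m}" for i l m
    using assms that by auto
  moreover have "Inr k \<in> K" using assms by auto
  ultimately show ?thesis unfolding response_of_def response_def
    by (intro arg_cong2[where f = "(+)"] sum.cong refl) (auto simp: noise_def)
qed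

lemma responses_indep: "indep_vars (\<lambda>_. count_space UNIV) (\<lambda>k. response k (c k)) {1..n}"
proof -
  have "indep_vars (\<lambda>k. PiM (noise_at k) (\<lambda>_. count_space UNIV)) (\<lambda>k \<omega>. restrict (\<lambda>s. noise \<xi> \<epsilon> s \<omega>) (noise_at k)) {1..n}"
  proof (rule indep_vars_restrict[OF noise_indep])
    have "noise_at a \<inter> noise_at b = {}" if "a \<noteq> b" for a b
    proof (rule equals0I)
      fix s assume "s \<in> noise_at a \<inter> noise_at b"
      then show False using that by (cases s) auto
    qed
    then show "disjoint_family_on (\<lambda>k. noise_at k) {1..n}" unfolding disjoint_family_on_def by blast
  qed auto
  then have "indep_vars (\<lambda>_. count_space UNIV) (\<lambda>k \<omega>. response_of k (c k) (restrict (\<lambda>s. noise \<xi> \<epsilon> s \<omega>) (noise_at k))) {1..n}"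
    by (rule indep_vars_compose2) (auto intro: response_of_measurable)
  then show ?thesis
    by (subst (asm) indep_vars_cong[where Y = "\<lambda>k. response k (c k)"]) (auto simp: response_eq_response_of fun_eq_iff)
qed

lemma response_measurable: "k \<in> {1..n} \<Longrightarrow> response k c \<in> measurable M (count_space UNIV)"
  using indep_vars_measurable[OF responses_indep[of "\<lambda>_. c"]] by blast

lemma initial_measurable: "state p X 0 -` A \<inter> space M \<in> sets M"
proof -
  have "state p X 0 -` A \<inter> space M \<in> sets (vimage_algebra (space M) (state p X 0) (count_space UNIV))"
    by (rule in_vimage_algebra) simp
  then show ?thesis using indep_setD_ev1[OF initial_indep] by blast
qed

lemma prob_initial: "prob {\<omega>\<in>space M. state p X 0 \<omega> = v} = pmf G v"
proof -
  have m: "state p X 0 \<in> measurable M (count_space UNIV)" using initial_measurable by (intro measurableI) auto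
  have "prob {\<omega>\<in>space M. state p X 0 \<omega> = v} = measure (distr M (count_space UNIV) (state p X 0)) {v}"
    using m by (subst measure_distr) (auto intro!: arg_cong[where f = prob])
  then show ?thesis unfolding initial_law by (simp add: measure_pmf_single)
qed

text \<open>
  On the event that the path is \<open>h\<close>, the number of thinning variables used at each time is fixed by \<open>h\<close>. The event is
  therefore an intersection of independent ones: one about the initial vector and one for each time, about
  disjoint blocks of the noise.
\<close>

lemma prob_path_point:
  assumes k: "k \<le> n" and h: "\<And>j. \<not> (- int p < j \<and> j \<le> int k) \<Longrightarrow> h j = 0"
  shows "{\<omega>\<in>space M. path k \<omega> = h} \<in> sets M"
    and "prob {\<omega>\<in>space M. path k \<omega> = h} =
      pmf G (vec p (\<lambda>i. h (- int i))) * (\<Prod>j=1..k. pmf (step_law p \<alpha> (innov_law j) (\<lambda>i. h (int j - int i))) (h (int j)))"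
proof -
  let ?v = "vec p (\<lambda>i. h (- int i))" and ?c = "\<lambda>j i. h (int j - int i)"
  let ?A = "{\<omega>\<in>space M. state p X 0 \<omega> = ?v}" and ?B = "{\<omega>\<in>space M. \<forall>j\<in>{1..k}. response j (?c j) \<omega> = h (int j)}"
  have path_iff: "path k \<omega> = h \<longleftrightarrow> state p X 0 \<omega> = ?v \<and> (\<forall>j\<in>{1..k}. response j (?c j) \<omega> = h (int j))" if \<omega>: "\<omega> \<in> space M" for \<omega>
  proof
    assume ph: "path k \<omega> = h"
    have Xh: "X j \<omega> = h j" if "- int p < j" "j \<le> int k" for j using fun_cong[OF ph, of j] that unfolding path_def by simp
    have "state p X 0 \<omega> = ?v" unfolding state_def by (intro eq_vecI) (auto simp: Xh)
    moreover have "response j (?c j) \<omega> = h (int j)" if j: "j \<in> {1..k}" for j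
    proof -
      have "response j (?c j) \<omega> = (\<Sum>i=1..p. \<Sum>l=1..X (int j - int i) \<omega>. \<xi> i j l \<omega>) + \<epsilon> j \<omega>"
        unfolding response_def using j by (intro arg_cong2[where f = "(+)"] sum.cong refl) (auto simp: Xh)
      also have "\<dots> = X (int j) \<omega>" using recursion[of j \<omega>] j k \<omega> by simp
      also have "\<dots> = h (int j)" using j by (intro Xh) auto
      finally show ?thesis .
    qed
    ultimately show "state p X 0 \<omega> = ?v \<and> (\<forall>j\<in>{1..k}. response j (?c j) \<omega> = h (int j))" by blast
  next
    assume *: "state p X 0 \<omega> = ?v \<and> (\<forall>j\<in>{1..k}. response j (?c j) \<omega> = h (int j))"
    have neg: "X (- int i) \<omega> = h (- int i)" if "i < p" for i
    proof -
      have "state p X 0 \<omega> $ i = ?v $ i" using * by simp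
      then show ?thesis using that by (simp add: state_def)
    qed
    have Xh: "X j \<omega> = h j" if "- int p < j" "j \<le> int m" "m \<le> k" for j m
      using that
    proof (induction m arbitrary: j)
      case 0
      then have "X (- int (nat (- j))) \<omega> = h (- int (nat (- j)))" by (intro neg) auto
      then show ?case using 0 by simp
    next
      case (Suc m)
      show ?case
      proof (cases "j \<le> int m")
        case True
        then show ?thesis using Suc by simp
      next
        case False
        then have j: "j = int (Suc m)" using Suc.prems by simp
        have "X j \<omega> = (\<Sum>i=1..p. \<Sum>l=1..X (int (Suc m) - int i) \<omega>. \<xi> i (Suc m) l \<omega>) + \<epsilon> (Suc m) \<omega>"
          unfolding j using recursion[of "Suc m" \<omega>] Suc.prems k \<omega> by simp
        also have "\<dots> = response (Suc m) (?c (Suc m)) \<omega>"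
          unfolding response_def using Suc by (intro arg_cong2[where f = "(+)"] sum.cong refl) auto
        also have "\<dots> = h (int (Suc m))"
        proof -
          have "Suc m \<in> {1..k}" using Suc.prems by auto
          then show ?thesis using * by blast
        qed
        finally show ?thesis unfolding j .
      qed
    qed
    show "path k \<omega> = h" unfolding path_def using Xh[of _ k] h by (auto simp: fun_eq_iff)
  qed
  then have eq: "{\<omega>\<in>space M. path k \<omega> = h} = ?A \<inter> ?B" by auto
  have A: "?A \<in> sets (vimage_algebra (space M) (state p X 0) (count_space UNIV))"
    using in_vimage_algebra[of "{?v}" "count_space UNIV" "state p X 0" "space M"] by (simp add: vimage_def Int_def conj_commute)
  let ?N = "PiM (noise_indices p n) (\<lambda>_. count_space UNIV) :: (noise_index \<Rightarrow> nat) measure"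
  let ?D = "{f\<in>space ?N. \<forall>j\<in>{1..k}. response_of j (?c j) f = h (int j)}"
  have sub: "noise_at j \<subseteq> noise_indices p n" for j by auto
  have D: "?D \<in> sets ?N"
  proof (rule sets.sets_Collect_finite_All)
    fix j assume "j \<in> {1..k}"
    then have "response_of j (?c j) \<in> measurable ?N (count_space UNIV)" using k sub by (intro response_of_measurable) auto
    from measurable_sets[OF this, of "{h (int j)}"]
    show "{f\<in>space ?N. response_of j (?c j) f = h (int j)} \<in> sets ?N" by (simp add: vimage_def Int_def conj_commute)
  qed simp
  have Beq: "?B = (\<lambda>\<omega>. \<lambda>s\<in>noise_indices p n. noise \<xi> \<epsilon> s \<omega>) -` ?D \<inter> space M"
    using response_eq_response_of[OF _ sub] k by (auto simp: space_PiM)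
  have B: "?B \<in> sets (vimage_algebra (space M) (\<lambda>\<omega>. \<lambda>s\<in>noise_indices p n. noise \<xi> \<epsilon> s \<omega>) ?N)"
    unfolding Beq by (rule in_vimage_algebra[OF D])
  have "?A \<in> sets M" "?B \<in> sets M" using A B indep_setD_ev1[OF initial_indep] indep_setD_ev2[OF initial_indep] by blast+
  then show "{\<omega>\<in>space M. path k \<omega> = h} \<in> sets M" unfolding eq by simp
  have "prob (?A \<inter> ?B) = prob ?A * prob ?B" by (rule indep_setD[OF initial_indep A B])
  also have "prob ?A = pmf G ?v" by (rule prob_initial)
  also have "prob ?B = (\<Prod>j=1..k. pmf (step_law p \<alpha> (innov_law j) (?c j)) (h (int j)))"
  proof (rule prob_indep_points[OF responses_indep[of ?c]])
    show "finite {1..k}" "{1..k} \<subseteq> {1..n}" using k by auto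
    fix j assume j: "j \<in> {1..k}"
    then have jn: "j \<in> {1..n}" using k by auto
    show "distr M (count_space UNIV) (response j (?c j)) = measure_pmf (step_law p \<alpha> (innov_law j) (?c j))"
    proof (rule measure_eqI_countable_AE[where \<Omega> = UNIV])
      fix y
      have "emeasure (distr M (count_space UNIV) (response j (?c j))) {y} = emeasure M {\<omega>\<in>space M. response j (?c j) \<omega> = y}"
        by (subst emeasure_distr[OF response_measurable[OF jn]]) (auto intro!: arg_cong[where f = "emeasure M"])
      then show "emeasure (distr M (count_space UNIV) (response j (?c j))) {y} = emeasure (measure_pmf (step_law p \<alpha> (innov_law j) (?c j))) {y}"
        using prob_response[OF jn, of "?c j" y] by (simp add: emeasure_eq_measure emeasure_pmf_single)
    qed auto
  qed
  finally show "prob {\<omega>\<in>space M. path k \<omega> = h} =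
      pmf G ?v * (\<Prod>j=1..k. pmf (step_law p \<alpha> (innov_law j) (\<lambda>i. h (int j - int i))) (h (int j)))" unfolding eq .
qed

lemma initial_dimension: "v \<in> set_pmf G \<Longrightarrow> v \<in> carrier_vec p"
proof (rule ccontr)
  assume v: "v \<in> set_pmf G" "v \<notin> carrier_vec p"
  then have empty: "{\<omega>\<in>space M. state p X 0 \<omega> = v} = {}" by (auto simp: state_def)
  have "pmf G v = 0" unfolding prob_initial[symmetric] empty by simp
  then show False using v by (simp add: set_pmf_iff)
qed

lemma pmf_init_law:
  assumes h: "\<And>j. \<not> (- int p < j \<and> j \<le> 0) \<Longrightarrow> h j = 0"
  shows "pmf (init_law p G) h = pmf G (vec p (\<lambda>i. h (- int i)))"
proof -
  let ?f = "\<lambda>v :: nat vec. \<lambda>j. if - int p < j \<and> j \<le> 0 then v $ nat (- j) else 0"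
  have "?f v = h \<longleftrightarrow> v = vec p (\<lambda>i. h (- int i))" if v: "v \<in> carrier_vec p" for v
  proof
    assume "?f v = h"
    then show "v = vec p (\<lambda>i. h (- int i))" using v by (intro eq_vecI) auto
  next
    assume "v = vec p (\<lambda>i. h (- int i))"
    then show "?f v = h" using h by (auto simp: fun_eq_iff)
  qed
  then have iff: "?f v = h \<longleftrightarrow> v = vec p (\<lambda>i. h (- int i))" if "v \<in> set_pmf G" for v using that initial_dimension by blast
  have "pmf (init_law p G) h = measure_pmf.prob G (?f -` {h})" unfolding init_law_def by (simp add: pmf_map)
  also have "\<dots> = measure_pmf.prob G {vec p (\<lambda>i. h (- int i))}"
    by (rule measure_prob_cong_0) (use iff in \<open>auto simp: pmf_eq_0_set_pmf\<close>)
  finally show ?thesis by (simp add: measure_pmf_single)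
qed

text \<open>
  The observed path takes countably many values, so its law is determined by the probabilities of single paths.
\<close>

lemma path_measurable:
  assumes k: "k \<le> n"
  shows "path k \<in> measurable M (count_space UNIV)"
    and "distr M (count_space UNIV) (path k) = measure_pmf (path_law p \<alpha> (init_law p G) innov_law k)"
proof -
  let ?J = "{- int p<..int k}"
  let ?\<Omega> = "PiE_dflt ?J 0 (\<lambda>_. UNIV :: nat set)"
  have cnt: "countable ?\<Omega>" by (intro countable_PiE_dflt) auto
  have in\<Omega>: "path k \<omega> \<in> ?\<Omega>" for \<omega> unfolding path_def PiE_dflt_def by auto
  have zero: "h j = 0" if "h \<in> ?\<Omega>" "\<not> (- int p < j \<and> j \<le> int k)" for h j using that unfolding PiE_dflt_def by auto
  show meas: "path k \<in> measurable M (count_space UNIV)"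
  proof (rule measurableI)
    fix A
    have "path k -` A \<inter> space M = (\<Union>h\<in>?\<Omega> \<inter> A. {\<omega>\<in>space M. path k \<omega> = h})" using in\<Omega> by blast
    also have "\<dots> \<in> sets M" using cnt prob_path_point(1)[OF k] zero by (intro sets.countable_UN') auto
    finally show "path k -` A \<inter> space M \<in> sets M" .
  qed simp
  have init0: "x j = 0" if "x \<in> set_pmf (init_law p G)" "\<not> (- int p < j \<and> j \<le> 0)" for x j
    using that unfolding init_law_def by auto
  show "distr M (count_space UNIV) (path k) = measure_pmf (path_law p \<alpha> (init_law p G) innov_law k)"
  proof (rule measure_eqI_countable_AE[OF _ _ _ _ cnt])
    show "AE z in distr M (count_space UNIV) (path k). z \<in> ?\<Omega>"
      by (subst AE_distr_iff[OF meas]) (simp, intro always_eventually allI in\<Omega>)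
    have "x j = 0" if "x \<in> set_pmf (path_law p \<alpha> (init_law p G) innov_law m)" "\<not> (- int p < j \<and> j \<le> int m)" for x j m
      using that
    proof (induction m arbitrary: x)
      case (Suc m)
      then obtain x' y where "x' \<in> set_pmf (path_law p \<alpha> (init_law p G) innov_law m)" "x = x'(int (Suc m) := y)" by auto
      then show ?case using Suc.IH[of x'] Suc.prems by auto
    qed (use init0 in auto)
    then show "AE z in measure_pmf (path_law p \<alpha> (init_law p G) innov_law k). z \<in> ?\<Omega>"
      by (auto simp: AE_measure_pmf_iff PiE_dflt_def)
    fix h assume h: "h \<in> ?\<Omega>"
    have "emeasure (distr M (count_space UNIV) (path k)) {h} = emeasure M {\<omega>\<in>space M. path k \<omega> = h}"
      by (subst emeasure_distr[OF meas]) (auto intro!: arg_cong[where f = "emeasure M"])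
    also have "\<dots> = ennreal (pmf (path_law p \<alpha> (init_law p G) innov_law k) h)"
    proof -
      have "pmf (path_law p \<alpha> (init_law p G) innov_law k) h = pmf (init_law p G) (\<lambda>j. if j \<le> 0 then h j else 0) *
          (\<Prod>j=1..k. pmf (step_law p \<alpha> (innov_law j) (\<lambda>i. h (int j - int i))) (h (int j)))"
        by (rule pmf_path_law) (use init0 zero[OF h] in auto)
      also have "pmf (init_law p G) (\<lambda>j. if j \<le> 0 then h j else 0) = pmf G (vec p (\<lambda>i. h (- int i)))"
      proof (subst pmf_init_law)
        show "(if j \<le> 0 then h j else 0) = 0" if "\<not> (- int p < j \<and> j \<le> 0)" for j using zero[OF h, of j] that by auto
      qed simp
      finally have e: "pmf (path_law p \<alpha> (init_law p G) innov_law k) h = prob {\<omega>\<in>space M. path k \<omega> = h}"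
        using prob_path_point(2)[OF k, of h] zero[OF h] by simp
      show ?thesis unfolding e by (simp add: emeasure_eq_measure)
    qed
    finally show "emeasure (distr M (count_space UNIV) (path k)) {h} = emeasure (measure_pmf (path_law p \<alpha> (init_law p G) innov_law k)) {h}"
      by (simp add: emeasure_pmf_single)
  qed auto
qed

end

section \<open>The maximum of the cumulated residuals\<close>

lemma nat_power4_le_power6: "real (x :: nat) ^ 4 \<le> real x ^ 6"
  by (cases "x = 0") (auto intro: power_increasing)

lemma integrable_power4_of_power6:
  fixes f :: "'b \<Rightarrow> nat"
  assumes f: "f \<in> measurable N (count_space UNIV)" and 6: "integrable N (\<lambda>x. real (f x) ^ 6)"
  shows "integrable N (\<lambda>x. real (f x) ^ 4)"
proof (rule Bochner_Integration.integrable_bound[OF 6])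
  show "(\<lambda>x. real (f x) ^ 4) \<in> borel_measurable N"
    by (rule measurable_compose[OF f]) simp
  show "AE x in N. norm (real (f x) ^ 4) \<le> norm (real (f x) ^ 6)"
    using nat_power4_le_power6 by (intro always_eventually) auto
qed

context inar_with_change
begin

lemma innovation_fourth_moment:
  assumes k: "k \<in> {1..n}" and 6: "integrable M (\<lambda>\<omega>. real (\<epsilon> k \<omega>) ^ 6)"
  shows "integrable (measure_pmf (innov_law k)) (\<lambda>e. real e ^ 4)"
proof -
  note m = innovation_measurable[OF k]
  have "integrable (distr M (count_space UNIV) (\<epsilon> k)) (\<lambda>e. real e ^ 4)"
    using integrable_power4_of_power6[OF m 6] by (subst integrable_distr_eq[OF m]) auto
  then show ?thesis unfolding innovation_law[OF k] innov_law_def .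
qed

lemma initial_fourth_moment:
  assumes i: "i < p" and 6: "integrable M (\<lambda>\<omega>. real (X (- int i) \<omega>) ^ 6)"
  shows "integrable (init_law p G) (\<lambda>x. real (x (- int i)) ^ 4)"
proof -
  have m: "state p X 0 \<in> measurable M (count_space UNIV)" using initial_measurable by (intro measurableI) auto
  have "(\<lambda>\<omega>. state p X 0 \<omega> $ i) \<in> measurable M (count_space UNIV)"
    by (rule measurable_compose[OF m]) simp
  then have Xm: "(\<lambda>\<omega>. X (- int i) \<omega>) \<in> measurable M (count_space UNIV)" using i by (simp add: state_def)
  have "integrable (distr M (count_space UNIV) (state p X 0)) (\<lambda>v. real (v $ i) ^ 4)"
    using integrable_power4_of_power6[OF Xm 6] i by (subst integrable_distr_eq[OF m]) (auto simp: state_def)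
  then have "integrable (measure_pmf G) (\<lambda>v. real (v $ i) ^ 4)" unfolding initial_law .
  then show ?thesis unfolding init_law_def using i by simp
qed

lemma Q_matrix_path: "Q_matrix p n (\<lambda>j x. x j) (path n \<omega>) = Q_matrix p n X \<omega>"
  and XY_vector_path: "XY_vector p n (\<lambda>j x. x j) (path n \<omega>) = XY_vector p n X \<omega>"
  and residual_path: "k \<in> {1..n} \<Longrightarrow> residual p (\<lambda>j x. x j) (\<lambda>_. \<theta> \<omega>) k (path n \<omega>) = residual p X \<theta> k \<omega>"
proof -
  have s: "state p (\<lambda>j x. x j) (int k - 1) (path n \<omega>) = state p X (int k - 1) \<omega>" if "k \<in> {1..n}" for k
    unfolding state_def path_def using that by (intro eq_vecI) auto
  have x: "path n \<omega> (int k) = X (int k) \<omega>" if "k \<in> {1..n}" for k unfolding path_def using that by auto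
  show "Q_matrix p n (\<lambda>j x. x j) (path n \<omega>) = Q_matrix p n X \<omega>"
    unfolding Q_matrix_def using s by (intro cong_mat) (auto intro!: sum.cong)
  show "XY_vector p n (\<lambda>j x. x j) (path n \<omega>) = XY_vector p n X \<omega>"
    unfolding XY_vector_def using s x by (intro eq_vecI) (auto intro!: sum.cong)
  show "k \<in> {1..n} \<Longrightarrow> residual p (\<lambda>j x. x j) (\<lambda>_. \<theta> \<omega>) k (path n \<omega>) = residual p X \<theta> k \<omega>"
    unfolding residual_def using s x by simp
qed

end

theorem theorem4p1:
  fixes p :: nat and \<rho> \<mu>' \<mu>'' \<psi> :: real and \<alpha> :: "nat \<Rightarrow> real" and \<tau> :: "nat \<Rightarrow> nat"
    and G :: "nat vec pmf" and F' F'' :: "nat pmf"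
    and \<pi>' \<pi>'' :: "nat vec pmf" and C' C'' Q :: "real mat"
    and M :: "nat \<Rightarrow> 'a measure"
    and \<xi> :: "nat \<Rightarrow> nat \<Rightarrow> nat \<Rightarrow> nat \<Rightarrow> 'a \<Rightarrow> nat"
    and \<epsilon> :: "nat \<Rightarrow> nat \<Rightarrow> 'a \<Rightarrow> nat"
    and X :: "nat \<Rightarrow> int \<Rightarrow> 'a \<Rightarrow> nat"
    and \<theta> :: "nat \<Rightarrow> 'a \<Rightarrow> real vec"
  assumes p: "1 \<le> p"
    and \<rho>: "0 < \<rho>" "\<rho> < 1"
    and \<tau>: "\<And>n. \<tau> n = max (nat \<lfloor>real n * \<rho>\<rfloor>) 1"
    and \<alpha>: "\<And>i. i \<in> {1..p} \<Longrightarrow> 0 \<le> \<alpha> i \<and> \<alpha> i \<le> 1"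
    and inar: "\<And>n. 2 \<le> n \<Longrightarrow>
      inar_with_change (M n) p n (\<tau> n) \<alpha> G F' F'' (\<xi> n) (\<epsilon> n) (X n)"
    and \<mu>': "\<mu>' = measure_pmf.expectation F' real"
    and \<mu>'': "\<mu>'' = measure_pmf.expectation F'' real"
    and mean_change: "\<mu>' > \<mu>''" "\<mu>'' > 0"
    and initial_moments: "\<And>n i. 2 \<le> n \<Longrightarrow> i < p \<Longrightarrow>
      integrable (M n) (\<lambda>\<omega>. real (X n (- int i) \<omega>) ^ 6)"
    and innovation_moments:
      "\<And>n. 2 \<le> n \<Longrightarrow> integrable (M n) (\<lambda>\<omega>. real (\<epsilon> n 1 \<omega>) ^ 6)"
      "\<And>n. 2 \<le> n \<Longrightarrow> integrable (M n) (\<lambda>\<omega>. real (\<epsilon> n (\<tau> n + 1) \<omega>) ^ 6)"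
    and stable: "(\<Sum>i=1..p. \<alpha> i) < 1"
    and nondegenerate: "(\<Sum>i=1..p. \<alpha> i) > 0 \<or>
      (measure_pmf.variance F' real > 0 \<and> measure_pmf.variance F'' real > 0)"
    and stationary: "inar_stationary p \<alpha> F' \<pi>'" "inar_stationary p \<alpha> F'' \<pi>''"
    and C': "C' = second_moment p \<pi>'"
    and C'': "C'' = second_moment p \<pi>''"
    and Q: "Q = \<rho> \<cdot>\<^sub>m C' + (1 - \<rho>) \<cdot>\<^sub>m C''"
    and \<psi>: "\<psi> = \<rho> * (1 - \<rho>) * (\<mu>' - \<mu>'') *
      (unit_vec (p + 1) p \<bullet> ((C'' * inverse_mat Q * C') *\<^sub>v unit_vec (p + 1) p))"
    and estimator: "\<And>n. 2 \<le> n \<Longrightarrow> cls_estimator (M n) p n (X n) (\<theta> n)"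
  shows "\<psi> > 0 \<and>
    (\<forall>\<gamma>. 0 < \<gamma> \<and> \<gamma> < 1 / 4 \<longrightarrow>
      O_P M
        (\<lambda>n \<omega>. (MAX k\<in>{1..n}. \<Sum>j=1..k. residual p (X n) (\<theta> n) j \<omega>) - real n * \<psi>)
        (\<lambda>n. real n powr (1 - \<gamma>)))"
proof -
  have \<tau>_le: "\<tau> n + 1 \<le> n" if "2 \<le> n" for n
  proof -
    have "real n * \<rho> < real n" using \<rho> that by simp
    then have "\<lfloor>real n * \<rho>\<rfloor> < int n" by linarith
    then show ?thesis unfolding \<tau> using that by simp
  qed
  have \<tau>_pos: "1 \<le> \<tau> n" for n unfolding \<tau> by simp
  interpret stable_inar p \<alpha> by unfold_locales (use p \<alpha> stable in auto)
  interpret two: inar_with_change "M 2" p 2 "\<tau> 2" \<alpha> G F' F'' "\<xi> 2" "\<epsilon> 2" "X 2" by (rule inar) simp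
  have F'4: "integrable F' (\<lambda>e. real e ^ 4)"
    using two.innovation_fourth_moment[of 1] innovation_moments(1)[of 2] \<tau>_pos[of 2] by (simp add: two.innov_law_def)
  have F''4: "integrable F'' (\<lambda>e. real e ^ 4)"
    using two.innovation_fourth_moment[of "\<tau> 2 + 1"] innovation_moments(2)[of 2] \<tau>_le[of 2] by (simp add: two.innov_law_def)
  interpret changing_inar p \<alpha> F' F'' "init_law p G"
    by unfold_locales (use F'4 F''4 two.initial_fourth_moment initial_moments[of 2] in auto)
  interpret before: stationary_inar p \<alpha> F' \<pi>' by unfold_locales (use F'4 stationary in auto)
  interpret after: stationary_inar p \<alpha> F'' \<pi>'' by unfold_locales (use F''4 stationary in auto)
  have \<mu>'_pos: "innov_mean F' > 0" and \<mu>''_pos: "innov_mean F'' > 0" and change: "innov_mean F'' < innov_mean F'"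
    using mean_change unfolding \<mu>' \<mu>'' by linarith+
  have pd': "pos_def (p + 1) (moment_matrix before.m before.lag_product)"
    using before.second_moment_pos_def[OF _ \<mu>'_pos] nondegenerate unfolding before.second_moment_eq by blast
  have pd'': "pos_def (p + 1) (moment_matrix after.m after.lag_product)"
    using after.second_moment_pos_def[OF _ \<mu>''_pos] nondegenerate unfolding after.second_moment_eq by blast
  note approx = residual_max_approx[OF before.yule_walker_solution after.yule_walker_solution pd' pd'' \<rho> change,
      folded before.second_moment_eq after.second_moment_eq C' C'', folded Q, folded \<mu>' \<mu>'', folded \<psi>]
  have "0 < \<psi>" by (rule approx(1)[of 0]) simp
  moreover have "O_P M (\<lambda>n \<omega>. (MAX k\<in>{1..n}. \<Sum>j=1..k. residual p (X n) (\<theta> n) j \<omega>) - real n * \<psi>)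
        (\<lambda>n. real n powr (1 - \<gamma>))" if \<gamma>: "0 < \<gamma>" "\<gamma> < 1 / 4" for \<gamma>
    unfolding O_P_def
  proof (intro allI impI)
    fix \<delta> :: real assume \<delta>: "0 < \<delta>"
    let ?r = "\<lambda>n. real n powr (1 - \<gamma>)"
    obtain K where K: "0 < K" and rare: "\<And>Fs n t. Fs \<in> regimes \<Longrightarrow> 1 \<le> n \<Longrightarrow> t \<le> n \<Longrightarrow>
      measure_pmf.prob (paths Fs n) {x. \<exists>k\<in>grid n t. (K * ?r n) ^ 2 \<le> fluctuation Fs k x} < \<delta>"
      using fluctuations_small[of \<gamma> \<delta>] \<gamma> \<delta> by auto
    obtain K2 c0 where K2: "0 \<le> K2" "0 \<le> c0" and good: "\<And>n t r x \<theta>. 1 \<le> n \<Longrightarrow> 1 \<le> t \<Longrightarrow> t \<le> n \<Longrightarrow>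
      \<bar>real t - real n * \<rho>\<bar> \<le> 1 \<Longrightarrow> sqrt (real n) \<le> r \<Longrightarrow> r \<le> real n \<Longrightarrow> c0 * r \<le> real n \<Longrightarrow>
      \<forall>k\<in>grid n t. fluctuation (regime t) k x < (K * r) ^ 2 \<Longrightarrow> \<theta> x \<in> carrier_vec (p + 1) \<Longrightarrow>
      invertible_mat (Q_matrix p n (\<lambda>j x. x j) x) \<longrightarrow>
        \<theta> x = inverse_mat (Q_matrix p n (\<lambda>j x. x j) x) *\<^sub>v XY_vector p n (\<lambda>j x. x j) x \<Longrightarrow>
      \<bar>(MAX k\<in>{1..n}. \<Sum>j=1..k. residual p (\<lambda>j x. x j) \<theta> j x) - real n * \<psi>\<bar> \<le> K2 * r"
      using approx(2)[OF less_imp_le[OF K]] by blast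
    have "((\<lambda>n. c0 * real n powr (- \<gamma>)) \<longlongrightarrow> c0 * 0) sequentially"
      using \<gamma> by (intro tendsto_mult tendsto_const tendsto_neg_powr filterlim_real_sequentially) auto
    then have ev1: "\<forall>\<^sub>F n in sequentially. c0 * real n powr (- \<gamma>) < 1" by (rule order_tendstoD) simp
    have ev2: "\<forall>\<^sub>F n in sequentially. 1 / \<rho> \<le> real n"
      using eventually_ge_at_top[of "nat \<lceil>1 / \<rho>\<rceil>"] by eventually_elim linarith
    have "\<forall>\<^sub>F n in sequentially. measure (M n) {\<omega> \<in> space (M n).
        \<bar>(MAX k\<in>{1..n}. \<Sum>j=1..k. residual p (X n) (\<theta> n) j \<omega>) - real n * \<psi>\<bar> > K2 * ?r n} < \<delta>"
      using ev1 ev2 eventually_ge_at_top[of 2]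
    proof eventually_elim
      case (elim n)
      interpret N: inar_with_change "M n" p n "\<tau> n" \<alpha> G F' F'' "\<xi> n" "\<epsilon> n" "X n" by (rule inar) (use elim in simp)
      have n: "1 \<le> n" using elim by simp
      have t: "1 \<le> \<tau> n" "\<tau> n \<le> n" using \<tau>_pos \<tau>_le[of n] elim by auto
      have "1 \<le> real n * \<rho>" using elim(2) \<rho> by (simp add: field_simps)
      then have fl: "1 \<le> \<lfloor>real n * \<rho>\<rfloor>" by linarith
      then have "\<tau> n = nat \<lfloor>real n * \<rho>\<rfloor>" unfolding \<tau> by (intro max_absorb1) linarith
      then have "real (\<tau> n) = of_int \<lfloor>real n * \<rho>\<rfloor>" using fl by simp
      then have t\<rho>: "\<bar>real (\<tau> n) - real n * \<rho>\<bar> \<le> 1" by linarith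
      have "real n powr (1 / 2) \<le> ?r n" using n \<gamma> by (intro powr_mono) auto
      then have r1: "sqrt (real n) \<le> ?r n" by (simp add: powr_half_sqrt)
      have "?r n \<le> real n powr 1" using n \<gamma> by (intro powr_mono) auto
      then have r2: "?r n \<le> real n" using n by simp
      have "?r n = real n * real n powr (- \<gamma>)" using n powr_add[of "real n" 1 "- \<gamma>"] by simp
      then have "c0 * ?r n = real n * (c0 * real n powr (- \<gamma>))" by simp
      also have "\<dots> \<le> real n * 1" using elim(1) by (intro mult_left_mono) auto
      finally have r3: "c0 * ?r n \<le> real n" by simp
      have law: "N.innov_law = regime (\<tau> n)" unfolding N.innov_law_def regime_def by (rule ext) simp
      let ?bad = "{x. \<exists>k\<in>grid n (\<tau> n). (K * ?r n) ^ 2 \<le> fluctuation (regime (\<tau> n)) k x}"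
      let ?large = "{\<omega> \<in> space (M n). \<bar>(MAX k\<in>{1..n}. \<Sum>j=1..k. residual p (X n) (\<theta> n) j \<omega>) - real n * \<psi>\<bar> > K2 * ?r n}"
      have "?large \<subseteq> N.path n -` ?bad \<inter> space (M n)"
      proof
        fix \<omega> assume \<omega>: "\<omega> \<in> ?large"
        have "N.path n \<omega> \<in> ?bad"
        proof (rule ccontr)
          assume "N.path n \<omega> \<notin> ?bad"
          then have small: "\<forall>k\<in>grid n (\<tau> n). fluctuation (regime (\<tau> n)) k (N.path n \<omega>) < (K * ?r n) ^ 2" by (auto simp: not_le)
          have est: "cls_estimator (M n) p n (X n) (\<theta> n)" using estimator elim by simp
          have "\<bar>(MAX k\<in>{1..n}. \<Sum>j=1..k. residual p (\<lambda>j x. x j) (\<lambda>_. \<theta> n \<omega>) j (N.path n \<omega>)) - real n * \<psi>\<bar> \<le> K2 * ?r n"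
            by (rule good[OF n t t\<rho> r1 r2 r3 small])
              (use est \<omega> in \<open>auto simp: cls_estimator_def N.Q_matrix_path N.XY_vector_path\<close>)
          moreover have "(MAX k\<in>{1..n}. \<Sum>j=1..k. residual p (\<lambda>j x. x j) (\<lambda>_. \<theta> n \<omega>) j (N.path n \<omega>)) =
             (MAX k\<in>{1..n}. \<Sum>j=1..k. residual p (X n) (\<theta> n) j \<omega>)"
            by (intro arg_cong[where f = Max] image_cong refl sum.cong N.residual_path) auto
          ultimately show False using \<omega> by simp
        qed
        then show "\<omega> \<in> N.path n -` ?bad \<inter> space (M n)" using \<omega> by simp
      qed
      then have "measure (M n) ?large \<le> measure (M n) (N.path n -` ?bad \<inter> space (M n))"
        by (intro N.finite_measure_mono measurable_sets[OF N.path_measurable(1)]) auto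
      also have "\<dots> = measure (distr (M n) (count_space UNIV) (N.path n)) ?bad"
        by (rule measure_distr[symmetric]) (auto intro: N.path_measurable(1))
      also have "\<dots> = measure_pmf.prob (paths (regime (\<tau> n)) n) ?bad"
        unfolding N.path_measurable(2)[OF order_refl] law ..
      also have "\<dots> < \<delta>" by (rule rare[OF regime_in_regimes n t(2)])
      finally show ?case .
    qed
    then show "\<exists>K. \<forall>\<^sub>F n in sequentially. measure (M n) {\<omega> \<in> space (M n).
        \<bar>(MAX k\<in>{1..n}. \<Sum>j=1..k. residual p (X n) (\<theta> n) j \<omega>) - real n * \<psi>\<bar> > K * ?r n} < \<delta>" by blast
  qed
  ultimately show ?thesis by blast
qed

end
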